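(* Let $\mathcal{H}\ge 1$ be a real number and let $K$ be an algebraic number field such that $$\mathcal{H}\, c_K < \min\{H(\alpha) : \alpha\in O_K \text{ and } K=\mathbb{Q}(\alpha)\}.$$ Let $F\subseteq K$ be the maximal totally real subfield of $K$. Then $K$ is totally complex, $K/F$ is a Galois extension, and every $\mu\in O_K$ with $H(\mu)\le \mathcal{H}$ is contained in $F$.
   Context: $O_K$ denotes the ring of algebraic integers of $K$. Let $d=[K:\mathbb{Q}]$, let $\Delta_K$ be the discriminant of $K$, and let $s$ be the number of complex (non-real) archimedean places of $K$. Define $c_K = (2/\pi)^{s/d}\,|\Delta_K|^{1/(2d)}$. For each place $v$ of $K$, let $\|\cdot\|_v$ be the absolute value from $v$ extending the usual absolute value on $\mathbb{Q}$ or the standard $p$-adic absolute value on $\mathbb{Q}_p$, let $d_v=[K_v:\mathbb{Q}_v]$, and set $|\cdot|_v=\|\cdot\|_v^{d_v/d}$. The absolute multiplicative Weil height of $\alpha\in K^\times$ is $H(\alpha)=\prod_v \max\{1,|\alpha|_v\}$. A field is totally real if all its embeddings into $\mathbb{C}$ land in $\mathbb{R}$, and totally complex if none do. *)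

theory Defs
  imports
    "HOL-Algebra.Finite_Extensions"
    "HOL-Algebra.QuotRing"
    "HOL-Algebra.Generated_Fields"
    "HOL-Library.FuncSet"
    "Jordan_Normal_Form.VS_Connect"
    "Jordan_Normal_Form.Determinant"
begin

text \<open>A number field \<open>K\<close> is a type \<open>'a\<close> of characteristic zero that has finite degree over
  its prime field \<open>\<rat>\<close>.  Seen as an \<open>HOL-Algebra\<close> structure it is \<open>class_ring\<close>, and subfields
  of \<open>K\<close> are sets \<open>F\<close> with \<open>subfield F class_ring\<close>.\<close>

definition number_field :: "'a::field_char_0 itself \<Rightarrow> bool" where
  "number_field _ \<longleftrightarrow> ring.finite_dimension (class_ring :: 'a ring) \<rat> UNIV"

definition field_degree :: "'a::field_char_0 itself \<Rightarrow> nat" where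
  "field_degree _ = ring.dim (class_ring :: 'a ring) \<rat> UNIV"

definition ring_of_integers :: "'a::field_char_0 set" where
  "ring_of_integers = {x. algebraic_int x}"

definition adjoin_to_Rats :: "'a::field_char_0 \<Rightarrow> 'a set" where
  "adjoin_to_Rats \<alpha> = generate_field class_ring {\<alpha>}"

text \<open>Extensionality makes an embedding of a proper subfield \<open>L\<close> a unique function.\<close>

definition embeddings :: "'a::field_char_0 set \<Rightarrow> ('a \<Rightarrow> complex) set" where
  "embeddings L = Ring.ring_hom (class_ring\<lparr>carrier := L\<rparr>) class_ring \<inter> extensional L"

definition totally_real :: "'a::field_char_0 set \<Rightarrow> bool" where
  "totally_real L \<longleftrightarrow> (\<forall>\<sigma>\<in>embeddings L. \<sigma> ` L \<subseteq> \<real>)"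

definition totally_complex :: "'a::field_char_0 set \<Rightarrow> bool" where
  "totally_complex L \<longleftrightarrow> (\<forall>\<sigma>\<in>embeddings L. \<not> \<sigma> ` L \<subseteq> \<real>)"

definition max_totally_real_subfield :: "'a::field_char_0 set" where
  "max_totally_real_subfield = (GREATEST L. subfield L class_ring \<and> totally_real L)"

definition field_automorphisms :: "'a::field_char_0 set \<Rightarrow> ('a \<Rightarrow> 'a) set" where
  "field_automorphisms F = {\<tau> \<in> ring_iso class_ring class_ring. \<forall>x\<in>F. \<tau> x = x}"

text \<open>The whole type is Galois over \<open>F\<close>: it is algebraic over \<open>F\<close>, and \<open>F\<close> is the fixed field
  of the group of \<open>F\<close>-automorphisms.\<close>

definition galois_over :: "'a::field_char_0 set \<Rightarrow> bool" where
  "galois_over F \<longleftrightarrow> subfield F class_ring \<and>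
     (\<forall>x. (ring.algebraic class_ring over F) x) \<and>
     {x. \<forall>\<tau>\<in>field_automorphisms F. \<tau> x = x} = F"

definition integral_basis :: "'a::field_char_0 list \<Rightarrow> bool" where
  "integral_basis \<omega> \<longleftrightarrow> set \<omega> \<subseteq> ring_of_integers \<and>
     (\<forall>x\<in>ring_of_integers. \<exists>!c::int list. length c = length \<omega> \<and>
        x = (\<Sum>i<length \<omega>. of_int (c ! i) * \<omega> ! i))"

text \<open>The square of \<open>det (\<sigma>\<^sub>i \<omega>\<^sub>j)\<close> is an integer that depends neither on the integral basis
  nor on the enumeration of the embeddings.\<close>

definition discriminant :: "'a::field_char_0 itself \<Rightarrow> int" where
  "discriminant _ = (THE D. \<exists>(\<omega> :: 'a list) \<sigma>.
     integral_basis \<omega> \<and> distinct \<sigma> \<and> set \<sigma> = embeddings UNIV \<and>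
     of_int D = (det (mat (length \<sigma>) (length \<omega>) (\<lambda>(i, j). (\<sigma> ! i) (\<omega> ! j))))\<^sup>2)"

definition absolute_value :: "('a::field_char_0 \<Rightarrow> real) \<Rightarrow> bool" where
  "absolute_value v \<longleftrightarrow> (\<forall>x. 0 \<le> v x) \<and> (\<forall>x. v x = 0 \<longleftrightarrow> x = 0) \<and>
     (\<forall>x y. v (x * y) = v x * v y) \<and> (\<forall>x y. v (x + y) \<le> v x + v y)"

definition padic_abs :: "nat \<Rightarrow> rat \<Rightarrow> real" where
  "padic_abs p q = (if q = 0 then 0 else
     (case quotient_of q of (a, b) \<Rightarrow>
        real p powi (int (multiplicity (int p) b) - int (multiplicity (int p) a))))"

text \<open>A place is represented by the unique absolute value \<open>\<parallel>\<cdot>\<parallel>\<^sub>v\<close> in its equivalence class that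
  extends the usual absolute value or a standard \<open>p\<close>-adic absolute value of \<open>\<rat>\<close>.\<close>

definition archimedean_places :: "('a::field_char_0 \<Rightarrow> real) set" where
  "archimedean_places = {v. absolute_value v \<and> (\<forall>q. v (of_rat q) = \<bar>of_rat q\<bar>)}"

definition nonarchimedean_places :: "('a::field_char_0 \<Rightarrow> real) set" where
  "nonarchimedean_places =
     {v. absolute_value v \<and> (\<exists>p. prime p \<and> (\<forall>q. v (of_rat q) = padic_abs p q))}"

definition places :: "('a::field_char_0 \<Rightarrow> real) set" where
  "places = archimedean_places \<union> nonarchimedean_places"

definition complex_places :: "('a::field_char_0 \<Rightarrow> real) set" where
  "complex_places = {v \<in> archimedean_places.
     \<exists>\<sigma>\<in>embeddings UNIV. \<not> range \<sigma> \<subseteq> \<real> \<and> v = (\<lambda>x. cmod (\<sigma> x))}"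

text \<open>The completion \<open>K\<^sub>v\<close> is the ring of \<open>v\<close>-Cauchy sequences modulo null sequences, and \<open>\<rat>\<^sub>v\<close>
  sits in it as the classes of Cauchy sequences of rationals.\<close>

definition cauchy_ring :: "('a::field_char_0 \<Rightarrow> real) \<Rightarrow> (nat \<Rightarrow> 'a) ring" where
  "cauchy_ring v =
     \<lparr>carrier = {x. \<forall>e>0. \<exists>N. \<forall>m\<ge>N. \<forall>n\<ge>N. v (x m - x n) < e},
      mult = (\<lambda>x y n. x n * y n), one = (\<lambda>n. 1), zero = (\<lambda>n. 0),
      add = (\<lambda>x y n. x n + y n)\<rparr>"

definition null_sequences :: "('a::field_char_0 \<Rightarrow> real) \<Rightarrow> (nat \<Rightarrow> 'a) set" where
  "null_sequences v = {x. (\<lambda>n. v (x n)) \<longlonglongrightarrow> 0}"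

definition completion :: "('a::field_char_0 \<Rightarrow> real) \<Rightarrow> (nat \<Rightarrow> 'a) set ring" where
  "completion v = cauchy_ring v Quot null_sequences v"

definition rational_completion :: "('a::field_char_0 \<Rightarrow> real) \<Rightarrow> (nat \<Rightarrow> 'a) set set" where
  "rational_completion v =
     {null_sequences v +>\<^bsub>cauchy_ring v\<^esub> x | x. x \<in> carrier (cauchy_ring v) \<and> range x \<subseteq> \<rat>}"

definition local_degree :: "('a::field_char_0 \<Rightarrow> real) \<Rightarrow> nat" where
  "local_degree v =
     ring.dim (completion v) (rational_completion v) (carrier (completion v))"

definition normalized_abs :: "('a::field_char_0 \<Rightarrow> real) \<Rightarrow> 'a \<Rightarrow> real" where
  "normalized_abs v \<alpha> = v \<alpha> powr (real (local_degree v) / real (field_degree TYPE('a)))"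

text \<open>All but finitely many factors equal \<open>1\<close>; a product over the infinite set of all places
  would be \<open>1\<close> by convention, so the trivial factors are left out.\<close>

definition weil_height :: "'a::field_char_0 \<Rightarrow> real" where
  "weil_height \<alpha> = (\<Prod>v \<in> {v \<in> places. max 1 (normalized_abs v \<alpha>) \<noteq> 1}.
     max 1 (normalized_abs v \<alpha>))"

definition field_constant :: "'a::field_char_0 itself \<Rightarrow> real" where
  "field_constant _ =
     (2 / pi) powr (real (card (complex_places :: ('a \<Rightarrow> real) set)) / real (field_degree TYPE('a)))
     * \<bar>real_of_int (discriminant TYPE('a))\<bar> powr (1 / (2 * real (field_degree TYPE('a))))"

end

theory Submission
  imports Defs "HOL-Analysis.Analysis" "HOL-Computational_Algebra.Fundamental_Theorem_Algebra"
begin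

text \<open>Let \<open>\<mu> \<noteq> 0\<close> be an integer of height at most \<open>\<H>\<close> and \<open>\<sigma>\<close> an embedding of \<open>K\<close>.
  Minkowski's theorem gives an integer \<open>\<alpha> \<noteq> 0\<close> with \<open>\<bar>\<tau> \<alpha>\<bar> < 1 / max 1 \<bar>\<tau> \<mu>\<bar>\<close> for all embeddings
  \<open>\<tau>\<close> other than \<open>\<sigma>\<close> and its complex conjugate, such that the heights of \<open>\<alpha>\<close> and \<open>\<mu> \<alpha>\<close>
  exceed \<open>\<H> c\<^sub>K\<close> by as little as desired, if at all.  Hence neither generates \<open>K\<close>, so each of them has the same image under
  \<open>\<sigma>\<close> and some other embedding.  The norm of a nonzero integer is at least \<open>1\<close>, so
  \<open>\<bar>\<sigma> \<alpha>\<bar> \<ge> 1 > \<bar>\<tau> \<alpha>\<bar>\<close>, and that other embedding can only be the conjugate of \<open>\<sigma>\<close>.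
  Therefore \<open>\<sigma>\<close> is not real, while \<open>\<sigma> \<alpha>\<close>, \<open>\<sigma> (\<mu> \<alpha>)\<close> and with them \<open>\<sigma> \<mu>\<close> are real.  Moreover
  only \<open>\<sigma>\<close> and its conjugate extend the restriction of \<open>\<sigma>\<close> to \<open>\<rat>(\<alpha>)\<close>, so \<open>K\<close> is quadratic over
  \<open>\<rat>(\<alpha>)\<close> and complex conjugation at \<open>\<sigma>\<close> is induced by an automorphism of \<open>K\<close>.  An element
  fixed by these automorphisms for all \<open>\<sigma>\<close> is totally real.\<close>

text \<open>The \<open>d\<close>-th power of c_K, namely (2/pi)^s times the square root of the
  absolute discriminant, is the threshold of Minkowski's theorem: once the product of the radii
  prescribed at all embeddings exceeds it, some nonzero integer lies below all of them. The radii 1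
  / max 1 |\<tau> \<mu>| keep both \<alpha> and \<mu> \<alpha> below 1 away from \<sigma>, so that
  only \<sigma> and its conjugate contribute to either height. What these radii take from the volume
  has to be returned at \<sigma>, and multiplication by \<mu> costs its size at \<sigma> once more;
  together this is the factor H(\<mu>)^d, which is why \<H> and c_K enter as a product. The
  hypothesis is strict, which leaves room for a product of radii strictly above the threshold. Much
  of the remaining work connects the definitions with embeddings. A place is an arbitrary absolute
  value and a local degree is the dimension of a completion, so the archimedean places have to be
  classified before the height becomes a product over embeddings; the discriminant is a definite
  description, so an integral basis has to be constructed.\<close>

no_notation Matrix.vec_index (infixl "$" 100)
hide_const (open) Matrix.mat Matrix.vec

section \<open>Linear algebra over the rational numbers\<close>

lemma ring_class_ring: "ring (class_ring :: 'a::field_char_0 ring)"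
  by (rule class_ring.ring_axioms)

text \<open>Turns the structure-based predicate into closure conditions that \<open>simp\<close> can
  check for concrete sets. Since \<open>inverse 0 = 0\<close>, the last condition may include
  zero.\<close>

lemma subfield_class_ring_iff:
  "subfield L (class_ring :: 'a::field_char_0 ring) \<longleftrightarrow>
     1 \<in> L \<and> (\<forall>x\<in>L. \<forall>y\<in>L. x - y \<in> L \<and> x * y \<in> L) \<and> (\<forall>x\<in>L. inverse x \<in> L)"
  (is "?A \<longleftrightarrow> ?B")
proof
  assume A: ?A
  note sr = subfieldE(1)[OF A]
  have one: "1 \<in> L" using subringE(3)[OF sr] by simp
  have zero: "0 \<in> L" using subringE(2)[OF sr] by simp
  have neg: "- x \<in> L" if "x \<in> L" for x
    using subringE(5)[OF sr that] by (simp add: class_ring_simps)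
  have add: "x + y \<in> L" if "x \<in> L" "y \<in> L" for x y
    using subringE(7)[OF sr that] by simp
  have mult: "x * y \<in> L" if "x \<in> L" "y \<in> L" for x y
    using subringE(6)[OF sr that] by simp
  have "inverse x \<in> L" if "x \<in> L" for x
  proof (cases "x = 0")
    case False
    then show ?thesis using ring.subfield_m_inv(1)[OF ring_class_ring A, of x] that by (simp add: class_ring_simps)
  qed (use zero in simp)
  then show ?B using one add[OF _ neg] mult by (simp add: diff_conv_add_uminus del: add_uminus_conv_diff)
next
  assume B: ?B
  then have zero: "0 \<in> L" by (metis cancel_comm_monoid_add_class.diff_cancel)
  have neg: "- x \<in> L" if "x \<in> L" for x using B zero that by (metis diff_0)
  have add: "x + y \<in> L" if "x \<in> L" "y \<in> L" for x y
    using B neg that by (metis diff_minus_eq_add)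
  show ?A
  proof (rule field.subfieldI'[OF class_field])
    show "subring L (class_ring :: 'a ring)"
      by (rule ring.subringI[OF ring_class_ring]) (use B neg add in \<open>auto simp: class_ring_simps\<close>)
  qed (use B in \<open>auto simp: class_ring_simps\<close>)
qed

text \<open>Families over an index set, instead of the lists of \<open>ring.independent\<close>,
  because bases will be indexed by a finite type; repeated values count as a dependence.\<close>

definition rat_indep :: "'i set \<Rightarrow> ('i \<Rightarrow> 'a::field_char_0) \<Rightarrow> bool" where
  "rat_indep I b \<longleftrightarrow> (\<forall>c::'i \<Rightarrow> rat. (\<Sum>i\<in>I. of_rat (c i) * b i) = 0 \<longrightarrow> (\<forall>i\<in>I. c i = 0))"

definition rat_span :: "'i set \<Rightarrow> ('i \<Rightarrow> 'a::field_char_0) \<Rightarrow> bool" where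
  "rat_span I b \<longleftrightarrow> (\<forall>x. \<exists>c::'i \<Rightarrow> rat. x = (\<Sum>i\<in>I. of_rat (c i) * b i))"

lemma subfield_Rats: "subfield \<rat> (class_ring :: 'a::field_char_0 ring)"
  by (subst subfield_class_ring_iff) auto

lemma combine_map:
  assumes "distinct xs"
  shows "ring.combine class_ring (map c xs) (map b xs) = (\<Sum>i\<in>set xs. c i * (b i :: 'a::field_char_0))"
  using assms by (induction xs) (auto simp: ring.combine.simps[OF ring_class_ring])

lemma Rats_coeffs:
  fixes Ks :: "'a::field_char_0 list"
  assumes "distinct xs" "length Ks = length xs" "set Ks \<subseteq> \<rat>"
  obtains c :: "'i \<Rightarrow> rat" where "Ks = map (\<lambda>i. of_rat (c i)) (xs :: 'i list)"
proof -
  have "\<exists>c :: 'i \<Rightarrow> rat. Ks = map (\<lambda>i. of_rat (c i)) xs"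
    using assms
  proof (induction xs arbitrary: Ks)
    case (Cons x xs)
    obtain k Ks' where Ks: "Ks = k # Ks'" using Cons.prems by (cases Ks) auto
    obtain c :: "'i \<Rightarrow> rat" where c: "Ks' = map (\<lambda>i. of_rat (c i)) xs"
      using Cons Ks by auto
    obtain q where q: "k = of_rat q" using Cons.prems Ks by (auto simp: Rats_def)
    have "Ks = map (\<lambda>i. of_rat ((c(x := q)) i)) (x # xs)"
      using Cons.prems by (auto simp: Ks c q)
    then show ?case by blast
  qed simp
  then show ?thesis using that by blast
qed

lemma rat_indep_iff_independent:
  assumes "distinct xs"
  shows "rat_indep (set xs) (b :: 'i \<Rightarrow> 'a::field_char_0) \<longleftrightarrow> ring.independent class_ring \<rat> (map b xs)"
proof
  assume ri: "rat_indep (set xs) b"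
  show "ring.independent class_ring \<rat> (map b xs)"
  proof (rule ccontr)
    assume dep: "\<not> ?thesis"
    obtain Ks where Ks: "length Ks = length (map b xs)" "ring.combine class_ring Ks (map b xs) = 0"
      "set Ks \<subseteq> \<rat>" "set Ks \<noteq> {0}"
      by (rule ring.dependent_imp_non_trivial_combine[OF ring_class_ring subfield_Rats _ dep]) (auto intro: that)
    obtain c :: "'i \<Rightarrow> rat" where c: "Ks = map (\<lambda>i. of_rat (c i)) xs"
      using Rats_coeffs[OF assms, of Ks] Ks by auto
    have "(\<Sum>i\<in>set xs. of_rat (c i) * b i) = 0"
      using Ks(2) unfolding c by (simp add: combine_map assms)
    then have "\<forall>i\<in>set xs. c i = 0" using ri by (auto simp: rat_indep_def)
    then have "set Ks \<subseteq> {0}" by (auto simp: c)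
    then have "xs = []" using Ks(4) by (cases xs) (auto simp: c)
    then show False using dep by (simp add: ring.li_Nil[OF ring_class_ring])
  qed
next
  assume ind: "ring.independent class_ring \<rat> (map b xs)"
  show "rat_indep (set xs) b"
    unfolding rat_indep_def
  proof (intro allI impI)
    fix c :: "'i \<Rightarrow> rat" assume "(\<Sum>i\<in>set xs. of_rat (c i) * b i) = 0"
    then have "ring.combine class_ring (map (\<lambda>i. of_rat (c i)) xs) (map b xs) = 0"
      by (simp add: combine_map assms)
    moreover have "(\<lambda>i. of_rat (c i)) ` set xs \<subseteq> (\<rat> :: 'a set)" by auto
    ultimately have "set (take (length (map b xs)) (map (\<lambda>i. of_rat (c i)) xs)) \<subseteq> {0 :: 'a}"
      using ring.independent_imp_trivial_combine[OF ring_class_ring subfield_Rats ind, of "map (\<lambda>i. of_rat (c i)) xs"]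
      by auto
    then show "\<forall>i\<in>set xs. c i = 0" by auto
  qed
qed

lemma rat_span_iff_Span:
  assumes "distinct xs"
  shows "rat_span (set xs) (b :: 'i \<Rightarrow> 'a::field_char_0) \<longleftrightarrow> ring.Span class_ring \<rat> (map b xs) = UNIV"
proof -
  have "ring.Span class_ring \<rat> (map b xs) =
     {ring.combine class_ring Ks (map b xs) | Ks. length Ks = length xs \<and> set Ks \<subseteq> \<rat>}"
    using ring.Span_eq_combine_set_length_version[OF ring_class_ring subfield_Rats, of "map b xs"] by simp
  also have "\<dots> = range (\<lambda>c::'i \<Rightarrow> rat. \<Sum>i\<in>set xs. of_rat (c i) * b i)"
  proof (intro equalityI subsetI)
    fix y assume "y \<in> {ring.combine class_ring Ks (map b xs) | Ks. length Ks = length xs \<and> set Ks \<subseteq> \<rat>}"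
    then obtain Ks where Ks: "y = ring.combine class_ring Ks (map b xs)" "length Ks = length xs" "set Ks \<subseteq> \<rat>"
      by blast
    then obtain c :: "'i \<Rightarrow> rat" where "Ks = map (\<lambda>i. of_rat (c i)) xs"
      using Rats_coeffs[OF assms] by blast
    then have "y = (\<Sum>i\<in>set xs. of_rat (c i) * b i)" using Ks(1) combine_map[OF assms] by simp
    then show "y \<in> range (\<lambda>c::'i \<Rightarrow> rat. \<Sum>i\<in>set xs. of_rat (c i) * b i)" by blast
  next
    fix y assume "y \<in> range (\<lambda>c::'i \<Rightarrow> rat. \<Sum>i\<in>set xs. of_rat (c i) * b i)"
    then obtain c :: "'i \<Rightarrow> rat" where y: "y = (\<Sum>i\<in>set xs. of_rat (c i) * b i)" by blast
    show "y \<in> {ring.combine class_ring Ks (map b xs) | Ks. length Ks = length xs \<and> set Ks \<subseteq> \<rat>}"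
      unfolding y mem_Collect_eq
      by (rule exI[of _ "map (\<lambda>i. of_rat (c i)) xs"]) (auto simp: combine_map assms)
  qed
  finally show ?thesis by (simp add: rat_span_def set_eq_iff image_iff)
qed

lemma number_field_dimension:
  assumes "number_field TYPE('a::field_char_0)"
  shows "ring.dimension class_ring (field_degree TYPE('a)) \<rat> (UNIV :: 'a set)"
  using ring.finite_dimensionE[OF ring_class_ring subfield_Rats] assms
  by (auto simp: number_field_def field_degree_def over_def)

lemma rat_basis_exists:
  assumes "number_field TYPE('a::field_char_0)"
  obtains b :: "nat \<Rightarrow> 'a::field_char_0" where "rat_indep {..<field_degree TYPE('a)} b" "rat_span {..<field_degree TYPE('a)} b"
proof -
  let ?d = "field_degree TYPE('a)"
  obtain Vs :: "'a list" where Vs: "ring.independent class_ring \<rat> Vs" "length Vs = ?d" "ring.Span class_ring \<rat> Vs = UNIV"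
    using ring.exists_base[OF ring_class_ring subfield_Rats number_field_dimension[OF assms]] by auto
  have *: "map (\<lambda>i. Vs ! i) [0..<?d] = Vs" using Vs(2) by (metis map_nth)
  show ?thesis
    using that[of "\<lambda>i. Vs ! i"] rat_indep_iff_independent[of "[0..<?d]" "\<lambda>i. Vs ! i"]
      rat_span_iff_Span[of "[0..<?d]" "\<lambda>i. Vs ! i"] Vs unfolding * by (simp add: lessThan_atLeast0)
qed

lemma rat_indep_card_le:
  assumes "number_field TYPE('a::field_char_0)" "finite I" "rat_indep I (b :: 'i \<Rightarrow> 'a::field_char_0)"
  shows "card I \<le> field_degree TYPE('a)"
proof -
  obtain xs where xs: "set xs = I" "distinct xs" using assms(2) finite_distinct_list by blast
  have "length (map b xs) \<le> field_degree TYPE('a)"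
    using ring.independent_length_le_dimension[OF ring_class_ring subfield_Rats number_field_dimension[OF assms(1)], of "map b xs"]
      assms(3) rat_indep_iff_independent[OF xs(2), of b] xs by simp
  then show ?thesis using xs distinct_card by fastforce
qed

lemma rat_indep_card_eq_iff:
  assumes "number_field TYPE('a::field_char_0)" "finite I" "rat_indep I (b :: 'i \<Rightarrow> 'a::field_char_0)"
  shows "card I = field_degree TYPE('a) \<longleftrightarrow> rat_span I b"
proof -
  obtain xs where xs: "set xs = I" "distinct xs" using assms(2) finite_distinct_list by blast
  have "length (map b xs) = field_degree TYPE('a) \<longleftrightarrow> ring.Span class_ring \<rat> (map b xs) = UNIV"
    using ring.independent_length_eq_dimension[OF ring_class_ring subfield_Rats number_field_dimension[OF assms(1)], of "map b xs"]
      assms(3) rat_indep_iff_independent[OF xs(2), of b] xs by simp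
  then show ?thesis using rat_span_iff_Span[OF xs(2), of b] xs distinct_card[OF xs(2)] by simp
qed

lemma field_degree_pos:
  assumes "number_field TYPE('a::field_char_0)"
  shows "field_degree TYPE('a) > 0"
proof (rule ccontr)
  assume "\<not> ?thesis"
  then have "ring.dimension class_ring 0 \<rat> (UNIV :: 'a set)" using number_field_dimension[OF assms] by simp
  then have "(UNIV :: 'a set) = {0}" using ring.dimension_zero[OF ring_class_ring subfield_Rats] by simp
  then have "(1::'a) = 0" by (metis UNIV_I singletonD)
  then show False by simp
qed

text \<open>Independence bounds the number of indices by the degree \<open>d\<close>, and the powers
  with exponents \<open>0\<close> to \<open>d\<close> are one too many. A relation among them is the
  required polynomial.\<close>

lemma number_field_algebraic:
  assumes "number_field TYPE('a::field_char_0)"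
  shows "algebraic (x :: 'a)"
proof -
  have "\<not> rat_indep {..field_degree TYPE('a)} (\<lambda>i. x ^ i)"
    using rat_indep_card_le[OF assms, of "{..field_degree TYPE('a)}" "\<lambda>i. x ^ i"] by auto
  then obtain c :: "nat \<Rightarrow> rat" and j where c: "(\<Sum>i\<le>field_degree TYPE('a). of_rat (c i) * x ^ i) = 0"
    and j: "j \<le> field_degree TYPE('a)" "c j \<noteq> 0"
    by (auto simp: rat_indep_def)
  define p where "p = (\<Sum>i\<le>field_degree TYPE('a). Polynomial.monom (of_rat (c i) :: 'a) i)"
  have co: "Polynomial.coeff p i = (if i \<le> field_degree TYPE('a) then of_rat (c i) else 0)" for i
    by (auto simp: p_def coeff_sum if_distrib[of "\<lambda>f. Polynomial.coeff f i"] sum.delta coeff_monom)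
  show ?thesis
  proof (rule algebraicI')
    show "Polynomial.coeff p i \<in> \<rat>" for i by (simp add: co)
    show "p \<noteq> 0" using j co[of j] by auto
    show "poly p x = 0" using c by (simp add: p_def poly_sum poly_monom)
  qed
qed

section \<open>Minkowski's theorem\<close>

lemma emeasure_disc:
  assumes "r \<ge> 0"
  shows "emeasure (lborel \<Otimes>\<^sub>M lborel) {p::real \<times> real. (fst p)\<^sup>2 + (snd p)\<^sup>2 < r\<^sup>2} = ennreal (pi * r\<^sup>2)"
proof -
  have "{p::real \<times> real. (fst p)\<^sup>2 + (snd p)\<^sup>2 < r\<^sup>2} = ball 0 r"
  proof (intro Set.set_eqI)
    fix p :: "real \<times> real"
    have "norm p < r \<longleftrightarrow> (fst p)\<^sup>2 + (snd p)\<^sup>2 < r\<^sup>2"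
    proof -
      have "(norm p)\<^sup>2 = (fst p)\<^sup>2 + (snd p)\<^sup>2" by (simp add: norm_prod_def)
      moreover have "norm p < r \<longleftrightarrow> (norm p)\<^sup>2 < r\<^sup>2"
        using assms by (auto intro: power2_less_imp_less power_strict_mono)
      ultimately show ?thesis by simp
    qed
    then show "p \<in> {p::real \<times> real. (fst p)\<^sup>2 + (snd p)\<^sup>2 < r\<^sup>2} \<longleftrightarrow> p \<in> ball 0 r" by simp
  qed
  then show ?thesis
    using assms by (simp add: lborel_prod emeasure_ball eval_unit_ball_vol power2_eq_square)
qed

interpretation lborel_family: product_sigma_finite "\<lambda>_::'i. lborel :: real measure"
  by standard

text \<open>A fixed point of \<open>c\<close> contributes an interval, a two-cycle a disc.\<close>

lemma emeasure_PiM_discs: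
  fixes c :: "'i \<Rightarrow> 'i" and r :: "'i \<Rightarrow> real"
  assumes "finite J" "c ` J \<subseteq> J" "\<And>i. c (c i) = i" "\<And>i. r (c i) = r i" "\<And>i. r i > 0"
  shows "emeasure (Pi\<^sub>M J (\<lambda>_. lborel)) {f \<in> space (Pi\<^sub>M J (\<lambda>_. lborel)). \<forall>i\<in>J. (f i)\<^sup>2 + (f (c i))\<^sup>2 < 2 * (r i)\<^sup>2}
    = ennreal (\<Prod>i\<in>J. (if c i = i then 2 else sqrt (2 * pi)) * r i)"
  using assms(1,2)
proof (induction J rule: finite_psubset_induct)
  case (psubset J)
  note fin = psubset.hyps and cJ = psubset.prems
  let ?M = "\<lambda>J. Pi\<^sub>M J (\<lambda>_. lborel :: real measure)"
  let ?S = "\<lambda>J. {f \<in> space (?M J). \<forall>i\<in>J. (f i)\<^sup>2 + (f (c i))\<^sup>2 < 2 * (r i)\<^sup>2}"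
  let ?w = "\<lambda>i. (if c i = i then 2 else sqrt (2 * pi)) * r i"
  have meas: "?S K \<in> sets (?M K)" if "finite K" "c ` K \<subseteq> K" for K
  proof -
    have "(\<lambda>f. (f i)\<^sup>2 + (f (c i))\<^sup>2) \<in> borel_measurable (?M K)" if "i \<in> K" for i
      using that \<open>c ` K \<subseteq> K\<close> by (intro borel_measurable_add borel_measurable_power) (auto intro!: measurable_component_singleton)
    then show ?thesis using that(1)
      by (intro sets.sets_Collect_finite_All) auto
  qed
  show ?case
  proof (cases "J = {}")
    case True
    then show ?thesis by (simp add: space_PiM)
  next
    case False
    then obtain i where i: "i \<in> J" by blast
    show ?thesis
    proof (cases "c i = i")
      case True
      define K where "K = J - {i}"
      have J: "J = insert i K" "i \<notin> K" using i by (auto simp: K_def)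
      have cK: "c j \<in> K" if j: "j \<in> K" for j
      proof -
        have "c j \<noteq> i" by (metis assms(3) True j J(2))
        then show ?thesis using cJ j by (auto simp: K_def)
      qed
      then have K: "K \<subset> J" "c ` K \<subseteq> K" "finite K" using fin J by auto
      have ind: "indicator (?S J) (x(i := y)) = indicator {-r i<..<r i} y * (indicator (?S K) x :: ennreal)"
        if x: "x \<in> space (?M K)" for x y
      proof -
        have "x(i := y) \<in> space (?M J)" using x J by (auto simp: space_PiM PiE_def extensional_def)
        moreover have "y\<^sup>2 + y\<^sup>2 < 2 * (r i)\<^sup>2 \<longleftrightarrow> -r i < y \<and> y < r i"
        proof -
          have "y\<^sup>2 < (r i)\<^sup>2 \<longleftrightarrow> \<bar>y\<bar> < r i"
            using abs_le_square_iff[of "r i" y] assms(5)[of i] by (simp add: not_le[symmetric])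
          then show ?thesis by (simp add: abs_less_iff conj_commute minus_less_iff)
        qed
        moreover have "c j \<noteq> i" if "j \<in> K" for j using cK[OF that] J(2) by blast
        ultimately have "x(i := y) \<in> ?S J \<longleftrightarrow> (-r i < y \<and> y < r i) \<and> x \<in> ?S K"
          using J True x by (auto simp: fun_upd_def)
        then show ?thesis by (auto simp: indicator_def)
      qed
      have "emeasure (?M J) (?S J) = (\<integral>\<^sup>+x. indicator (?S J) x \<partial>?M J)"
        using meas[OF fin cJ] by simp
      also have "\<dots> = (\<integral>\<^sup>+y. (\<integral>\<^sup>+x. indicator (?S J) (x(i := y)) \<partial>?M K) \<partial>lborel)"
        unfolding J(1) using meas[OF fin cJ] J K
        by (intro lborel_family.product_nn_integral_insert_rev) auto
      also have "\<dots> = (\<integral>\<^sup>+y. (\<integral>\<^sup>+x. indicator {-r i<..<r i} y * indicator (?S K) x \<partial>?M K) \<partial>lborel)"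
        by (intro nn_integral_cong) (simp add: ind)
      also have "\<dots> = (\<integral>\<^sup>+y. indicator {-r i<..<r i} y * emeasure (?M K) (?S K) \<partial>lborel)"
        using meas[OF K(3,2)] by (intro nn_integral_cong) (simp add: nn_integral_cmult)
      also have "\<dots> = ennreal (2 * r i) * emeasure (?M K) (?S K)"
        using assms(5)[of i] by (simp add: nn_integral_multc)
      also have "\<dots> = ennreal (\<Prod>i\<in>J. ?w i)"
        using psubset.IH[OF K(1,2)] J K True assms(5)
        by (simp add: ennreal_mult'[symmetric] less_imp_le mult_ac)
      finally show ?thesis .
    next
      case False
      define K where "K = J - {i, c i}"
      have ci: "c i \<in> J" using i cJ by blast
      have J: "J = insert i (insert (c i) K)" "i \<notin> K" "c i \<notin> K" using i ci by (auto simp: K_def)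
      have cK: "c j \<in> K" if j: "j \<in> K" for j
      proof -
        have "c j \<noteq> i" by (metis assms(3) j J(3))
        moreover have "c j \<noteq> c i" by (metis assms(3) j J(2))
        ultimately show ?thesis using cJ j by (auto simp: K_def)
      qed
      then have K: "K \<subset> J" "c ` K \<subseteq> K" "finite K" using fin J by auto
      \<comment> \<open>The conditions at \<open>i\<close> and at \<open>c i\<close> describe the
        same disc of radius \<open>sqrt 2 * r i\<close>. Its area \<open>2 * pi * (r i)^2\<close> is
        split evenly, so that each of the two indices receives
        \<open>sqrt (2 * pi) * r i\<close>.\<close>
      let ?D = "{p::real \<times> real. (fst p)\<^sup>2 + (snd p)\<^sup>2 < (sqrt 2 * r i)\<^sup>2}"
      have ind: "indicator (?S J) (x(c i := z, i := y)) = indicator ?D (y, z) * (indicator (?S K) x :: ennreal)"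
        if x: "x \<in> space (?M K)" for x y z
      proof -
        have "x(c i := z, i := y) \<in> space (?M J)" using x J by (auto simp: space_PiM PiE_def extensional_def)
        moreover have "c j \<noteq> i" "c j \<noteq> c i" if "j \<in> K" for j using cK[OF that] J(2,3) by auto
        ultimately have "x(c i := z, i := y) \<in> ?S J \<longleftrightarrow> y\<^sup>2 + z\<^sup>2 < 2 * (r i)\<^sup>2 \<and> x \<in> ?S K"
          using J False x assms(3,4) by (auto simp: fun_upd_def add.commute)
        then show ?thesis by (auto simp: indicator_def power_mult_distrib)
      qed
      have D: "?D \<in> sets (lborel \<Otimes>\<^sub>M lborel)"
        unfolding lborel_prod by (simp add: borel_open open_Collect_less continuous_intros)
      have upd: "(\<lambda>x. x(i := y)) \<in> ?M (insert (c i) K) \<rightarrow>\<^sub>M ?M J" for y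
        unfolding J(1) by (intro measurable_fun_upd[where J="insert (c i) K"]) auto
      have "emeasure (?M J) (?S J) = (\<integral>\<^sup>+x. indicator (?S J) x \<partial>?M J)"
        using meas[OF fin cJ] by simp
      also have "\<dots> = (\<integral>\<^sup>+y. (\<integral>\<^sup>+x. indicator (?S J) (x(i := y)) \<partial>?M (insert (c i) K)) \<partial>lborel)"
        unfolding J(1) using meas[OF fin cJ] J K False
        by (intro lborel_family.product_nn_integral_insert_rev) auto
      also have "\<dots> = (\<integral>\<^sup>+y. (\<integral>\<^sup>+z. (\<integral>\<^sup>+x. indicator (?S J) (x(c i := z, i := y)) \<partial>?M K) \<partial>lborel) \<partial>lborel)"
      proof (rule nn_integral_cong)
        fix y :: real
        have "(\<lambda>x. indicator (?S J) (x(i := y)) :: ennreal) \<in> borel_measurable (?M (insert (c i) K))"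
          by (rule measurable_compose[OF upd]) (intro borel_measurable_indicator meas[OF fin cJ])
        then show "(\<integral>\<^sup>+x. indicator (?S J) (x(i := y)) \<partial>?M (insert (c i) K)) =
            (\<integral>\<^sup>+z. (\<integral>\<^sup>+x. indicator (?S J) (x(c i := z, i := y)) \<partial>?M K) \<partial>lborel)"
          by (rule lborel_family.product_nn_integral_insert_rev[OF K(3) J(3)])
      qed
      also have "\<dots> = (\<integral>\<^sup>+y. (\<integral>\<^sup>+z. (\<integral>\<^sup>+x. indicator ?D (y, z) * indicator (?S K) x \<partial>?M K) \<partial>lborel) \<partial>lborel)"
        by (intro nn_integral_cong) (simp add: ind)
      also have "\<dots> = (\<integral>\<^sup>+y. (\<integral>\<^sup>+z. indicator ?D (y, z) * emeasure (?M K) (?S K) \<partial>lborel) \<partial>lborel)"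
        using meas[OF K(3,2)] by (intro nn_integral_cong) (simp add: nn_integral_cmult)
      also have "\<dots> = (\<integral>\<^sup>+p. indicator ?D p * emeasure (?M K) (?S K) \<partial>(lborel \<Otimes>\<^sub>M lborel))"
        by (rule lborel.nn_integral_fst[where f = "\<lambda>p. indicator ?D p * emeasure (?M K) (?S K)"])
          (intro borel_measurable_times_ennreal borel_measurable_indicator D borel_measurable_const)
      also have "\<dots> = ennreal (pi * (sqrt 2 * r i)\<^sup>2) * emeasure (?M K) (?S K)"
        using D emeasure_disc[of "sqrt 2 * r i"] assms(5)[of i] by (simp add: nn_integral_multc)
      also have "\<dots> = ennreal (\<Prod>i\<in>J. ?w i)"
      proof -
        have "c (c i) \<noteq> c i" using False assms(3) by metis
        then have "(\<Prod>i\<in>J. ?w i) = (sqrt (2 * pi) * r i) * ((sqrt (2 * pi) * r (c i)) * (\<Prod>i\<in>K. ?w i))"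
          using J K False assms(3) by simp
        also have "\<dots> = pi * (sqrt 2 * r i)\<^sup>2 * (\<Prod>i\<in>K. ?w i)"
          by (simp add: assms(4) power2_eq_square real_sqrt_mult algebra_simps)
        finally show ?thesis
          using psubset.IH[OF K(1,2)] by (simp add: ennreal_mult'[symmetric])
      qed
      finally show ?thesis .
    qed
  qed
qed

text \<open>Lebesgue measure is determined by its values on boxes, where the product measure gives
  the product of the side lengths. Fubini on function spaces thus computes volumes of sets of
  vectors.\<close>

lemma distr_PiM_vec_lambda:
  "distr (Pi\<^sub>M UNIV (\<lambda>_::'n::finite. lborel)) borel vec_lambda = (lborel :: (real^'n) measure)"
proof (rule lborel_eqI[symmetric])
  fix l u :: "real^'n"
  assume lu: "\<And>b. b \<in> Basis \<Longrightarrow> l \<bullet> b \<le> u \<bullet> b"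
  have le: "l $ i \<le> u $ i" for i using lu[of "axis i 1"] by (auto simp: inner_axis Basis_vec_def)
  have m: "vec_lambda \<in> Pi\<^sub>M UNIV (\<lambda>_::'n. lborel) \<rightarrow>\<^sub>M (borel :: (real^'n) measure)"
    by (rule borel_measurable_euclidean_space[THEN iffD2])
      (auto simp: Basis_vec_def inner_axis intro!: measurable_component_singleton)
  have "vec_lambda -` box l u \<inter> space (Pi\<^sub>M UNIV (\<lambda>_::'n. lborel)) = Pi\<^sub>E UNIV (\<lambda>i. {l $ i<..<u $ i})"
    by (auto simp: space_PiM mem_box_cart PiE_iff)
  then have "emeasure (distr (Pi\<^sub>M UNIV (\<lambda>_::'n. lborel)) borel vec_lambda) (box l u) =
      (\<Prod>i\<in>UNIV. emeasure lborel {l $ i<..<u $ i})"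
    using m by (simp add: emeasure_distr lborel_family.emeasure_PiM)
  also have "\<dots> = ennreal (\<Prod>i\<in>UNIV. u $ i - l $ i)"
    using le by (simp add: prod_ennreal)
  also have "(\<Prod>i\<in>UNIV. u $ i - l $ i) = (\<Prod>b\<in>Basis. (u - l) \<bullet> b)"
    by (simp add: Basis_vec_def UNION_singleton_eq_range axis_eq_axis prod.reindex inj_on_def inner_axis)
  finally show "emeasure (distr (Pi\<^sub>M UNIV (\<lambda>_::'n. lborel)) borel vec_lambda) (box l u) = (\<Prod>b\<in>Basis. (u - l) \<bullet> b)" .
qed simp

text \<open>The volume is read off from the product measure along \<open>vec_lambda\<close>;
  measurability and boundedness are recorded because \<open>minkowski\<close> asks for them.\<close>

lemma measure_discs:
  fixes c :: "'n::finite \<Rightarrow> 'n" and r :: "'n \<Rightarrow> real"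
  assumes "\<And>i. c (c i) = i" "\<And>i. r (c i) = r i" "\<And>i. r i > 0"
  shows "measure lebesgue {y::real^'n. \<forall>i. (y $ i)\<^sup>2 + (y $ c i)\<^sup>2 < 2 * (r i)\<^sup>2}
    = (\<Prod>i\<in>UNIV. (if c i = i then 2 else sqrt (2 * pi)) * r i)"
    (is "measure _ ?Y = ?p")
    and "{y::real^'n. \<forall>i. (y $ i)\<^sup>2 + (y $ c i)\<^sup>2 < 2 * (r i)\<^sup>2} \<in> lmeasurable"
    and "bounded {y::real^'n. \<forall>i. (y $ i)\<^sup>2 + (y $ c i)\<^sup>2 < 2 * (r i)\<^sup>2}"
proof -
  have op: "open ?Y"
  proof -
    have "?Y = (\<Inter>i. {y. (y $ i)\<^sup>2 + (y $ c i)\<^sup>2 < 2 * (r i)\<^sup>2})" by auto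
    then show ?thesis by (auto intro!: open_INT open_Collect_less continuous_intros)
  qed
  have m: "vec_lambda \<in> Pi\<^sub>M UNIV (\<lambda>_::'n. lborel) \<rightarrow>\<^sub>M (borel :: (real^'n) measure)"
    by (rule borel_measurable_euclidean_space[THEN iffD2])
      (auto simp: Basis_vec_def inner_axis intro!: measurable_component_singleton)
  have "emeasure lborel ?Y = emeasure (distr (Pi\<^sub>M UNIV (\<lambda>_::'n. lborel)) borel vec_lambda) ?Y"
    by (simp only: distr_PiM_vec_lambda)
  also have "\<dots> = emeasure (Pi\<^sub>M UNIV (\<lambda>_::'n. lborel)) (vec_lambda -` ?Y \<inter> space (Pi\<^sub>M UNIV (\<lambda>_. lborel)))"
    using m op by (intro emeasure_distr) auto
  also have "vec_lambda -` ?Y \<inter> space (Pi\<^sub>M UNIV (\<lambda>_. lborel)) =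
      {f \<in> space (Pi\<^sub>M UNIV (\<lambda>_. lborel)). \<forall>i\<in>UNIV. (f i)\<^sup>2 + (f (c i))\<^sup>2 < 2 * (r i)\<^sup>2}"
    by auto
  also have "emeasure (Pi\<^sub>M UNIV (\<lambda>_. lborel)) \<dots> = ennreal ?p"
    by (rule emeasure_PiM_discs) (use assms in auto)
  finally have em: "emeasure lborel ?Y = ennreal ?p" .
  have "?p \<ge> 0" using assms(3) by (intro prod_nonneg) (auto simp: less_imp_le)
  then show "measure lebesgue ?Y = ?p" using em op by (simp add: measure_def)
  show bd: "bounded ?Y"
  proof (rule bounded_subset)
    show "bounded (cbox (- (\<chi> i. 2 * r i)) (\<chi> i. 2 * r i) :: (real^'n) set)" by simp
    \<comment> \<open>A crude bound, the coordinate being below \<open>sqrt 2 * r i\<close> in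
      absolute value.\<close>
    have "\<bar>y $ i\<bar> \<le> 2 * r i" if "y \<in> ?Y" for y i
    proof -
      have "(y $ i)\<^sup>2 + (y $ c i)\<^sup>2 < 2 * (r i)\<^sup>2" using that by simp
      then have "(y $ i)\<^sup>2 \<le> (2 * r i)\<^sup>2" by (simp add: power_mult_distrib) (smt (verit) zero_le_power2)
      then show ?thesis using assms(3)[of i] abs_le_square_iff[of "y $ i" "2 * r i"] by simp
    qed
    then have "\<forall>y\<in>?Y. \<forall>i. \<bar>y $ i\<bar> \<le> 2 * r i" by blast
    then show "?Y \<subseteq> cbox (- (\<chi> i. 2 * r i)) (\<chi> i. 2 * r i)"
      by (auto simp: mem_box_cart abs_le_iff minus_le_iff)
  qed
  show "?Y \<in> lmeasurable" using op bd by (rule lmeasurable_open[rotated])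
qed

text \<open>A packing argument. If \<open>0\<close> were the only integer point of \<open>S\<close>,
  the translates of \<open>S/2\<close> by integer vectors would be pairwise disjoint. The
  \<open>N^n\<close> translates by vectors with entries in \<open>{0, ..., N - 1}\<close> lie in a
  cube of side \<open>N + 2R\<close>, and letting \<open>N\<close> grow bounds the volume of
  \<open>S/2\<close> by \<open>1\<close>, hence that of \<open>S\<close> by
  \<open>2^n\<close>.\<close>

theorem minkowski:
  fixes S :: "(real^'n::{finite,wellorder}) set"
  assumes "convex S" "\<And>x. x \<in> S \<Longrightarrow> - x \<in> S" "bounded S" "S \<in> lmeasurable" "measure lebesgue S > 2 ^ CARD('n)"
  shows "\<exists>x\<in>S. x \<noteq> 0 \<and> (\<forall>i. x $ i \<in> \<int>)"
proof (rule ccontr)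
  assume "\<not> ?thesis"
  then have no: "x = 0" if "x \<in> S" "\<And>i. x $ i \<in> \<int>" for x using that by blast
  define T where "T = (*\<^sub>R) (1/2) ` S"
  have lin: "linear ((*\<^sub>R) (1/2) :: real^'n::_ \<Rightarrow> _)" by (simp add: linear_scale_self)
  have Tm: "T \<in> lmeasurable" unfolding T_def using measurable_linear_image[OF lin assms(4)] .
  have "measure lebesgue T = (1/2) ^ CARD('n) * measure lebesgue S"
    unfolding T_def by (subst measure_linear_image[OF lin assms(4)]) simp
  then have mT: "measure lebesgue T > 1"
  proof -
    assume "measure lebesgue T = (1/2) ^ CARD('n) * measure lebesgue S"
    then have "2 ^ CARD('n) * 1 < 2 ^ CARD('n) * measure lebesgue T" using assms(5) by (simp add: power_divide)
    then show ?thesis by (simp only: mult_less_cancel_left_pos[OF zero_less_power[OF zero_less_numeral]])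
  qed
  obtain R0 where R0: "\<And>x. x \<in> S \<Longrightarrow> norm x \<le> R0" using assms(3) by (auto simp: bounded_iff)
  define R where "R = max R0 1"
  have R: "\<bar>x $ i\<bar> \<le> R" if x: "x \<in> T" for x i
  proof -
    obtain s where s: "s \<in> S" "x = (1/2) *\<^sub>R s" using x unfolding T_def by blast
    have "\<bar>s $ i\<bar> \<le> R0" using component_le_norm_cart[of s i] R0[OF s(1)] by linarith
    then show ?thesis using s by (simp add: R_def)
  qed
  have R1: "R \<ge> 1" by (simp add: R_def)
  define Z where "Z N = {z::real^'n::_. \<forall>i. z $ i \<in> real ` {..<N}}" for N
  have Zeq: "Z N = vec_lambda ` (PiE UNIV (\<lambda>_. real ` {..<N}))" for N
  proof (intro equalityI subsetI)
    fix z assume "z \<in> Z N"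
    then show "z \<in> vec_lambda ` (PiE UNIV (\<lambda>_. real ` {..<N}))"
      by (intro image_eqI[of _ _ "vec_nth z"]) (simp_all add: Z_def PiE_iff)
  qed (auto simp: Z_def PiE_iff)
  have Zfin: "finite (Z N)" for N unfolding Zeq by (intro finite_imageI finite_PiE) auto
  have Zcard: "card (Z N) = N ^ CARD('n)" for N
  proof -
    have "inj_on vec_lambda (PiE UNIV (\<lambda>_::'n. real ` {..<N}))" by (rule inj_onI) (simp add: vec_lambda_inject)
    moreover have "card (real ` {..<N}) = N" by (simp add: card_image)
    ultimately show ?thesis unfolding Zeq by (simp add: card_image card_PiE)
  qed
  have disj: "disjoint_family_on (\<lambda>z. (+) z ` T) (Z N)" for N
    unfolding disjoint_family_on_def
  proof (intro ballI impI)
    fix z w assume zw: "z \<in> Z N" "w \<in> Z N" "z \<noteq> w"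
    show "(+) z ` T \<inter> (+) w ` T = {}"
    proof (rule ccontr)
      assume "\<not> ?thesis"
      then obtain a b where ab: "a \<in> S" "b \<in> S" "z + (1/2) *\<^sub>R a = w + (1/2) *\<^sub>R b" unfolding T_def by blast
      \<comment> \<open>If two translates meet, the difference of their shifts is the midpoint of
        \<open>b\<close> and \<open>- a\<close>, which symmetry and convexity put into
        \<open>S\<close>.\<close>
      have "z - w = (1/2) *\<^sub>R b + (1/2) *\<^sub>R (- a)" using ab(3) by (simp add: algebra_simps)
      also have "\<dots> \<in> S" using convexD[OF assms(1) ab(2) assms(2)[OF ab(1)], of "1/2" "1/2"] by simp
      finally have mem: "z - w \<in> S" .
      have "z $ i \<in> real ` {..<N}" "w $ i \<in> real ` {..<N}" for i using zw(1,2) unfolding Z_def by simp_all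
      then have "z $ i \<in> \<int>" "w $ i \<in> \<int>" for i by (metis Ints_of_nat imageE)+
      then have "z - w = 0" by (intro no[OF mem]) simp
      then show False using zw(3) by simp
    qed
  qed
  have ineq: "real N ^ CARD('n) * measure lebesgue T \<le> (real N + 2 * R) ^ CARD('n)" for N
  proof -
    have mt: "(+) z ` T \<in> lmeasurable" for z using measurable_translation[OF Tm] .
    have "measure lebesgue (\<Union>z\<in>Z N. (+) z ` T) = (\<Sum>z\<in>Z N. measure lebesgue ((+) z ` T))"
    proof (rule measure_finite_Union[OF Zfin _ disj])
      show "(\<lambda>z. (+) z ` T) ` Z N \<subseteq> sets lebesgue" using fmeasurableD[OF mt] by blast
      show "emeasure lebesgue ((+) z ` T) \<noteq> \<infinity>" for z
        unfolding infinity_ennreal_def by (rule fmeasurableD2[OF mt])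
    qed
    also have "\<dots> = real N ^ CARD('n) * measure lebesgue T" by (simp add: measure_translation Zcard)
    finally have eq: "real N ^ CARD('n) * measure lebesgue T = measure lebesgue (\<Union>z\<in>Z N. (+) z ` T)" ..
    let ?B = "cbox (\<chi> i. - R) (\<chi> i. real N + R) :: (real^'n::_) set"
    have "(\<Union>z\<in>Z N. (+) z ` T) \<subseteq> ?B"
    proof (intro UN_least subsetI)
      fix z x assume z: "z \<in> Z N" "x \<in> (+) z ` T"
      then obtain t where t: "t \<in> T" "x = z + t" by blast
      have zi: "0 \<le> z $ i \<and> z $ i \<le> real N" for i
      proof -
        obtain k where "z $ i = real k" "k < N" using z(1) unfolding Z_def by (metis (mono_tags, lifting) imageE lessThan_iff mem_Collect_eq)
        then show ?thesis by simp
      qed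
      have "- R \<le> x $ i \<and> x $ i \<le> real N + R" for i
        using R[OF t(1), of i] zi[of i] t(2) by (auto simp: abs_le_iff)
      then show "x \<in> ?B" by (simp add: mem_box_cart)
    qed
    then have "measure lebesgue (\<Union>z\<in>Z N. (+) z ` T) \<le> measure lebesgue ?B"
      using mt Zfin by (intro measure_mono_fmeasurable) (auto simp: fmeasurableD)
    also have "measure lebesgue ?B = (real N + 2 * R) ^ CARD('n)"
      using R1 by (subst measure_completion) (auto simp: content_cbox_cart interval_ne_empty_cart algebra_simps)
    finally show ?thesis using eq by simp
  qed
  \<comment> \<open>After division by \<open>N^n\<close> the boundary layer of width
    \<open>R\<close> becomes negligible.\<close>
  have "(\<lambda>N. (1 + 2 * R / real N) ^ CARD('n)) \<longlonglongrightarrow> (1 + 0) ^ CARD('n)"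
    by (intro tendsto_intros lim_const_over_n)
  moreover have "\<forall>\<^sub>F N in sequentially. measure lebesgue T \<le> (1 + 2 * R / real N) ^ CARD('n)"
    using eventually_gt_at_top[of 0]
  proof eventually_elim
    case (elim N)
    have "1 + 2 * R / real N = (real N + 2 * R) / real N" using elim by (simp add: field_simps)
    then show ?case using ineq[of N] elim by (simp add: power_divide field_simps)
  qed
  ultimately have "measure lebesgue T \<le> (1 + 0) ^ CARD('n)"
    by (rule tendsto_lowerbound) simp
  then show False using mT by simp
qed

section \<open>Extension of embeddings\<close>

text \<open>Values outside \<open>L\<close> are left free, so that one function can be a
  homomorphism on several subfields without being restricted; \<open>extensional\<close> is added
  only to compare with \<open>embeddings\<close>.\<close>

definition ring_hom_on :: "'a::field_char_0 set \<Rightarrow> ('a \<Rightarrow> complex) \<Rightarrow> bool" where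
  "ring_hom_on L \<sigma> \<longleftrightarrow> \<sigma> 1 = 1 \<and> (\<forall>x\<in>L. \<forall>y\<in>L. \<sigma> (x + y) = \<sigma> x + \<sigma> y \<and> \<sigma> (x * y) = \<sigma> x * \<sigma> y)"

definition poly_over :: "'a::field_char_0 set \<Rightarrow> 'a poly \<Rightarrow> bool" where
  "poly_over L p \<longleftrightarrow> (\<forall>i. coeff p i \<in> L)"

abbreviation class_subfield :: "'a::field_char_0 set \<Rightarrow> bool" where
  "class_subfield L \<equiv> subfield L class_ring"

lemma subfield_closed:
  assumes "class_subfield L"
  shows "1 \<in> L" "0 \<in> L" "x \<in> L \<Longrightarrow> - x \<in> L" "x \<in> L \<Longrightarrow> y \<in> L \<Longrightarrow> x + y \<in> L"
    "x \<in> L \<Longrightarrow> y \<in> L \<Longrightarrow> x - y \<in> L" "x \<in> L \<Longrightarrow> y \<in> L \<Longrightarrow> x * y \<in> L" "x \<in> L \<Longrightarrow> inverse x \<in> L"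
    "x \<in> L \<Longrightarrow> y \<in> L \<Longrightarrow> x / y \<in> L" "x \<in> L \<Longrightarrow> x ^ n \<in> L"
proof -
  have B: "1 \<in> L" "\<And>x y. x \<in> L \<Longrightarrow> y \<in> L \<Longrightarrow> x - y \<in> L \<and> x * y \<in> L" "\<And>x. x \<in> L \<Longrightarrow> inverse x \<in> L"
    using assms by (auto simp: subfield_class_ring_iff)
  show one: "1 \<in> L" by fact
  show zero: "0 \<in> L" using B(2)[OF one one] by simp
  have neg: "- x \<in> L" if "x \<in> L" for x using B(2)[OF zero that] by simp
  have add: "x + y \<in> L" if "x \<in> L" "y \<in> L" for x y
    using B(2)[OF that(1) neg[OF that(2)]] by simp
  show "x \<in> L \<Longrightarrow> - x \<in> L" "x \<in> L \<Longrightarrow> y \<in> L \<Longrightarrow> x + y \<in> L"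
    "x \<in> L \<Longrightarrow> y \<in> L \<Longrightarrow> x - y \<in> L" "x \<in> L \<Longrightarrow> y \<in> L \<Longrightarrow> x * y \<in> L" "x \<in> L \<Longrightarrow> inverse x \<in> L"
    "x \<in> L \<Longrightarrow> y \<in> L \<Longrightarrow> x / y \<in> L"
    using neg add B by (auto simp: divide_inverse)
  show "x \<in> L \<Longrightarrow> x ^ n \<in> L" by (induction n) (use one B in auto)
qed

lemma subfield_sum:
  assumes "class_subfield L" "\<And>i. i \<in> A \<Longrightarrow> f i \<in> L"
  shows "sum f A \<in> L"
  using assms(2) by (induction A rule: infinite_finite_induct) (use subfield_closed[OF assms(1)] in auto)

lemma subfield_of_nat: "class_subfield L \<Longrightarrow> of_nat n \<in> L"
  by (induction n) (auto intro: subfield_closed(1,2) subfield_closed(4)[of L 1])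

lemma subfield_of_int: "class_subfield L \<Longrightarrow> of_int n \<in> L"
  by (cases n rule: int_cases2) (auto intro: subfield_of_nat subfield_closed(3))

lemma subfield_Rats_subset:
  assumes "class_subfield L"
  shows "\<rat> \<subseteq> L"
proof
  fix x :: 'a assume "x \<in> \<rat>"
  then obtain a b where "x = of_int a / of_int b" by (auto elim: Rats_cases')
  then show "x \<in> L" using subfield_of_int[OF assms] subfield_closed(8)[OF assms] by blast
qed

lemma subfield_UNIV: "class_subfield UNIV"
  by (simp add: subfield_class_ring_iff)

lemma ring_hom_on_subfield:
  assumes "class_subfield L" "ring_hom_on L \<sigma>"
  shows "\<sigma> 0 = 0" "\<sigma> 1 = 1" "x \<in> L \<Longrightarrow> y \<in> L \<Longrightarrow> \<sigma> (x + y) = \<sigma> x + \<sigma> y"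
    "x \<in> L \<Longrightarrow> y \<in> L \<Longrightarrow> \<sigma> (x * y) = \<sigma> x * \<sigma> y" "x \<in> L \<Longrightarrow> \<sigma> (- x) = - \<sigma> x"
    "x \<in> L \<Longrightarrow> y \<in> L \<Longrightarrow> \<sigma> (x - y) = \<sigma> x - \<sigma> y" "x \<in> L \<Longrightarrow> \<sigma> x = 0 \<longleftrightarrow> x = 0"
    "x \<in> L \<Longrightarrow> y \<in> L \<Longrightarrow> \<sigma> x = \<sigma> y \<Longrightarrow> x = y" "x \<in> L \<Longrightarrow> \<sigma> (inverse x) = inverse (\<sigma> x)"
proof -
  note cl = subfield_closed[OF assms(1)]
  show one: "\<sigma> 1 = 1" using assms(2) by (simp add: ring_hom_on_def)
  have add: "\<sigma> (x + y) = \<sigma> x + \<sigma> y" if "x \<in> L" "y \<in> L" for x y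
    using assms(2) that by (simp add: ring_hom_on_def)
  have mult: "\<sigma> (x * y) = \<sigma> x * \<sigma> y" if "x \<in> L" "y \<in> L" for x y
    using assms(2) that by (simp add: ring_hom_on_def)
  show "x \<in> L \<Longrightarrow> y \<in> L \<Longrightarrow> \<sigma> (x + y) = \<sigma> x + \<sigma> y" "x \<in> L \<Longrightarrow> y \<in> L \<Longrightarrow> \<sigma> (x * y) = \<sigma> x * \<sigma> y"
    using add mult by auto
  show zero: "\<sigma> 0 = 0" using add[OF cl(2) cl(2)] by simp
  have neg: "\<sigma> (- x) = - \<sigma> x" if "x \<in> L" for x
    using add[OF that cl(3)[OF that]] zero by (simp add: minus_unique)
  have diff: "\<sigma> (x - y) = \<sigma> x - \<sigma> y" if "x \<in> L" "y \<in> L" for x y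
    using add[OF that(1) cl(3)[OF that(2)]] neg[OF that(2)] by simp
  have nz: "\<sigma> x = 0 \<longleftrightarrow> x = 0" if "x \<in> L" for x
    using mult[OF that cl(7)[OF that]] one zero by (cases "x = 0") auto
  show "x \<in> L \<Longrightarrow> \<sigma> (- x) = - \<sigma> x" "x \<in> L \<Longrightarrow> y \<in> L \<Longrightarrow> \<sigma> (x - y) = \<sigma> x - \<sigma> y"
    "x \<in> L \<Longrightarrow> \<sigma> x = 0 \<longleftrightarrow> x = 0" using neg diff nz by auto
  show "x \<in> L \<Longrightarrow> y \<in> L \<Longrightarrow> \<sigma> x = \<sigma> y \<Longrightarrow> x = y" using diff[of x y] nz[of "x - y"] cl(5) by auto
  show "\<sigma> (inverse x) = inverse (\<sigma> x)" if "x \<in> L"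
  proof (cases "x = 0")
    case False
    then have "\<sigma> x * \<sigma> (inverse x) = 1" using mult[OF that cl(7)[OF that]] one by simp
    then show ?thesis by (metis inverse_unique)
  qed (use zero in simp)
qed

lemma ring_hom_on_sum:
  assumes "class_subfield L" "ring_hom_on L \<sigma>" "\<And>i. i \<in> A \<Longrightarrow> f i \<in> L"
  shows "\<sigma> (sum f A) = (\<Sum>i\<in>A. \<sigma> (f i))"
  using assms(3)
proof (induction A rule: infinite_finite_induct)
  case (insert x A)
  then show ?case
    using ring_hom_on_subfield(3)[OF assms(1,2), of "f x" "sum f A"] subfield_sum[OF assms(1), of A f] by simp
qed (use ring_hom_on_subfield(1)[OF assms(1,2)] in auto)

lemma embeddings_iff: "\<sigma> \<in> embeddings L \<longleftrightarrow> ring_hom_on L \<sigma> \<and> \<sigma> \<in> extensional L"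
  by (auto simp: embeddings_def Ring.ring_hom_def ring_hom_on_def)

lemma embeddings_UNIV_iff: "\<sigma> \<in> embeddings UNIV \<longleftrightarrow> ring_hom_on UNIV \<sigma>"
  by (simp add: embeddings_iff)

lemma embedding_simps:
  assumes "\<sigma> \<in> embeddings (UNIV :: 'a::field_char_0 set)"
  shows "\<sigma> 0 = 0" "\<sigma> 1 = 1" "\<sigma> (x + y) = \<sigma> x + \<sigma> y" "\<sigma> (x * y) = \<sigma> x * \<sigma> y" "\<sigma> (- x) = - \<sigma> x"
    "\<sigma> (x - y) = \<sigma> x - \<sigma> y" "\<sigma> x = 0 \<longleftrightarrow> x = 0" "\<sigma> x = \<sigma> y \<longleftrightarrow> x = y" "\<sigma> (inverse x) = inverse (\<sigma> x)"
    "\<sigma> (x ^ n) = \<sigma> x ^ n" "\<sigma> (sum f A) = (\<Sum>i\<in>A. \<sigma> (f i))" "\<sigma> (prod f A) = (\<Prod>i\<in>A. \<sigma> (f i))"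
    "\<sigma> (of_nat k) = of_nat k" "\<sigma> (of_int m) = of_int m" "\<sigma> (of_rat q) = of_rat q" "\<sigma> (x / y) = \<sigma> x / \<sigma> y"
proof -
  have h: "ring_hom_on UNIV \<sigma>" using assms by (simp add: embeddings_UNIV_iff)
  note H = ring_hom_on_subfield[OF subfield_UNIV h, simplified]
  show "\<sigma> 0 = 0" "\<sigma> 1 = 1" "\<sigma> (x + y) = \<sigma> x + \<sigma> y" "\<sigma> (x * y) = \<sigma> x * \<sigma> y" "\<sigma> (- x) = - \<sigma> x"
    "\<sigma> (x - y) = \<sigma> x - \<sigma> y" "\<sigma> x = 0 \<longleftrightarrow> x = 0" "\<sigma> x = \<sigma> y \<longleftrightarrow> x = y" "\<sigma> (inverse x) = inverse (\<sigma> x)"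
    using H by auto
  show "\<sigma> (x ^ n) = \<sigma> x ^ n" by (induction n) (auto simp: H)
  show "\<sigma> (sum f A) = (\<Sum>i\<in>A. \<sigma> (f i))" by (rule ring_hom_on_sum[OF subfield_UNIV h]) simp
  show "\<sigma> (prod f A) = (\<Prod>i\<in>A. \<sigma> (f i))" by (induction A rule: infinite_finite_induct) (auto simp: H)
  have nat: "\<sigma> (of_nat k) = of_nat k" for k by (induction k) (auto simp: H)
  have int: "\<sigma> (of_int m) = of_int m" for m by (cases m rule: int_cases2) (auto simp: H nat)
  show "\<sigma> (of_nat k) = of_nat k" "\<sigma> (of_int m) = of_int m" by fact+
  show div: "\<sigma> (x / y) = \<sigma> x / \<sigma> y" for x y by (simp add: divide_inverse H)
  show "\<sigma> (of_rat q) = of_rat q"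
    by (cases q rule: Rat_cases) (simp add: of_rat_rat div int)
qed

section \<open>Polynomials and minimal polynomials over a subfield\<close>

lemma map_poly_hom_on:
  assumes "class_subfield L" "ring_hom_on L \<sigma>" "poly_over L p" "poly_over L q"
  shows "map_poly \<sigma> (p + q) = map_poly \<sigma> p + map_poly \<sigma> q"
    "map_poly \<sigma> (p - q) = map_poly \<sigma> p - map_poly \<sigma> q"
    "map_poly \<sigma> (p * q) = map_poly \<sigma> p * map_poly \<sigma> q"
    "poly_over L (p + q)" "poly_over L (p - q)" "poly_over L (p * q)"
proof -
  note h = ring_hom_on_subfield[OF assms(1,2)] and cl = subfield_closed[OF assms(1)]
  have pq: "coeff p i \<in> L" "coeff q i \<in> L" for i using assms(3,4) by (auto simp: poly_over_def)
  show "map_poly \<sigma> (p + q) = map_poly \<sigma> p + map_poly \<sigma> q" "map_poly \<sigma> (p - q) = map_poly \<sigma> p - map_poly \<sigma> q"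
    by (rule poly_eqI; simp add: coeff_map_poly h pq)+
  show "map_poly \<sigma> (p * q) = map_poly \<sigma> p * map_poly \<sigma> q"
    by (rule poly_eqI) (simp add: coeff_map_poly h coeff_mult ring_hom_on_sum[OF assms(1,2)] pq cl)
  show "poly_over L (p + q)" "poly_over L (p - q)" using pq cl by (auto simp: poly_over_def)
  show "poly_over L (p * q)"
    unfolding poly_over_def coeff_mult using pq cl by (auto intro!: subfield_sum[OF assms(1)])
qed

lemma poly_over_basic:
  assumes "class_subfield L"
  shows "poly_over L 0" "poly_over L 1" "c \<in> L \<Longrightarrow> poly_over L [:c:]" "c \<in> L \<Longrightarrow> poly_over L (monom c n)"
    "poly_over L p \<Longrightarrow> poly_over L (pCons c p) \<longleftrightarrow> c \<in> L" "poly_over L p \<Longrightarrow> c \<in> L \<Longrightarrow> poly_over L (Polynomial.smult c p)"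
    "poly_over L p \<Longrightarrow> poly_over L q \<Longrightarrow> poly_over L (p + q)"
    "poly_over L p \<Longrightarrow> poly_over L q \<Longrightarrow> poly_over L (p - q)"
    "poly_over L p \<Longrightarrow> poly_over L q \<Longrightarrow> poly_over L (p * q)"
proof -
  note cl = subfield_closed[OF assms]
  show "poly_over L 0" "poly_over L 1" "c \<in> L \<Longrightarrow> poly_over L [:c:]" "c \<in> L \<Longrightarrow> poly_over L (monom c n)"
    "poly_over L p \<Longrightarrow> c \<in> L \<Longrightarrow> poly_over L (Polynomial.smult c p)"
    "poly_over L p \<Longrightarrow> poly_over L q \<Longrightarrow> poly_over L (p + q)"
    "poly_over L p \<Longrightarrow> poly_over L q \<Longrightarrow> poly_over L (p - q)"
    using cl by (auto simp: poly_over_def coeff_pCons split: nat.splits)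
  show "poly_over L p \<Longrightarrow> poly_over L (pCons c p) \<longleftrightarrow> c \<in> L"
    unfolding poly_over_def by (metis coeff_pCons_0 coeff_pCons_Suc not0_implies_Suc)
  show "poly_over L p \<Longrightarrow> poly_over L q \<Longrightarrow> poly_over L (p * q)"
    unfolding poly_over_def coeff_mult using cl by (auto intro!: subfield_sum[OF assms])
qed

text \<open>Minimality is measured by degree against all annihilating polynomials over
  \<open>L\<close>; division with remainder turns it into divisibility.\<close>

definition is_minpoly :: "'a::field_char_0 set \<Rightarrow> 'a \<Rightarrow> 'a poly \<Rightarrow> bool" where
  "is_minpoly L x m \<longleftrightarrow> poly_over L m \<and> lead_coeff m = 1 \<and> poly m x = 0 \<and>
     (\<forall>p. poly_over L p \<longrightarrow> poly p x = 0 \<longrightarrow> p \<noteq> 0 \<longrightarrow> degree m \<le> degree p)"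

lemma is_minpoly_exists:
  assumes "class_subfield L" "algebraic x"
  obtains m where "is_minpoly L x m"
proof -
  let ?P = "\<lambda>p. poly_over L p \<and> poly p x = 0 \<and> p \<noteq> 0"
  obtain p where p: "\<And>i. coeff p i \<in> \<rat>" "p \<noteq> 0" "poly p x = 0"
    using assms(2) algebraic_altdef by blast
  then have "?P p" using subfield_Rats_subset[OF assms(1)] by (auto simp: poly_over_def)
  from ex_has_least_nat[of ?P _ degree, OF this]
  obtain q where q: "?P q" "\<forall>r. ?P r \<longrightarrow> degree q \<le> degree r" by blast
  define m where "m = Polynomial.smult (inverse (lead_coeff q)) q"
  have "is_minpoly L x m"
    unfolding is_minpoly_def m_def using q poly_over_basic(6)[OF assms(1)] subfield_closed(7)[OF assms(1)]
    by (auto simp: poly_over_def)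
  then show ?thesis using that by blast
qed

text \<open>Polynomials have coefficients in the whole field. Cancelling leading terms with
  multiples of a monic divisor never leaves \<open>L\<close>, so quotient and remainder stay over
  \<open>L\<close>.\<close>

lemma poly_over_division:
  assumes "class_subfield L" "poly_over L m" "lead_coeff m = 1" "poly_over L p"
  shows "\<exists>q r. poly_over L q \<and> poly_over L r \<and> p = m * q + r \<and> (r = 0 \<or> degree r < degree m)"
  using assms(4)
proof (induction "degree p" arbitrary: p rule: less_induct)
  case less
  note cl = poly_over_basic[OF assms(1)]
  have m0: "m \<noteq> 0" using assms(3) by auto
  show ?case
  proof (cases "p = 0 \<or> degree p < degree m")
    case True
    then show ?thesis using less.prems cl(1) by (intro exI[of _ 0] exI[of _ p]) auto
  next
    case False
    let ?t = "monom (lead_coeff p) (degree p - degree m)"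
    have t: "poly_over L ?t" using less.prems cl(4) by (auto simp: poly_over_def)
    let ?p' = "p - m * ?t"
    have p': "poly_over L ?p'" using cl(8,9) less.prems assms(2) t by blast
    have p0: "p \<noteq> 0" and le: "degree m \<le> degree p" using False by auto
    have t0: "?t \<noteq> 0" using p0 by (simp add: monom_eq_0_iff)
    have dt0: "degree ?t = degree p - degree m" using p0 by (intro degree_monom_eq) simp
    have dt1: "degree (m * ?t) = degree p" using degree_mult_eq[OF m0 t0] le dt0 by simp
    have "lead_coeff (m * ?t) = lead_coeff p"
      by (subst lead_coeff_mult) (simp add: assms(3) dt0)
    note dt = dt1 this[unfolded dt1]
    have c0: "coeff ?p' (degree p) = 0" using dt by simp
    have "degree ?p' \<le> degree p" using dt(1) by (metis degree_diff_le order_refl)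
    then have "?p' = 0 \<or> degree ?p' < degree p"
      using c0 by (metis leading_coeff_0_iff nless_le)
    then show ?thesis
    proof
      assume "?p' = 0"
      then show ?thesis using t cl(1) by (intro exI[of _ ?t] exI[of _ 0]) auto
    next
      assume "degree ?p' < degree p"
      from less.hyps[OF this p'] obtain q r where qr: "poly_over L q" "poly_over L r" "?p' = m * q + r"
        "r = 0 \<or> degree r < degree m" by blast
      then have "p = m * (q + ?t) + r" by (simp add: algebra_simps)
      then show ?thesis using qr cl(7)[OF qr(1) t] by blast
    qed
  qed
qed

lemma minpoly_dvd:
  assumes "class_subfield L" "is_minpoly L x m" "poly_over L p" "poly p x = 0"
  obtains q where "poly_over L q" "p = m * q"
proof -
  obtain q r where qr: "poly_over L q" "poly_over L r" "p = m * q + r" "r = 0 \<or> degree r < degree m"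
    using poly_over_division[OF assms(1) _ _ assms(3), of m] assms(2) by (auto simp: is_minpoly_def)
  have "poly r x = 0" using qr(3) assms(2,4) by (simp add: is_minpoly_def)
  then have "r = 0" using qr(2,4) assms(2) by (auto simp: is_minpoly_def)
  then show ?thesis using qr that by simp
qed

text \<open>A nonzero \<open>y\<close> is a root of an integer polynomial \<open>a + X * q\<close>
  with \<open>a\<close> nonzero, so its inverse is \<open>- q(y) / a\<close>, which lies in the
  ring.\<close>

lemma subring_is_subfield:
  assumes "number_field TYPE('a::field_char_0)" "\<rat> \<subseteq> (R :: 'a set)"
    "\<And>x y. x \<in> R \<Longrightarrow> y \<in> R \<Longrightarrow> x + y \<in> R" "\<And>x y. x \<in> R \<Longrightarrow> y \<in> R \<Longrightarrow> x * y \<in> R"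
  shows "class_subfield R"
  unfolding subfield_class_ring_iff
proof (intro conjI ballI)
  show "1 \<in> R" using assms(2) by auto
  have m1: "-1 \<in> R" using assms(2) by auto
  have neg: "- y \<in> R" if "y \<in> R" for y using assms(4)[OF m1 that] by simp
  show "x - y \<in> R" if "x \<in> R" "y \<in> R" for x y using assms(3)[OF that(1) neg[OF that(2)]] by simp
  show "x * y \<in> R" if "x \<in> R" "y \<in> R" for x y using assms(4) that by simp
  show "inverse y \<in> R" if y: "y \<in> R" for y
  proof (cases "y = 0")
    case False
    obtain p where p: "coeff p 0 \<noteq> 0" "poly (map_poly of_int p) y = 0"
      using algebraicE'_nonzero[OF number_field_algebraic[OF assms(1)] False] by metis
    obtain a q where aq: "p = pCons a q" by (cases p)
    have "a \<noteq> 0" using p(1) aq by simp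
    have eq: "of_int a + y * poly (map_poly of_int q) y = 0" using p(2) aq by (simp add: map_poly_pCons)
    have "poly (map_poly of_int q) y \<in> R"
    proof (induction q)
      case 0 then show ?case using assms(2) by auto
    next
      case (pCons b q)
      have "of_int b \<in> R" using assms(2) by auto
      then show ?case using pCons assms(3,4) y by (simp add: map_poly_pCons)
    qed
    moreover have "- inverse (of_int a) \<in> R" using assms(2) by auto
    ultimately have "poly (map_poly of_int q) y * (- inverse (of_int a)) \<in> R" by (rule assms(4))
    moreover have "inverse y = poly (map_poly of_int q) y * (- inverse (of_int a))"
      using eq \<open>a \<noteq> 0\<close> False by (simp add: field_simps add_eq_0_iff)
    ultimately show ?thesis by simp
  qed (use assms(2) in auto)
qed

text \<open>On \<open>L[x]\<close> the extension sends \<open>p(x)\<close> to the value at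
  \<open>z\<close> of the image of \<open>p\<close>. Two polynomials with the same value at
  \<open>x\<close> differ by a multiple of \<open>m\<close>, whose image vanishes at
  \<open>z\<close>, so the result does not depend on the choice made by \<open>SOME\<close>.\<close>

lemma extend_hom_step:
  assumes nf: "number_field TYPE('a::field_char_0)" and L: "class_subfield (L :: 'a set)" and h: "ring_hom_on L \<sigma>"
    and m: "is_minpoly L x m" and z: "poly (map_poly \<sigma> m) z = 0"
  obtains L' \<sigma>' where "class_subfield L'" "L \<subseteq> L'" "x \<in> L'" "ring_hom_on L' \<sigma>'" "\<And>y. y \<in> L \<Longrightarrow> \<sigma>' y = \<sigma> y" "\<sigma>' x = z"
proof -
  note cl = poly_over_basic[OF L] and hh = map_poly_hom_on[OF L h] and hs = ring_hom_on_subfield[OF L h]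
  define L' where "L' = {poly p x | p. poly_over L p}"
  define \<sigma>' where "\<sigma>' y = poly (map_poly \<sigma> (SOME p. poly_over L p \<and> poly p x = y)) z" for y
  have wd: "poly (map_poly \<sigma> p) z = poly (map_poly \<sigma> q) z" if pq: "poly_over L p" "poly_over L q" "poly p x = poly q x" for p q
  proof -
    have "poly_over L (p - q)" "poly (p - q) x = 0" using pq cl(8) by auto
    then obtain r where r: "poly_over L r" "p - q = m * r" using minpoly_dvd[OF L m] by metis
    have "map_poly \<sigma> p - map_poly \<sigma> q = map_poly \<sigma> m * map_poly \<sigma> r"
      using hh(2)[OF pq(1,2)] hh(3)[of m r] r m by (simp add: is_minpoly_def)
    then have "poly (map_poly \<sigma> p - map_poly \<sigma> q) z = 0" using z by simp
    then show ?thesis by simp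
  qed
  have ev: "\<sigma>' (poly p x) = poly (map_poly \<sigma> p) z" if "poly_over L p" for p
  proof -
    have "poly_over L (SOME q. poly_over L q \<and> poly q x = poly p x) \<and>
        poly (SOME q. poly_over L q \<and> poly q x = poly p x) x = poly p x"
      by (rule someI[of _ p]) (use that in simp)
    then show ?thesis unfolding \<sigma>'_def using wd that by blast
  qed
  have sub: "L \<subseteq> L'"
  proof
    fix c assume "c \<in> L"
    then show "c \<in> L'" unfolding L'_def using cl(3)[of c] by (intro CollectI exI[of _ "[:c:]"]) auto
  qed
  have onL: "\<sigma>' y = \<sigma> y" if "y \<in> L" for y
    using ev[OF cl(3)[OF that]] hs(1) by (simp add: map_poly_pCons)
  have X: "poly_over L [:0, 1:]" using cl(1,2) by (auto simp: poly_over_def coeff_pCons subfield_closed[OF L] split: nat.splits)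
  have "poly [:0, 1:] x \<in> L'" unfolding L'_def using X by blast
  then have x: "x \<in> L'" by simp
  have "\<sigma>' x = z" using ev[OF X] hs(1,2) by (simp add: map_poly_pCons)
  moreover have "class_subfield L'"
  proof (rule subring_is_subfield[OF nf])
    show "\<rat> \<subseteq> L'" using sub subfield_Rats_subset[OF L] by auto
    show "a + b \<in> L'" "a * b \<in> L'" if ab: "a \<in> L'" "b \<in> L'" for a b
    proof -
      obtain p q where pq: "poly_over L p" "poly_over L q" "a = poly p x" "b = poly q x"
        using ab unfolding L'_def by blast
      show "a + b \<in> L'" unfolding L'_def using cl(7)[OF pq(1,2)] pq(3,4) by (intro CollectI exI[of _ "p + q"]) auto
      show "a * b \<in> L'" unfolding L'_def using cl(9)[OF pq(1,2)] pq(3,4) by (intro CollectI exI[of _ "p * q"]) auto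
    qed
  qed
  moreover have "ring_hom_on L' \<sigma>'"
    unfolding ring_hom_on_def
  proof (intro conjI ballI)
    show "\<sigma>' 1 = 1" using onL subfield_closed(1)[OF L] hs(2) by simp
    fix a b assume "a \<in> L'" "b \<in> L'"
    then obtain p q where pq: "poly_over L p" "poly_over L q" "a = poly p x" "b = poly q x"
      unfolding L'_def by blast
    show "\<sigma>' (a + b) = \<sigma>' a + \<sigma>' b" "\<sigma>' (a * b) = \<sigma>' a * \<sigma>' b"
      using ev[OF cl(7)[OF pq(1,2)]] ev[OF cl(9)[OF pq(1,2)]] ev[OF pq(1)] ev[OF pq(2)] hh(1)[OF pq(1,2)] hh(3)[OF pq(1,2)]
      by (simp_all add: pq(3,4))
  qed
  ultimately show ?thesis using that sub x onL by blast
qed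

lemma degree_map_poly_hom_on:
  assumes "class_subfield L" "ring_hom_on L \<sigma>" "poly_over L p" "lead_coeff p = 1"
  shows "degree (map_poly \<sigma> p) = degree p" "lead_coeff (map_poly \<sigma> p) = 1"
proof -
  note hs = ring_hom_on_subfield[OF assms(1,2)]
  show *: "lead_coeff (map_poly \<sigma> p) = 1"
    using lead_coeff_map_poly_nz[of \<sigma> p] hs(1,2) assms(4) by simp
  have "coeff (map_poly \<sigma> p) (degree p) = 1" using coeff_map_poly[of \<sigma> p] hs assms(4) by simp
  then have "degree p \<le> degree (map_poly \<sigma> p)" by (intro le_degree) simp
  then show "degree (map_poly \<sigma> p) = degree p"
    using degree_le[of "degree p" "map_poly \<sigma> p"] coeff_map_poly[of \<sigma> p] hs(1) by (simp add: coeff_eq_0)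
qed

lemma minpoly_degree_pos:
  assumes "is_minpoly L x m" shows "degree m > 0"
proof (rule ccontr)
  assume "\<not> ?thesis"
  then obtain c where "m = [:c:]" by (auto elim: degree_eq_zeroE)
  then show False using assms by (auto simp: is_minpoly_def)
qed

lemma minpoly_has_image_root:
  assumes "class_subfield L" "ring_hom_on L \<sigma>" "is_minpoly L x m"
  obtains z where "poly (map_poly \<sigma> m) z = 0"
proof -
  have "degree (map_poly \<sigma> m) > 0"
    using degree_map_poly_hom_on[OF assms(1,2)] minpoly_degree_pos[OF assms(3)] assms(3) by (simp add: is_minpoly_def)
  then have "\<exists>z. poly (map_poly \<sigma> m) z = 0" by (rule alg_closed_imp_poly_has_root)
  then show ?thesis using that by blast
qed

text \<open>A rational basis is adjoined one element at a time, and algebraic closedness of the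
  complex numbers supplies a root at each step.\<close>

theorem extend_hom:
  assumes nf: "number_field TYPE('a::field_char_0)" and L: "class_subfield (L :: 'a set)" and h: "ring_hom_on L \<sigma>"
  obtains \<tau> where "\<tau> \<in> embeddings UNIV" "\<And>y. y \<in> L \<Longrightarrow> \<tau> y = \<sigma> y"
proof -
  let ?d = "field_degree TYPE('a)"
  obtain b :: "nat \<Rightarrow> 'a" where b: "rat_span {..<?d} b" using rat_basis_exists[OF nf] by metis
  have "\<exists>L' \<sigma>'. class_subfield L' \<and> L \<subseteq> L' \<and> b ` {..<n} \<subseteq> L' \<and> ring_hom_on L' \<sigma>' \<and> (\<forall>y\<in>L. \<sigma>' y = \<sigma> y)" for n
  proof (induction n)
    case 0
    then show ?case using L h by auto
  next
    case (Suc n)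
    then obtain L' \<sigma>' where L': "class_subfield L'" "L \<subseteq> L'" "b ` {..<n} \<subseteq> L'" "ring_hom_on L' \<sigma>'" "\<forall>y\<in>L. \<sigma>' y = \<sigma> y"
      by blast
    obtain m where m: "is_minpoly L' (b n) m" using is_minpoly_exists[OF L'(1) number_field_algebraic[OF nf]] by metis
    obtain z where z: "poly (map_poly \<sigma>' m) z = 0" using minpoly_has_image_root[OF L'(1,4) m] by metis
    obtain L'' \<sigma>'' where L'': "class_subfield L''" "L' \<subseteq> L''" "b n \<in> L''" "ring_hom_on L'' \<sigma>''" "\<And>y. y \<in> L' \<Longrightarrow> \<sigma>'' y = \<sigma>' y"
      using extend_hom_step[OF nf L'(1,4) m z] by metis
    have "b ` {..<Suc n} \<subseteq> L''" using L'(3) L''(2,3) by (auto simp: lessThan_Suc)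
    then show ?case using L' L'' by (intro exI[of _ L''] exI[of _ \<sigma>'']) auto
  qed
  from this[of ?d] obtain L' \<sigma>' where L': "class_subfield L'" "b ` {..<?d} \<subseteq> L'" "ring_hom_on L' \<sigma>'" "\<forall>y\<in>L. \<sigma>' y = \<sigma> y"
    by blast
  have "y \<in> L'" for y
  proof -
    obtain c :: "nat \<Rightarrow> rat" where "y = (\<Sum>i<?d. of_rat (c i) * b i)" using b by (auto simp: rat_span_def)
    moreover have "of_rat q \<in> L'" for q using subfield_Rats_subset[OF L'(1)] by auto
    ultimately show ?thesis using L'(2) by (auto intro!: subfield_sum[OF L'(1)] subfield_closed(6)[OF L'(1)])
  qed
  then have "L' = UNIV" by auto
  then show ?thesis using that[of \<sigma>'] L' by (simp add: embeddings_UNIV_iff)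
qed

theorem extend_hom_root:
  assumes nf: "number_field TYPE('a::field_char_0)" and L: "class_subfield (L :: 'a set)" and h: "ring_hom_on L \<sigma>"
    and m: "is_minpoly L x m" and z: "poly (map_poly \<sigma> m) z = 0"
  obtains \<tau> where "\<tau> \<in> embeddings UNIV" "\<And>y. y \<in> L \<Longrightarrow> \<tau> y = \<sigma> y" "\<tau> x = z"
proof -
  obtain L' \<sigma>' where 1: "class_subfield L'" "L \<subseteq> L'" "x \<in> L'" "ring_hom_on L' \<sigma>'" "\<And>y. y \<in> L \<Longrightarrow> \<sigma>' y = \<sigma> y" "\<sigma>' x = z"
    using extend_hom_step[OF assms] by metis
  obtain \<tau> where \<tau>: "\<tau> \<in> embeddings UNIV" "\<And>y. y \<in> L' \<Longrightarrow> \<tau> y = \<sigma>' y"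
    using extend_hom[OF nf 1(1,4)] by metis
  show ?thesis by (rule that[OF \<tau>(1)]) (use 1 \<tau>(2) in auto)
qed

text \<open>\<open>a\<close> and \<open>b\<close> are the multiplicities of \<open>z\<close> and
  \<open>w\<close>, found by splitting off one linear factor at a time; the second-highest
  coefficient is minus the sum of the roots. If \<open>z = w\<close>, every root is counted by
  \<open>b\<close>, because the case \<open>c = w\<close> comes first.\<close>

lemma two_roots_coeff:
  fixes p :: "complex poly"
  assumes "degree p = Suc n" "lead_coeff p = 1" "\<And>c. poly p c = 0 \<Longrightarrow> c = z \<or> c = w"
  shows "\<exists>a b. a + b = Suc n \<and> coeff p n = - (of_nat a * z + of_nat b * w) \<and> (poly p w = 0 \<longrightarrow> b > 0)"
  using assms
proof (induction n arbitrary: p)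
  case (0 p)
  obtain c where c: "poly p c = 0" using alg_closed_imp_poly_has_root[of p] 0 by auto
  obtain q where q: "p = [:-c, 1:] * q" using c by (metis dvdE poly_eq_0_iff_dvd)
  have q0: "q \<noteq> 0" using 0 q by auto
  have "degree q = 0" using 0 q q0 by (simp add: degree_mult_eq del: mult_pCons_left)
  then obtain k where k: "q = [:k:]" by (auto elim: degree_eq_zeroE)
  have "lead_coeff ([:-c, 1:] * q) = lead_coeff q" by (subst lead_coeff_mult) simp
  then have "lead_coeff q = 1" using 0(2) unfolding q[symmetric] by simp
  then have "k = 1" using k by simp
  then have p: "p = [:-c, 1:]" using q k by simp
  consider "c = w" | "c = z" "c \<noteq> w" using 0(3)[OF c] by blast
  then show ?case
  proof cases
    case 1 show ?thesis by (rule exI[of _ 0], rule exI[of _ 1], use 1 p in simp)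
  next
    case 2 show ?thesis by (rule exI[of _ 1], rule exI[of _ 0], use 2 p in simp)
  qed
next
  case (Suc n p)
  obtain c where c: "poly p c = 0" using alg_closed_imp_poly_has_root[of p] Suc.prems by auto
  obtain q where q: "p = [:-c, 1:] * q" using c by (metis dvdE poly_eq_0_iff_dvd)
  have q0: "q \<noteq> 0" using Suc.prems q by auto
  have dq: "degree q = Suc n" using Suc.prems q q0 by (simp add: degree_mult_eq del: mult_pCons_left)
  have lq: "lead_coeff q = 1" using Suc.prems(2) q by (simp add: lead_coeff_mult del: mult_pCons_left)
  have "x = z \<or> x = w" if "poly q x = 0" for x using Suc.prems(3)[of x] that q by simp
  from Suc.IH[OF dq lq this] obtain a b where ab: "a + b = Suc n" "coeff q n = - (of_nat a * z + of_nat b * w)"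
    "poly q w = 0 \<longrightarrow> b > 0" by blast
  have cp: "coeff p (Suc n) = coeff q n - c" using lq dq by (simp add: q)
  have pw: "poly p w = (w - c) * poly q w" by (simp add: q algebra_simps)
  consider "c = w" | "c = z" "c \<noteq> w" using Suc.prems(3)[OF c] by blast
  then show ?case
  proof cases
    case 1
    have "coeff p (Suc n) = - (of_nat a * z + of_nat (Suc b) * w)"
      by (simp only: cp ab(2) 1) (simp add: algebra_simps)
    then show ?thesis using ab(1) by (metis add_Suc_right zero_less_Suc)
  next
    case 2
    have "coeff p (Suc n) = - (of_nat (Suc a) * z + of_nat b * w)"
      by (simp only: cp ab(2) 2(1)) (simp add: algebra_simps)
    moreover have "poly p w = 0 \<longrightarrow> b > 0" using ab(3) pw 2(2) by simp
    ultimately show ?thesis using ab(1) by (metis add_Suc)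
  qed
qed

lemma embedding_hom_on:
  assumes "\<sigma> \<in> embeddings UNIV" shows "ring_hom_on L \<sigma>"
  using assms by (auto simp: embeddings_UNIV_iff ring_hom_on_def)

text \<open>\<open>\<sigma> y\<close> is the sum of the roots of the image under \<open>\<sigma>\<close> of the minimal polynomial of \<open>x\<close> over \<open>L\<close>.\<close>

lemma two_conjugates_trace:
  assumes nf: "number_field TYPE('a::field_char_0)" and L: "class_subfield (L :: 'a set)"
    and \<sigma>: "\<sigma> \<in> embeddings UNIV"
    and two: "\<forall>\<tau>\<in>embeddings UNIV. (\<forall>y\<in>L. \<tau> y = \<sigma> y) \<longrightarrow> \<tau> x = \<sigma> x \<or> \<tau> x = w"
  shows "\<exists>a b y. a + b > 0 \<and> y \<in> L \<and> of_nat a * \<sigma> x + of_nat b * w = \<sigma> y \<and>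
    ((\<exists>\<tau>\<in>embeddings UNIV. (\<forall>y\<in>L. \<tau> y = \<sigma> y) \<and> \<tau> x = w) \<longrightarrow> b > (0::nat))"
proof -
  obtain m where m: "is_minpoly L x m" using is_minpoly_exists[OF L number_field_algebraic[OF nf]] by metis
  have h: "ring_hom_on L \<sigma>" by (rule embedding_hom_on[OF \<sigma>])
  have mo: "poly_over L m" "lead_coeff m = 1" using m by (auto simp: is_minpoly_def)
  let ?p = "map_poly \<sigma> m"
  note dm = degree_map_poly_hom_on[OF L h mo]
  obtain n where n: "degree m = Suc n" using minpoly_degree_pos[OF m] gr0_implies_Suc by blast
  have ev: "poly ?p (\<tau> x) = 0" if "\<tau> \<in> embeddings UNIV" "\<forall>y\<in>L. \<tau> y = \<sigma> y" for \<tau>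
  proof -
    have "poly ?p (\<tau> x) = (\<Sum>i\<le>degree m. \<sigma> (coeff m i) * \<tau> x ^ i)"
      using dm(1) by (simp add: poly_altdef coeff_map_poly embedding_simps(1)[OF \<sigma>])
    also have "\<dots> = (\<Sum>i\<le>degree m. \<tau> (coeff m i) * \<tau> x ^ i)"
      using mo that by (intro sum.cong) (auto simp: poly_over_def)
    also have "\<dots> = \<tau> (poly m x)" by (simp add: poly_altdef embedding_simps[OF that(1)])
    also have "\<dots> = 0" using m by (simp add: is_minpoly_def embedding_simps[OF that(1)])
    finally show ?thesis .
  qed
  have "c = \<sigma> x \<or> c = w" if c0: "poly ?p c = 0" for c
  proof -
    obtain \<tau> where "\<tau> \<in> embeddings UNIV" "\<And>y. y \<in> L \<Longrightarrow> \<tau> y = \<sigma> y" "\<tau> x = c"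
      using extend_hom_root[OF nf L h m c0] by metis
    then show ?thesis using two by (metis (no_types, lifting))
  qed
  from two_roots_coeff[OF _ dm(2) this] obtain a b where ab: "a + b = Suc n"
    "coeff ?p n = - (of_nat a * \<sigma> x + of_nat b * w)" "poly ?p w = 0 \<longrightarrow> b > 0"
    using dm(1) n by auto
  have y: "- coeff m n \<in> L" using mo subfield_closed(3)[OF L] by (auto simp: poly_over_def)
  have "of_nat a * \<sigma> x + of_nat b * w = \<sigma> (- coeff m n)"
    using ab(2) by (simp add: coeff_map_poly embedding_simps[OF \<sigma>])
  moreover have "b > 0" if "\<exists>\<tau>\<in>embeddings UNIV. (\<forall>y\<in>L. \<tau> y = \<sigma> y) \<and> \<tau> x = w"
    using that ev ab(3) by blast
  ultimately show ?thesis using ab(1) y by (metis zero_less_Suc)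
qed

section \<open>Generators of the field\<close>

lemma adjoin_to_Rats_subfield: "class_subfield (adjoin_to_Rats \<gamma>)" "\<gamma> \<in> adjoin_to_Rats \<gamma>"
  using field.generate_fieldE(1,2)[OF class_field _ refl, of "{\<gamma>}"] by (auto simp: adjoin_to_Rats_def)

lemma adjoin_to_Rats_least:
  assumes "class_subfield L" "\<gamma> \<in> L" shows "adjoin_to_Rats \<gamma> \<subseteq> L"
  using field.generate_field_min_subfield1[OF class_field _ assms(1), of "{\<gamma>}"] assms(2)
  by (auto simp: adjoin_to_Rats_def)

text \<open>One embedding is enough for the test. Every \<open>x\<close> has only the conjugate
  \<open>\<sigma> x\<close> over \<rat>(\<gamma>), so the trace lemma with
  \<open>w = \<sigma> x\<close> puts a positive multiple of \<open>x\<close> into that field, and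
  characteristic zero allows the division.\<close>

lemma generator_criterion:
  assumes nf: "number_field TYPE('a::field_char_0)" and \<sigma>: "\<sigma> \<in> embeddings (UNIV :: 'a set)"
    and uniq: "\<And>\<tau>. \<tau> \<in> embeddings UNIV \<Longrightarrow> \<tau> \<gamma> = \<sigma> \<gamma> \<Longrightarrow> \<tau> = \<sigma>"
  shows "adjoin_to_Rats \<gamma> = UNIV"
proof -
  have "x \<in> adjoin_to_Rats \<gamma>" for x
  proof -
    let ?L = "adjoin_to_Rats \<gamma>"
    note L = adjoin_to_Rats_subfield(1)[of \<gamma>]
    have "\<forall>\<tau>\<in>embeddings UNIV. (\<forall>y\<in>?L. \<tau> y = \<sigma> y) \<longrightarrow> \<tau> x = \<sigma> x \<or> \<tau> x = \<sigma> x"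
    proof (intro ballI impI)
      fix \<tau> assume t: "\<tau> \<in> embeddings UNIV" "\<forall>y\<in>?L. \<tau> y = \<sigma> y"
      have "\<tau> = \<sigma>" by (rule uniq[OF t(1) bspec[OF t(2) adjoin_to_Rats_subfield(2)]])
      then show "\<tau> x = \<sigma> x \<or> \<tau> x = \<sigma> x" by simp
    qed
    from two_conjugates_trace[OF nf L \<sigma> this] obtain a b :: nat and y
      where ab: "a + b > 0" "y \<in> ?L" "of_nat a * \<sigma> x + of_nat b * \<sigma> x = \<sigma> y" by (elim exE conjE)
    have "\<sigma> (of_nat (a + b) * x) = \<sigma> y" using ab(3) by (simp add: embedding_simps[OF \<sigma>] algebra_simps)
    then have "of_nat (a + b) * x = y" by (rule embedding_simps(8)[OF \<sigma>, THEN iffD1])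
    moreover have "(of_nat (a + b) :: 'a) \<noteq> 0" using ab(1) by (simp only: of_nat_eq_0_iff)
    ultimately have x: "x = y / of_nat (a + b)" by (metis nonzero_mult_div_cancel_left)
    show ?thesis unfolding x by (rule subfield_closed(8)[OF L ab(2) subfield_of_nat[OF L]])
  qed
  then show ?thesis by auto
qed

lemma embeddings_eqI:
  assumes "rat_span I b" "\<sigma> \<in> embeddings UNIV" "\<tau> \<in> embeddings UNIV" "\<And>i. i \<in> I \<Longrightarrow> \<sigma> (b i) = \<tau> (b i)"
  shows "\<sigma> = \<tau>"
proof
  fix x
  obtain c :: "_ \<Rightarrow> rat" where "x = (\<Sum>i\<in>I. of_rat (c i) * b i)" using assms(1) by (auto simp: rat_span_def)
  then show "\<sigma> x = \<tau> x" using assms(4) by (simp add: embedding_simps[OF assms(2)] embedding_simps[OF assms(3)])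
qed

section \<open>The number of embeddings and their independence\<close>

lemma finite_embeddings:
  assumes nf: "number_field TYPE('a::field_char_0)"
  shows "finite (embeddings (UNIV :: 'a set))"
proof -
  let ?d = "field_degree TYPE('a)"
  obtain b :: "nat \<Rightarrow> 'a" where b: "rat_span {..<?d} b" using rat_basis_exists[OF nf] by metis
  have "\<exists>p :: int poly. p \<noteq> 0 \<and> poly (map_poly of_int p) (b i) = 0" for i
    using algebraicE'[OF number_field_algebraic[OF nf, of "b i"]] by metis
  then obtain p :: "nat \<Rightarrow> int poly" where p: "\<And>i. p i \<noteq> 0" "\<And>i. poly (map_poly of_int (p i)) (b i) = 0" by metis
  let ?R = "\<lambda>i. {z :: complex. poly (map_poly of_int (p i)) z = 0}"
  let ?f = "\<lambda>\<sigma>. restrict (\<lambda>i. \<sigma> (b i)) {..<?d}"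
  have "?f ` embeddings UNIV \<subseteq> PiE {..<?d} ?R"
  proof (rule image_subsetI)
    fix \<sigma> :: "'a \<Rightarrow> complex" assume \<sigma>: "\<sigma> \<in> embeddings UNIV"
    have "poly (map_poly of_int (p i)) (\<sigma> (b i)) = \<sigma> (poly (map_poly of_int (p i)) (b i))" for i
      by (simp add: poly_altdef degree_map_poly coeff_map_poly embedding_simps[OF \<sigma>])
    then show "?f \<sigma> \<in> PiE {..<?d} ?R" using p(2) by (auto simp: embedding_simps[OF \<sigma>])
  qed
  moreover have "finite (PiE {..<?d} ?R)"
    using p(1) by (intro finite_PiE) (auto intro!: poly_roots_finite simp: map_poly_eq_0_iff)
  ultimately have "finite (?f ` embeddings UNIV)" by (rule finite_subset)
  moreover have "inj_on ?f (embeddings UNIV)"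
  proof (rule inj_onI)
    fix \<sigma> \<tau> :: "'a \<Rightarrow> complex" assume *: "\<sigma> \<in> embeddings UNIV" "\<tau> \<in> embeddings UNIV" "?f \<sigma> = ?f \<tau>"
    have "\<sigma> (b i) = \<tau> (b i)" if "i \<in> {..<?d}" for i using fun_cong[OF *(3), of i] that by simp
    then show "\<sigma> = \<tau>" by (rule embeddings_eqI[OF b *(1,2)])
  qed
  ultimately show ?thesis using finite_imageD by blast
qed

text \<open>For \<theta> equal to the sum of the \<open>b i * t ^ i\<close>, two distinct embeddings
  agree at \<theta> exactly if \<open>t\<close> is a root of a certain nonzero polynomial. Finitely
  many pairs give finitely many bad \<open>t\<close>, so some natural number works.\<close>

lemma separating_element:
  assumes nf: "number_field TYPE('a::field_char_0)"
  obtains \<theta> :: "'a::field_char_0" where "inj_on (\<lambda>\<sigma>. \<sigma> \<theta>) (embeddings UNIV)"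
proof -
  let ?d = "field_degree TYPE('a)" and ?E = "embeddings (UNIV :: 'a set)"
  obtain b :: "nat \<Rightarrow> 'a" where b: "rat_span {..<?d} b" using rat_basis_exists[OF nf] by metis
  let ?P = "\<lambda>(\<sigma>, \<tau>). (\<Sum>i<?d. monom (\<sigma> (b i) - \<tau> (b i)) i)"
  let ?X = "{(\<sigma>, \<tau>). \<sigma> \<in> ?E \<and> \<tau> \<in> ?E \<and> \<sigma> \<noteq> \<tau>}"
  have X: "finite ?X"
    by (rule finite_subset[of _ "?E \<times> ?E"]) (use finite_embeddings[OF nf] in auto)
  have nz: "?P s \<noteq> 0" if s: "s \<in> ?X" for s
  proof
    assume z: "?P s = 0"
    obtain \<sigma> \<tau> where st: "s = (\<sigma>, \<tau>)" by (cases s)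
    have "\<sigma> (b i) = \<tau> (b i)" if "i \<in> {..<?d}" for i
    proof -
      have "coeff (?P s) i = \<sigma> (b i) - \<tau> (b i)"
        using that by (simp add: st coeff_sum sum.delta)
      then show ?thesis using z by simp
    qed
    then show False using embeddings_eqI[OF b, of \<sigma> \<tau>] s st by auto
  qed
  have "(\<Prod>s\<in>?X. ?P s) \<noteq> 0" using X nz by (simp add: prod_zero_iff)
  then have "finite {z. poly (\<Prod>s\<in>?X. ?P s) z = 0}" by (rule poly_roots_finite)
  moreover have "infinite (range (of_nat :: nat \<Rightarrow> complex))" by (simp add: range_inj_infinite inj_of_nat)
  ultimately obtain t :: nat where t: "poly (\<Prod>s\<in>?X. ?P s) (of_nat t) \<noteq> 0"
    by (metis (mono_tags, lifting) finite_subset image_subsetI mem_Collect_eq)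
  define \<theta> where "\<theta> = (\<Sum>i<?d. b i * of_nat t ^ i)"
  have "inj_on (\<lambda>\<sigma>. \<sigma> \<theta>) ?E"
  proof (rule inj_onI, rule ccontr)
    fix \<sigma> \<tau> assume *: "\<sigma> \<in> ?E" "\<tau> \<in> ?E" "\<sigma> \<theta> = \<tau> \<theta>" "\<sigma> \<noteq> \<tau>"
    have "poly (?P (\<sigma>, \<tau>)) (of_nat t) = \<sigma> \<theta> - \<tau> \<theta>"
      by (simp add: \<theta>_def embedding_simps[OF *(1)] embedding_simps[OF *(2)] poly_sum poly_monom left_diff_distrib sum_subtractf)
    moreover have "poly (?P (\<sigma>, \<tau>)) (of_nat t) \<noteq> 0"
      using t X * by (simp add: poly_prod prod_zero_iff) blast
    ultimately show False using *(3) by simp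
  qed
  then show ?thesis using that by blast
qed

text \<open>A separating element generates the field by \<open>generator_criterion\<close>, so its
  minimal polynomial over \<rat> has the degree of the field. Extending from \<rat> identifies the
  roots of this polynomial with the values of the embeddings at \<theta>. The roots are simple
  because the derivative has smaller degree, so counting them counts the embeddings.\<close>

theorem primitive_basis:
  assumes nf: "number_field TYPE('a::field_char_0)"
  obtains \<theta> :: "'a::field_char_0" where "inj_on (\<lambda>\<sigma>. \<sigma> \<theta>) (embeddings UNIV)"
    "card (embeddings (UNIV :: 'a set)) = field_degree TYPE('a)"
    "rat_indep {..<field_degree TYPE('a)} (\<lambda>i. \<theta> ^ i)" "rat_span {..<field_degree TYPE('a)} (\<lambda>i. \<theta> ^ i)"
proof -
  let ?E = "embeddings (UNIV :: 'a set)"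
  obtain \<theta> :: 'a where inj: "inj_on (\<lambda>\<sigma>. \<sigma> \<theta>) ?E" using separating_element[OF nf] by metis
  note Q = subfield_Rats[where 'a = 'a] and cl = poly_over_basic[OF subfield_Rats[where 'a = 'a]]
  obtain m where m: "is_minpoly \<rat> \<theta> m" using is_minpoly_exists[OF Q number_field_algebraic[OF nf]] by metis
  have mo: "poly_over \<rat> m" "lead_coeff m = 1" "poly m \<theta> = 0" using m by (auto simp: is_minpoly_def)
  let ?k = "degree m"
  have ind: "rat_indep {..<?k} (\<lambda>i. \<theta> ^ i)"
    unfolding rat_indep_def
  proof (intro allI impI ballI)
    fix c :: "nat \<Rightarrow> rat" and j assume c: "(\<Sum>i<?k. of_rat (c i) * \<theta> ^ i) = 0" and j: "j \<in> {..<?k}"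
    define p where "p = (\<Sum>i<?k. monom (of_rat (c i) :: 'a) i)"
    have co: "coeff p i = (if i < ?k then of_rat (c i) else 0)" for i
      by (auto simp: p_def coeff_sum if_distrib[of "\<lambda>f. coeff f i"] sum.delta coeff_monom)
    have po: "poly_over \<rat> p" by (auto simp: poly_over_def co)
    have pz: "poly p \<theta> = 0" using c by (simp add: p_def poly_sum poly_monom)
    have "p = 0"
    proof (rule ccontr)
      assume p0: "p \<noteq> 0"
      then have "?k \<le> degree p" using m po pz by (auto simp: is_minpoly_def)
      moreover have "coeff p (degree p) \<noteq> 0" using p0 by simp
      ultimately show False by (simp add: co)
    qed
    then show "c j = 0" using co[of j] j by simp
  qed
  define L where "L = {poly p \<theta> | p. poly_over \<rat> p}"
  have Lsub: "class_subfield L"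
  proof (rule subring_is_subfield[OF nf])
    show "\<rat> \<subseteq> L"
    proof
      fix c :: 'a assume "c \<in> \<rat>"
      then show "c \<in> L" unfolding L_def using cl(3)[of c] by (intro CollectI exI[of _ "[:c:]"]) auto
    qed
    show "a + b \<in> L" "a * b \<in> L" if ab: "a \<in> L" "b \<in> L" for a b
    proof -
      obtain p q where pq: "poly_over \<rat> p" "poly_over \<rat> q" "a = poly p \<theta>" "b = poly q \<theta>"
        using ab unfolding L_def by blast
      show "a + b \<in> L" unfolding L_def using cl(7)[OF pq(1,2)] pq(3,4) by (intro CollectI exI[of _ "p + q"]) auto
      show "a * b \<in> L" unfolding L_def using cl(9)[OF pq(1,2)] pq(3,4) by (intro CollectI exI[of _ "p * q"]) auto
    qed
  qed
  have "poly_over \<rat> [:0, 1 :: 'a:]" by (auto simp: poly_over_def coeff_pCons split: nat.splits)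
  then have "\<theta> \<in> L" unfolding L_def by (intro CollectI exI[of _ "[:0, 1:]"]) auto
  \<comment> \<open>The inclusion of \<rat> into the complex numbers extends to the whole field, so
    at least one embedding exists.\<close>
  obtain \<sigma>0 where \<sigma>0: "\<sigma>0 \<in> ?E"
  proof -
    have "ring_hom_on \<rat> (\<lambda>x::'a. of_rat (inv_into UNIV of_rat x))"
    proof -
      have "inv_into UNIV of_rat (of_rat q :: 'a) = q" for q by (simp add: inj_def inv_f_f)
      note inv = this
      have "inv_into UNIV of_rat (1 :: 'a) = (1 :: rat)" using inv[of 1] by simp
      then show ?thesis
        by (auto simp: ring_hom_on_def Rats_def inv of_rat_add[symmetric] of_rat_mult[symmetric] simp del: of_rat_add of_rat_mult)
    qed
    from extend_hom[OF nf Q this] show ?thesis using that by metis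
  qed
  have "adjoin_to_Rats \<theta> = UNIV"
    by (rule generator_criterion[OF nf \<sigma>0]) (use inj \<sigma>0 in \<open>auto simp: inj_on_def\<close>)
  then have LU: "L = UNIV" using adjoin_to_Rats_least[OF Lsub \<open>\<theta> \<in> L\<close>] by auto
  have span: "rat_span {..<?k} (\<lambda>i. \<theta> ^ i)"
    unfolding rat_span_def
  proof
    fix x
    have "x \<in> L" using LU by simp
    then obtain p where p: "x = poly p \<theta>" "poly_over \<rat> p" unfolding L_def by blast
    obtain q r where qr: "poly_over \<rat> r" "p = m * q + r" "r = 0 \<or> degree r < ?k"
      using poly_over_division[OF Q mo(1,2) p(2)] by blast
    have x: "x = poly r \<theta>" using p qr mo by simp
    have "\<forall>i. \<exists>q::rat. coeff r i = of_rat q" using qr(1) by (auto simp: poly_over_def Rats_def)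
    then obtain c :: "nat \<Rightarrow> rat" where c: "\<And>i. coeff r i = of_rat (c i)" by metis
    have "x = (\<Sum>i<?k. of_rat (c i) * \<theta> ^ i)"
      unfolding x poly_altdef c[symmetric]
      by (rule sum.mono_neutral_left) (use qr(3) minpoly_degree_pos[OF m] in \<open>auto simp: not_le coeff_eq_0\<close>)
    then show "\<exists>c::nat \<Rightarrow> rat. x = (\<Sum>i<?k. of_rat (c i) * \<theta> ^ i)" by blast
  qed
  have k: "?k = field_degree TYPE('a)" using rat_indep_card_eq_iff[OF nf _ ind] span by simp
  let ?p = "map_poly \<sigma>0 m"
  have h0: "ring_hom_on \<rat> \<sigma>0" by (rule embedding_hom_on[OF \<sigma>0])
  note dm = degree_map_poly_hom_on[OF Q h0 mo(1,2)]
  have agree: "map_poly \<tau> q = map_poly \<sigma>0 q" if tq: "\<tau> \<in> ?E" "poly_over \<rat> q" for \<tau> q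
  proof (rule poly_eqI)
    fix i
    obtain u where "coeff q i = of_rat u" using tq(2) by (auto simp: poly_over_def Rats_def)
    then show "coeff (map_poly \<tau> q) i = coeff (map_poly \<sigma>0 q) i"
      by (simp add: coeff_map_poly embedding_simps[OF \<sigma>0] embedding_simps[OF tq(1)])
  qed
  have ev: "poly (map_poly \<tau> q) (\<tau> y) = \<tau> (poly q y)" if "\<tau> \<in> ?E" for \<tau> y q
    using that by (simp add: poly_altdef degree_map_poly coeff_map_poly embedding_simps[OF that])
  have roots: "{z. poly ?p z = 0} = (\<lambda>\<sigma>. \<sigma> \<theta>) ` ?E"
  proof (intro equalityI subsetI)
    fix z assume "z \<in> {z. poly ?p z = 0}"
    then have z: "poly ?p z = 0" by simp
    obtain \<tau> where "\<tau> \<in> ?E" "\<tau> \<theta> = z" by (rule extend_hom_root[OF nf Q h0 m z]) blast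
    then show "z \<in> (\<lambda>\<sigma>. \<sigma> \<theta>) ` ?E" by blast
  next
    fix z assume "z \<in> (\<lambda>\<sigma>. \<sigma> \<theta>) ` ?E"
    then obtain \<tau> where t: "\<tau> \<in> ?E" "z = \<tau> \<theta>" by blast
    then show "z \<in> {z. poly ?p z = 0}"
      using ev[OF t(1), of m \<theta>] agree[OF t(1) mo(1)] mo(3) by (simp add: embedding_simps[OF t(1)])
  qed
  have "rsquarefree ?p"
    unfolding rsquarefree_roots
  proof (intro allI notI)
    fix z assume z: "poly ?p z = 0 \<and> poly (pderiv ?p) z = 0"
    then obtain \<tau> where t: "\<tau> \<in> ?E" "z = \<tau> \<theta>" using roots by auto
    have pd: "poly_over \<rat> (pderiv m)" using mo(1) by (auto simp: poly_over_def coeff_pderiv)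
    have "pderiv ?p = map_poly \<sigma>0 (pderiv m)"
      by (rule poly_eqI) (simp add: coeff_pderiv coeff_map_poly embedding_simps[OF \<sigma>0] del: of_nat_Suc)
    then have "\<tau> (poly (pderiv m) \<theta>) = 0" using z t ev[OF t(1), of "pderiv m" \<theta>] agree[OF t(1) pd] by simp
    then have "poly (pderiv m) \<theta> = 0" by (simp add: embedding_simps[OF t(1)])
    moreover have "pderiv m \<noteq> 0" using minpoly_degree_pos[OF m] by (simp add: pderiv_eq_0_iff)
    ultimately have "?k \<le> degree (pderiv m)" using m pd by (auto simp: is_minpoly_def)
    then show False using minpoly_degree_pos[OF m] by (simp add: degree_pderiv)
  qed
  then have sq: "rsquarefree ?p" .
  have p0: "?p \<noteq> 0" using dm(2) by auto
  have "card {z. poly ?p z = 0} = degree ?p"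
  proof -
    have "degree ?p = size (proots ?p)" by (simp add: size_proots_complex)
    also have "\<dots> = (\<Sum>z\<in>set_mset (proots ?p). count (proots ?p) z)" by (simp add: size_multiset_overloaded_eq)
    also have "\<dots> = (\<Sum>z\<in>{z. poly ?p z = 0}. 1)"
    proof (rule sum.cong)
      show "set_mset (proots ?p) = {z. poly ?p z = 0}" using p0 by simp
      fix z assume "z \<in> {z. poly ?p z = 0}"
      then show "count (proots ?p) z = 1"
        using rsquarefree_root_order[OF sq] p0 by (simp add: count_proots)
    qed
    finally show ?thesis by simp
  qed
  then have "card ?E = field_degree TYPE('a)"
    using roots card_image[OF inj] dm(1) k by simp
  then show ?thesis by (rule that[OF inj _ ind[unfolded k] span[unfolded k]])
qed

lemma card_embeddings:
  assumes "number_field TYPE('a::field_char_0)"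
  shows "card (embeddings (UNIV :: 'a set)) = field_degree TYPE('a)"
  by (rule primitive_basis[OF assms])

text \<open>In powers of \<theta> a relation becomes a polynomial of degree below \<open>d\<close>
  that vanishes at the \<open>d\<close> distinct numbers \<open>\<sigma> \<theta>\<close>, hence is
  zero. The rational base changes \<open>p\<close> and \<open>q\<close> between \<open>b\<close> and
  the powers of \<theta> carry this over to \<open>b\<close>.\<close>

theorem embedding_columns_independent:
  assumes nf: "number_field TYPE('a::field_char_0)" and I: "finite I" "rat_indep I (b :: 'i \<Rightarrow> 'a::field_char_0)" "rat_span I b"
    and c: "\<And>\<sigma>. \<sigma> \<in> embeddings UNIV \<Longrightarrow> (\<Sum>i\<in>I. c i * \<sigma> (b i)) = 0" and k: "k \<in> I"
  shows "c k = 0"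
proof -
  let ?d = "field_degree TYPE('a)" and ?E = "embeddings (UNIV :: 'a set)"
  obtain \<theta> :: 'a where \<theta>': "inj_on (\<lambda>\<sigma>. \<sigma> \<theta>) ?E" "card ?E = ?d"
    "rat_indep {..<?d} (\<lambda>i. \<theta> ^ i)" "rat_span {..<?d} (\<lambda>i. \<theta> ^ i)"
    by (rule primitive_basis[OF nf])
  note \<theta> = \<theta>'(1,2,4)
  have "\<forall>i. \<exists>p::nat \<Rightarrow> rat. b i = (\<Sum>j<?d. of_rat (p j) * \<theta> ^ j)" using \<theta>(3) by (auto simp: rat_span_def)
  then obtain p :: "'i \<Rightarrow> nat \<Rightarrow> rat" where p: "\<And>i. b i = (\<Sum>j<?d. of_rat (p i j) * \<theta> ^ j)" by metis
  have "\<forall>j. \<exists>q::'i \<Rightarrow> rat. \<theta> ^ j = (\<Sum>i\<in>I. of_rat (q i) * b i)" using I(3) by (auto simp: rat_span_def)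
  then obtain q :: "nat \<Rightarrow> 'i \<Rightarrow> rat" where q: "\<And>j. \<theta> ^ j = (\<Sum>i\<in>I. of_rat (q j i) * b i)" by metis
  have pq: "(\<Sum>j<?d. p i j * q j k) = (if i = k then 1 else 0)" if i: "i \<in> I" for i
  proof -
    let ?e = "\<lambda>k. (\<Sum>j<?d. p i j * q j k) - (if i = k then 1 else 0)"
    have "(\<Sum>k\<in>I. of_rat (?e k) * b k) = (\<Sum>k\<in>I. (\<Sum>j<?d. of_rat (p i j) * of_rat (q j k) * b k)) - (\<Sum>k\<in>I. (if i = k then b k else 0))"
      by (simp add: of_rat_diff of_rat_sum of_rat_mult left_diff_distrib sum_subtractf sum_distrib_right if_distrib[of of_rat] if_distrib[of "\<lambda>x. x * _"] cong: if_cong)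
    also have "(\<Sum>k\<in>I. (if i = k then b k else 0)) = b i" using i I(1) by simp
    also have "(\<Sum>k\<in>I. (\<Sum>j<?d. of_rat (p i j) * of_rat (q j k) * b k)) = (\<Sum>j<?d. of_rat (p i j) * \<theta> ^ j)"
      unfolding q by (subst sum.swap) (simp add: sum_distrib_left mult.assoc)
    also have "\<dots> = b i" using p by simp
    finally have "(\<Sum>k\<in>I. of_rat (?e k) * b k) = 0" by simp
    then have "\<forall>k\<in>I. ?e k = 0" by (rule I(2)[unfolded rat_indep_def, THEN spec, of ?e, THEN mp])
    then show ?thesis using k by auto
  qed
  let ?e = "\<lambda>j. \<Sum>i\<in>I. c i * of_rat (p i j)"
  define P where "P = (\<Sum>j<?d. monom (?e j) j)"
  have co: "coeff P j = (if j < ?d then ?e j else 0)" for j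
    by (auto simp: P_def coeff_sum if_distrib[of "\<lambda>f. coeff f j"] sum.delta coeff_monom)
  have "poly P (\<sigma> \<theta>) = 0" if "\<sigma> \<in> ?E" for \<sigma>
  proof -
    have "poly P (\<sigma> \<theta>) = (\<Sum>j<?d. ?e j * \<sigma> \<theta> ^ j)" by (simp add: P_def poly_sum poly_monom)
    also have "\<dots> = (\<Sum>i\<in>I. c i * (\<Sum>j<?d. of_rat (p i j) * \<sigma> \<theta> ^ j))"
      by (simp add: sum_distrib_left sum_distrib_right mult.assoc) (rule sum.swap)
    also have "\<dots> = (\<Sum>i\<in>I. c i * \<sigma> (b i))"
    proof -
      have "\<sigma> (b i) = (\<Sum>j<?d. of_rat (p i j) * \<sigma> \<theta> ^ j)" for i
        by (subst p) (simp add: embedding_simps[OF that])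
      then show ?thesis by simp
    qed
    finally show ?thesis using c[OF that] by simp
  qed
  then have sub: "(\<lambda>\<sigma>. \<sigma> \<theta>) ` ?E \<subseteq> {z. poly P z = 0}" by auto
  have "P = 0"
  proof (rule ccontr)
    assume P: "P \<noteq> 0"
    then have "coeff P (degree P) \<noteq> 0" by simp
    then have "degree P < ?d" by (auto simp: co split: if_splits)
    moreover have "?d \<le> card {z. poly P z = 0}"
      using card_mono[OF poly_roots_finite[OF P] sub] card_image[OF \<theta>(1)] \<theta>(2) by simp
    moreover have "card {z. poly P z = 0} \<le> degree P" using P by (rule card_poly_roots_bound)
    ultimately show False by simp
  qed
  then have e: "?e j = 0" if "j < ?d" for j using co[of j] that by simp
  have "c k = (\<Sum>i\<in>I. c i * of_rat (if i = k then 1 else 0))"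
    using k I(1) by (simp add: if_distrib[of of_rat] if_distrib[of "\<lambda>x. _ * x"] cong: if_cong)
  also have "\<dots> = (\<Sum>i\<in>I. c i * of_rat (\<Sum>j<?d. p i j * q j k))" using pq by (intro sum.cong) auto
  also have "\<dots> = (\<Sum>j<?d. ?e j * of_rat (q j k))"
    by (simp add: of_rat_sum of_rat_mult sum_distrib_left sum_distrib_right mult.assoc) (rule sum.swap)
  also have "\<dots> = 0" using e by simp
  finally show ?thesis .
qed

section \<open>Integral spans and algebraic integers\<close>

definition int_span :: "'i set \<Rightarrow> ('i \<Rightarrow> 'a::field_char_0) \<Rightarrow> 'a set" where
  "int_span I m = {(\<Sum>i\<in>I. of_int (c i) * m i) | c. True}"

lemma int_spanI: "(\<Sum>i\<in>I. of_int (c i) * m i) \<in> int_span I m"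
  by (auto simp: int_span_def)

lemma int_span_add: "x \<in> int_span I m \<Longrightarrow> y \<in> int_span I m \<Longrightarrow> x + y \<in> int_span I m"
proof -
  assume "x \<in> int_span I m" "y \<in> int_span I m"
  then obtain a b where "x = (\<Sum>i\<in>I. of_int (a i) * m i)" "y = (\<Sum>i\<in>I. of_int (b i) * m i)"
    by (auto simp: int_span_def)
  then have "x + y = (\<Sum>i\<in>I. of_int (a i + b i) * m i)" by (simp add: sum.distrib algebra_simps)
  then show ?thesis unfolding int_span_def by (intro CollectI exI[of _ "\<lambda>i. a i + b i"]) auto
qed

lemma int_span_scale: "x \<in> int_span I m \<Longrightarrow> of_int k * x \<in> int_span I m"
proof -
  assume "x \<in> int_span I m"
  then obtain a where "x = (\<Sum>i\<in>I. of_int (a i) * m i)" by (auto simp: int_span_def)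
  then have "of_int k * x = (\<Sum>i\<in>I. of_int (k * a i) * m i)" by (simp add: sum_distrib_left mult.assoc)
  then show ?thesis unfolding int_span_def by (intro CollectI exI[of _ "\<lambda>i. k * a i"]) auto
qed

lemma int_span_zero: "0 \<in> int_span I m"
  unfolding int_span_def by (intro CollectI exI[of _ "\<lambda>_. 0"]) auto

lemma int_span_sum: "(\<And>k. k \<in> A \<Longrightarrow> f k \<in> int_span I m) \<Longrightarrow> sum f A \<in> int_span I m"
  by (induction A rule: infinite_finite_induct) (auto intro: int_span_zero int_span_add)

lemma int_span_base: "finite I \<Longrightarrow> i \<in> I \<Longrightarrow> m i \<in> int_span I m"
  unfolding int_span_def
  by (intro CollectI exI[of _ "\<lambda>j. if j = i then 1 else 0"]) (simp add: if_distrib[of of_int] if_distrib[of "\<lambda>x. x * _"] cong: if_cong)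

lemma int_span_mult_stable:
  assumes "\<And>i. i \<in> I \<Longrightarrow> x * m i \<in> int_span I m" "y \<in> int_span I m"
  shows "x * y \<in> int_span I m"
proof -
  obtain a where y: "y = (\<Sum>i\<in>I. of_int (a i) * m i)" using assms(2) by (auto simp: int_span_def)
  have "x * y = (\<Sum>i\<in>I. of_int (a i) * (x * m i))" by (simp add: y sum_distrib_left mult_ac)
  also have "\<dots> \<in> int_span I m" by (intro int_span_sum int_span_scale assms(1))
  finally show ?thesis .
qed

text \<open>The Leibniz expansion of \<open>det (X - A)\<close> is a monic integer polynomial that vanishes at \<open>x\<close>.\<close>

lemma algebraic_int_if_stable:
  fixes m :: "'i \<Rightarrow> 'a::field_char_0"
  assumes "finite I" "i0 \<in> I" "m i0 \<noteq> 0" "\<And>i. i \<in> I \<Longrightarrow> x * m i \<in> int_span I m"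
  shows "algebraic_int x"
proof -
  define n where "n = card I"
  obtain h where h: "bij_betw h {0..<n} I" unfolding n_def using ex_bij_betw_nat_finite[OF assms(1)] by blast
  have "\<forall>i. \<exists>c. i \<in> I \<longrightarrow> x * m i = (\<Sum>j\<in>I. of_int (c j) * m j)"
    using assms(4) by (auto simp: int_span_def)
  then obtain C where C: "\<And>i. i \<in> I \<Longrightarrow> x * m i = (\<Sum>j\<in>I. of_int (C i j) * m j)" by metis
  define A :: "nat \<Rightarrow> nat \<Rightarrow> int" where "A i j = C (h i) (h j)" for i j
  have hI: "h i \<in> I" if "i < n" for i using h that by (auto simp: bij_betw_def)
  have A: "x * m (h i) = (\<Sum>j<n. of_int (A i j) * m (h j))" if "i < n" for i
    using C[OF hI[OF that]] sum.reindex_bij_betw[OF h, of "\<lambda>j. of_int (C (h i) j) * m j"]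
    by (simp add: A_def lessThan_atLeast0)
  obtain k0 where k0: "k0 < n" "h k0 = i0" using h assms(2) unfolding bij_betw_def by (metis atLeastLessThan_iff imageE)
  \<comment> \<open>\<open>x\<close> acts on the generators through the integer matrix
    \<open>A\<close>, so the nonzero vector of generators lies in the kernel of \<open>B\<close>,
    which is \<open>x\<close> times the identity minus \<open>A\<close>.\<close>
  define B :: "'a Matrix.mat" where "B = Matrix.mat n n (\<lambda>(i, j). (if i = j then x else 0) - of_int (A i j))"
  have Bc: "B \<in> carrier_mat n n" by (simp add: B_def)
  define v where "v = Matrix.vec n (\<lambda>j. m (h j))"
  have vc: "v \<in> carrier_vec n" by (simp add: v_def)
  have "v \<noteq> 0\<^sub>v n"
  proof
    assume "v = 0\<^sub>v n"
    then have "vec_index v k0 = vec_index (0\<^sub>v n) k0" by simp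
    then show False using k0 assms(3) by (simp add: v_def)
  qed
  moreover have "B *\<^sub>v v = 0\<^sub>v n"
  proof (rule eq_vecI)
    fix i assume "i < dim_vec (0\<^sub>v n :: 'a Matrix.vec)"
    then have i: "i < n" by simp
    have "vec_index (B *\<^sub>v v) i = (\<Sum>j<n. ((if i = j then x else 0) - of_int (A i j)) * m (h j))"
      using i by (simp add: B_def v_def scalar_prod_def lessThan_atLeast0)
    also have "\<dots> = (\<Sum>j<n. (if i = j then x * m (h j) else 0)) - (\<Sum>j<n. of_int (A i j) * m (h j))"
      by (simp add: left_diff_distrib sum_subtractf if_distrib[of "\<lambda>x. x * _"] cong: if_cong)
    also have "\<dots> = 0" using i A[OF i] by simp
    finally show "vec_index (B *\<^sub>v v) i = vec_index (0\<^sub>v n) i" using i by simp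
  qed (simp add: B_def)
  ultimately have "Determinant.det B = 0"
    using det_0_iff_vec_prod_zero_field[OF Bc] vc by blast
  then have det0: "(\<Sum>p | p permutes {0..<n}. signof p * (\<Prod>i=0..<n. (if i = p i then x else 0) - of_int (A i (p i)))) = 0"
  proof -
    assume "Determinant.det B = 0"
    moreover have "Determinant.det B = (\<Sum>p | p permutes {0..<n}. signof p * (\<Prod>i=0..<n. (if i = p i then x else 0) - of_int (A i (p i))))"
      unfolding det_def'[OF Bc]
      by (intro sum.cong refl arg_cong2[where f = "(*)"] prod.cong) (auto simp: B_def permutes_in_image)
    ultimately show ?thesis by simp
  qed
  define T :: "(nat \<Rightarrow> nat) \<Rightarrow> int poly" where
    "T p = Polynomial.smult (signof p) (\<Prod>i=0..<n. [: - A i (p i), if i = p i then 1 else 0 :])" for p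
  define Q where "Q = (\<Sum>p | p permutes {0..<n}. T p)"
  have fin: "finite {p. p permutes {0..<n}}" by (rule finite_permutations) simp
  have ev: "poly (map_poly of_int (T p)) x = signof p * (\<Prod>i=0..<n. (if i = p i then x else 0) - of_int (A i (p i)))" for p
  proof -
    have "poly (map_poly of_int (\<Prod>i\<in>S. [: - A i (p i), if i = p i then 1 else 0 :])) x =
        (\<Prod>i\<in>S. (if i = p i then x else 0) - of_int (A i (p i)))" for S
    proof (induction S rule: infinite_finite_induct)
      case (insert i S)
      have "map_poly of_int (a * b) = map_poly of_int a * (map_poly of_int b :: 'a poly)" for a b
        by (rule poly_eqI) (simp add: coeff_map_poly coeff_mult)
      then show ?case using insert by (simp add: map_poly_pCons del: mult_pCons_left)
    qed auto
    moreover have "map_poly of_int (Polynomial.smult (signof p) q) = Polynomial.smult (signof p) (map_poly of_int q :: 'a poly)" for q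
      by (rule poly_eqI) (simp add: coeff_map_poly)
    ultimately show ?thesis by (simp add: T_def)
  qed
  have "poly (map_poly of_int Q) x = (\<Sum>p | p permutes {0..<n}. poly (map_poly of_int (T p)) x)"
  proof -
    have "map_poly of_int (\<Sum>p\<in>S. T p) = (\<Sum>p\<in>S. map_poly of_int (T p) :: 'a poly)" for S
      by (rule poly_eqI) (simp add: coeff_map_poly coeff_sum)
    then show ?thesis by (simp add: Q_def poly_sum)
  qed
  then have Qx: "poly (map_poly of_int Q) x = 0" using det0 by (simp add: ev)
  \<comment> \<open>A moved index contributes a constant factor, so only the identity permutation
    reaches degree \<open>n\<close>; this makes the sum monic.\<close>
  have small: "degree (T p) < n" if p: "p permutes {0..<n}" "p \<noteq> id" for p
  proof -
    obtain i where i: "p i \<noteq> i" using p(2) by (metis eq_id_iff)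
    then have "i \<in> {0..<n}" using p(1) by (metis permutes_not_in)
    then have split: "{0..<n} = insert i ({0..<n} - {i})" by auto
    let ?f = "\<lambda>i. [: - A i (p i), if i = p i then 1 else 0 :]"
    have "degree (T p) \<le> degree (\<Prod>i=0..<n. ?f i)" unfolding T_def by (rule degree_smult_le)
    also have "\<dots> \<le> (\<Sum>i=0..<n. degree (?f i))" by (rule order_trans[OF degree_prod_sum_le]) (simp_all add: o_def)
    also have "\<dots> = degree (?f i) + (\<Sum>i\<in>{0..<n} - {i}. degree (?f i))" by (subst split) (rule sum.insert, auto)
    also have "\<dots> \<le> 0 + (\<Sum>i\<in>{0..<n} - {i}. 1)" using i by (intro add_mono sum_mono) auto
    also have "\<dots> < n" using \<open>i \<in> {0..<n}\<close> by (simp add: card_Diff_singleton)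
    finally show ?thesis .
  qed
  have idp: "degree (T id) = n" "lead_coeff (T id) = 1"
  proof -
    let ?f = "\<lambda>i. [: - A i i, 1 :]"
    have "T id = (\<Prod>i=0..<n. ?f i)" by (simp add: T_def sign_id)
    moreover have "degree (\<Prod>i=0..<n. ?f i) = (\<Sum>i=0..<n. degree (?f i))" by (rule degree_prod_eq_sum_degree) simp
    moreover have "lead_coeff (\<Prod>i=0..<n. ?f i) = (\<Prod>i=0..<n. lead_coeff (?f i))" by (rule lead_coeff_prod)
    ultimately show "degree (T id) = n" "lead_coeff (T id) = 1" by simp_all
  qed
  have "n > 0" using k0 by simp
  have Qs: "Q = T id + (\<Sum>p\<in>{p. p permutes {0..<n}} - {id}. T p)"
    unfolding Q_def using fin by (intro sum.remove) (auto simp: permutes_id)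
  have dr: "degree (\<Sum>p\<in>{p. p permutes {0..<n}} - {id}. T p) < degree (T id)"
    unfolding idp using small \<open>n > 0\<close> fin by (intro degree_sum_less) auto
  have "degree Q = n" unfolding Qs using degree_add_eq_left[OF dr] idp(1) by simp
  moreover have "coeff Q n = 1" using idp dr by (simp add: Qs coeff_eq_0)
  ultimately have "lead_coeff Q = 1" by simp
  then show ?thesis unfolding algebraic_int_altdef_ipoly using Qx by blast
qed

section \<open>Closure properties of algebraic integers\<close>

lemma algebraic_int_power_span:
  assumes "algebraic_int (x :: 'a::field_char_0)"
  obtains n where "n > 0" "\<And>k. x ^ k \<in> int_span {..<n} (\<lambda>i. x ^ i)"
proof -
  obtain p where p: "poly (map_poly of_int p) x = 0" "lead_coeff p = 1"
    using assms algebraic_int_altdef_ipoly by blast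
  define n where "n = degree p"
  have "n > 0"
  proof (rule ccontr)
    assume "\<not> n > 0"
    then obtain c where "p = [:c:]" by (auto simp: n_def elim: degree_eq_zeroE)
    then show False using p by (simp add: map_poly_pCons)
  qed
  let ?S = "int_span {..<n} (\<lambda>i. x ^ i)"
  have dm: "degree (map_poly of_int p :: 'a poly) = n" by (simp add: degree_map_poly n_def)
  have "0 = (\<Sum>i\<le>n. of_int (coeff p i) * x ^ i)"
    using p(1) by (simp add: poly_altdef dm coeff_map_poly)
  also have "{..n} = insert n {..<n}" by auto
  also have "(\<Sum>i\<in>insert n {..<n}. of_int (coeff p i) * x ^ i) = x ^ n + (\<Sum>i<n. of_int (coeff p i) * x ^ i)"
    using p(2) by (simp add: n_def)
  finally have "x ^ n = - (\<Sum>i<n. of_int (coeff p i) * x ^ i)" by (metis add_eq_0_iff2)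
  then have eq: "x ^ n = (\<Sum>i<n. of_int (- coeff p i) * x ^ i)" by (simp add: sum_negf)
  have xn: "x ^ n \<in> ?S" unfolding eq by (rule int_spanI)
  have step: "x * x ^ i \<in> ?S" if "i \<in> {..<n}" for i
  proof (cases "Suc i = n")
    case True then show ?thesis using xn by (metis power_Suc)
  next
    case False
    then show ?thesis using that int_span_base[of "{..<n}" "Suc i" "\<lambda>i. x ^ i"] by simp
  qed
  have "x ^ k \<in> ?S" for k
  proof (induction k)
    case 0 then show ?case using int_span_base[of "{..<n}" 0 "\<lambda>i. x ^ i"] \<open>n > 0\<close> by simp
  next
    case (Suc k) then show ?case using int_span_mult_stable[OF step] by simp
  qed
  then show ?thesis using that \<open>n > 0\<close> by blast
qed

text \<open>The products \<open>x ^ i * y ^ j\<close> with bounded exponents span a finitely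
  generated group that multiplication by \<open>x\<close> and by \<open>y\<close> maps into itself,
  hence so do \<open>x + y\<close> and \<open>x * y\<close>.\<close>

lemma algebraic_int_add_mult:
  assumes "algebraic_int (x :: 'a::field_char_0)" "algebraic_int y"
  shows "algebraic_int (x + y)" "algebraic_int (x * y)"
proof -
  obtain n where n: "n > 0" "\<And>k. x ^ k \<in> int_span {..<n} (\<lambda>i. x ^ i)" using algebraic_int_power_span[OF assms(1)] by metis
  obtain l where l: "l > 0" "\<And>k. y ^ k \<in> int_span {..<l} (\<lambda>i. y ^ i)" using algebraic_int_power_span[OF assms(2)] by metis
  let ?I = "{..<n} \<times> {..<l}" and ?m = "\<lambda>(i, j). x ^ i * y ^ j"
  let ?S = "int_span ?I ?m"
  have mono: "x ^ i * y ^ j \<in> ?S" for i j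
  proof -
    obtain a b where ab: "x ^ i = (\<Sum>i<n. of_int (a i) * x ^ i)" "y ^ j = (\<Sum>j<l. of_int (b j) * y ^ j)"
      using n(2)[of i] l(2)[of j] by (auto simp: int_span_def)
    have "x ^ i * y ^ j = (\<Sum>i<n. \<Sum>j<l. of_int (a i * b j) * (x ^ i * y ^ j))"
      unfolding ab by (simp add: sum_product mult_ac)
    also have "\<dots> = (\<Sum>p\<in>?I. of_int (a (fst p) * b (snd p)) * ?m p)"
      by (simp add: sum.cartesian_product case_prod_beta)
    finally show ?thesis unfolding int_span_def by (intro CollectI exI[of _ "\<lambda>p. a (fst p) * b (snd p)"]) simp
  qed
  have sx: "x * ?m p \<in> ?S" and sy: "y * ?m p \<in> ?S" for p
    using mono[of "Suc (fst p)" "snd p"] mono[of "fst p" "Suc (snd p)"] by (simp_all add: case_prod_beta mult_ac)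
  have z: "(0, 0) \<in> ?I" "?m (0, 0) \<noteq> 0" using n l by auto
  have "(x + y) * ?m p \<in> ?S" for p unfolding distrib_right by (rule int_span_add[OF sx sy])
  then show "algebraic_int (x + y)" by (intro algebraic_int_if_stable[where I = ?I and m = ?m, OF _ z]) simp_all
  have "x * y * ?m p \<in> ?S" for p
    unfolding mult.assoc by (rule int_span_mult_stable[OF sx sy])
  then show "algebraic_int (x * y)" by (intro algebraic_int_if_stable[where I = ?I and m = ?m, OF _ z]) simp_all
qed

lemma algebraic_int_sum: "(\<And>i. i \<in> A \<Longrightarrow> algebraic_int (f i :: 'a::field_char_0)) \<Longrightarrow> algebraic_int (sum f A)"
  by (induction A rule: infinite_finite_induct) (auto intro: algebraic_int_add_mult)

lemma algebraic_int_prod: "(\<And>i. i \<in> A \<Longrightarrow> algebraic_int (f i :: 'a::field_char_0)) \<Longrightarrow> algebraic_int (prod f A)"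
  by (induction A rule: infinite_finite_induct) (auto intro: algebraic_int_add_mult)

text \<open>If the equation of \<open>x\<close> has degree \<open>n\<close> and leading coefficient
  \<open>a\<close>, its product with \<open>a ^ (n - 1)\<close> is a monic equation for
  \<open>a * x\<close>.\<close>

lemma exists_algebraic_int_multiple:
  assumes "algebraic (x :: 'a::field_char_0)"
  obtains N where "N \<noteq> 0" "algebraic_int (of_int N * x)"
proof -
  obtain p where p: "p \<noteq> 0" "poly (map_poly of_int p) x = 0" using algebraicE'[OF assms] by metis
  define n where "n = degree p"
  define a where "a = lead_coeff p"
  have a0: "a \<noteq> 0" using p(1) by (simp add: a_def)
  have "n > 0"
  proof (rule ccontr)
    assume "\<not> n > 0"
    then obtain c where "p = [:c:]" by (auto simp: n_def elim: degree_eq_zeroE)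
    then show False using p by (simp add: map_poly_pCons)
  qed
  let ?z = "of_int a * x"
  let ?S = "int_span {..<n} (\<lambda>i. ?z ^ i)"
  have dm: "degree (map_poly of_int p :: 'a poly) = n" by (simp add: degree_map_poly n_def)
  have "0 = of_int a ^ (n - 1) * (\<Sum>i\<le>n. of_int (coeff p i) * x ^ i)"
    using p(2) by (simp add: poly_altdef dm coeff_map_poly)
  also have "\<dots> = of_int a ^ (n - 1) * (of_int a * x ^ n + (\<Sum>i<n. of_int (coeff p i) * x ^ i))"
  proof -
    have "{..n} = insert n {..<n}" by auto
    then have "(\<Sum>i\<le>n. of_int (coeff p i) * x ^ i) = of_int (coeff p n) * x ^ n + (\<Sum>i<n. of_int (coeff p i) * x ^ i)"
      by (simp only: sum.insert finite_lessThan lessThan_iff less_irrefl not_False_eq_True)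
    then show ?thesis by (simp only: a_def n_def)
  qed
  also have "\<dots> = ?z ^ n + (\<Sum>i<n. of_int (coeff p i * a ^ (n - 1 - i)) * ?z ^ i)"
  proof -
    have "of_int a ^ (n - 1) * (of_int a * x ^ n) = ?z ^ n"
      using \<open>n > 0\<close> by (cases n) (simp_all add: power_mult_distrib)
    moreover have "of_int a ^ (n - 1) * (of_int (coeff p i) * x ^ i) = of_int (coeff p i * a ^ (n - 1 - i)) * ?z ^ i" if "i < n" for i
    proof -
      have "(of_int a :: 'a) ^ (n - 1) = of_int a ^ (n - 1 - i) * of_int a ^ i"
        unfolding power_add[symmetric] using that by simp
      then show ?thesis by (simp only: of_int_mult of_int_power power_mult_distrib mult_ac)
    qed
    ultimately show ?thesis unfolding distrib_left sum_distrib_left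
      by (intro arg_cong2[where f = "(+)"] sum.cong) simp_all
  qed
  finally have "?z ^ n = - (\<Sum>i<n. of_int (coeff p i * a ^ (n - 1 - i)) * ?z ^ i)" by (metis add_eq_0_iff2)
  then have eq: "?z ^ n = (\<Sum>i<n. of_int (- (coeff p i * a ^ (n - 1 - i))) * ?z ^ i)" by (simp add: sum_negf)
  have zn: "?z ^ n \<in> ?S" unfolding eq by (rule int_spanI)
  have "algebraic_int ?z"
  proof (rule algebraic_int_if_stable[of "{..<n}" 0 "\<lambda>i. ?z ^ i"])
    fix i assume i: "i \<in> {..<n}"
    show "?z * ?z ^ i \<in> ?S"
    proof (cases "Suc i = n")
      case True then show ?thesis using zn by (metis power_Suc)
    next
      case False
      then show ?thesis using i int_span_base[of "{..<n}" "Suc i" "\<lambda>i. ?z ^ i"] by simp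
    qed
  qed (use \<open>n > 0\<close> in auto)
  then show ?thesis using that a0 by blast
qed

lemma algebraic_int_embedding:
  assumes "\<sigma> \<in> embeddings UNIV" "algebraic_int x"
  shows "algebraic_int (\<sigma> x)"
proof -
  obtain p where p: "poly (map_poly of_int p) x = 0" "lead_coeff p = 1"
    using assms(2) algebraic_int_altdef_ipoly by blast
  have "poly (map_poly of_int p) (\<sigma> x) = \<sigma> (poly (map_poly of_int p) x)"
    by (simp add: poly_altdef degree_map_poly coeff_map_poly embedding_simps[OF assms(1)])
  then show ?thesis using p algebraic_int_altdef_ipoly embedding_simps(1)[OF assms(1)] by metis
qed

section \<open>The conjugate matrix\<close>

text \<open>An index type with as many elements as the degree of the field (one for other fields, since
  types are nonempty).\<close>

typedef (overloaded) ('a::field_char_0) deg_index = "{..<max 1 (field_degree TYPE('a))}"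
  by (rule exI[of _ 0]) simp

text \<open>\<open>minkowski\<close> is stated over a finite well-ordered index type; the order is
  that of the representing natural numbers.\<close>

instantiation deg_index :: (field_char_0) wellorder
begin

definition less_eq_deg_index :: "'a deg_index \<Rightarrow> 'a deg_index \<Rightarrow> bool" where
  "less_eq_deg_index i j \<longleftrightarrow> Rep_deg_index i \<le> Rep_deg_index j"

definition less_deg_index :: "'a deg_index \<Rightarrow> 'a deg_index \<Rightarrow> bool" where
  "less_deg_index i j \<longleftrightarrow> Rep_deg_index i < Rep_deg_index j"

instance
proof
  fix P :: "'a deg_index \<Rightarrow> bool" and i
  assume *: "\<And>i. (\<And>j. j < i \<Longrightarrow> P j) \<Longrightarrow> P i"
  show "P i"
  proof (induction "Rep_deg_index i" arbitrary: i rule: less_induct)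
    case less
    show ?case by (rule *) (use less in \<open>simp add: less_deg_index_def\<close>)
  qed
qed (auto simp: less_eq_deg_index_def less_deg_index_def Rep_deg_index_inject)

end

instance deg_index :: (field_char_0) finite
proof
  have "(UNIV :: 'a deg_index set) = Abs_deg_index ` {..<max 1 (field_degree TYPE('a))}"
    using type_definition.Abs_image[OF type_definition_deg_index] by auto
  then show "finite (UNIV :: 'a deg_index set)" by (metis finite_imageI finite_lessThan)
qed

lemma bij_Rep_deg_index:
  assumes "number_field TYPE('a::field_char_0)"
  shows "bij_betw (Rep_deg_index :: 'a deg_index \<Rightarrow> nat) UNIV {..<field_degree TYPE('a)}"
proof -
  have "max 1 (field_degree TYPE('a)) = field_degree TYPE('a)" using field_degree_pos[OF assms] by simp
  then show ?thesis
    using type_definition.Rep_range[OF type_definition_deg_index]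
    by (auto simp: bij_betw_def inj_def Rep_deg_index_inject)
qed

lemma card_deg_index:
  assumes "number_field TYPE('a::field_char_0)"
  shows "CARD('a deg_index) = field_degree TYPE('a)"
  using bij_betw_same_card[OF bij_Rep_deg_index[OF assms]] by simp

lemma rat_indep_reindex:
  assumes "bij_betw h I J" shows "rat_indep I (\<lambda>i. b (h i)) \<longleftrightarrow> rat_indep J b"
proof
  assume L: "rat_indep I (\<lambda>i. b (h i))"
  show "rat_indep J b" unfolding rat_indep_def
  proof (intro allI impI)
    fix c :: "_ \<Rightarrow> rat" assume "(\<Sum>i\<in>J. of_rat (c i) * b i) = 0"
    then have "(\<Sum>i\<in>I. of_rat (c (h i)) * b (h i)) = 0"
      by (simp only: sum.reindex_bij_betw[OF assms, of "\<lambda>i. of_rat (c i) * b i"])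
    then have *: "\<forall>i\<in>I. c (h i) = 0" by (rule L[unfolded rat_indep_def, THEN spec, of "\<lambda>i. c (h i)", THEN mp])
    show "\<forall>i\<in>J. c i = 0"
    proof
      fix j assume "j \<in> J"
      then obtain i where "i \<in> I" "j = h i" using assms unfolding bij_betw_def by blast
      then show "c j = 0" using * by simp
    qed
  qed
next
  assume R: "rat_indep J b"
  let ?g = "the_inv_into I h"
  have gh: "?g (h i) = i" if "i \<in> I" for i using assms that by (simp add: bij_betw_def the_inv_into_f_f)
  show "rat_indep I (\<lambda>i. b (h i))" unfolding rat_indep_def
  proof (intro allI impI)
    fix c :: "_ \<Rightarrow> rat" assume "(\<Sum>i\<in>I. of_rat (c i) * b (h i)) = 0"
    then have "(\<Sum>i\<in>I. of_rat (c (?g (h i))) * b (h i)) = 0" by (simp add: gh)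
    then have "(\<Sum>i\<in>J. of_rat (c (?g i)) * b i) = 0"
      by (simp only: sum.reindex_bij_betw[OF assms, of "\<lambda>i. of_rat (c (?g i)) * b i"])
    then have *: "\<forall>i\<in>J. c (?g i) = 0" by (rule R[unfolded rat_indep_def, THEN spec, of "\<lambda>i. c (?g i)", THEN mp])
    show "\<forall>i\<in>I. c i = 0"
    proof
      fix i assume i: "i \<in> I"
      then have "h i \<in> J" using assms by (auto simp: bij_betw_def)
      then have "c (?g (h i)) = 0" by (rule bspec[OF *])
      then show "c i = 0" by (simp only: gh[OF i])
    qed
  qed
qed

text \<open>The discriminant is defined through number-indexed matrices, whereas the arguments about
  conjugates use matrices indexed by \<open>deg_index\<close>. The two Leibniz sums agree under
  transport of permutations along \<open>Rep_deg_index\<close>, which preserves signs.\<close>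

lemma jnf_det_eq_det:
  fixes f :: "nat \<Rightarrow> nat \<Rightarrow> complex"
  assumes nf: "number_field TYPE('a::field_char_0)"
  defines "d \<equiv> field_degree TYPE('a)"
  shows "Determinant.det (Matrix.mat d d (\<lambda>(i, j). f i j)) =
    det (\<chi> i j. f (Rep_deg_index (i :: 'a deg_index)) (Rep_deg_index (j :: 'a deg_index)))"
proof -
  let ?R = "Rep_deg_index :: 'a deg_index \<Rightarrow> nat"
  have b: "bij_betw ?R UNIV {0..<d}" using bij_Rep_deg_index[OF nf] by (simp add: d_def lessThan_atLeast0)
  have inj: "inj_on ?R UNIV" using b by (simp add: bij_betw_def)
  let ?m = "map_permutation UNIV ?R"
  have bm: "bij_betw ?m {p. p permutes UNIV} {p. p permutes {0..<d}}"
  proof (rule bij_betw_byWitness[where f' = "map_permutation {0..<d} (inv_into UNIV ?R)"])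
    show "\<forall>p\<in>{p. p permutes UNIV}. map_permutation {0..<d} (inv_into UNIV ?R) (?m p) = p"
      using map_permutation_compose_inv[OF b] inj by (auto intro!: map_permutation_compose_inv[OF b] inv_into_f_f)
    show "\<forall>p\<in>{p. p permutes {0..<d}}. ?m (map_permutation {0..<d} (inv_into UNIV ?R) p) = p"
      using b by (auto intro!: map_permutation_compose_inv[OF bij_betw_inv_into[OF b]] simp: bij_betw_inv_into_right[OF b])
    show "?m ` {p. p permutes UNIV} \<subseteq> {p. p permutes {0..<d}}"
      using map_permutation_permutes[OF b] by auto
    show "map_permutation {0..<d} (inv_into UNIV ?R) ` {p. p permutes {0..<d}} \<subseteq> {p. p permutes UNIV}"
      using map_permutation_permutes[OF bij_betw_inv_into[OF b]] by auto
  qed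
  have "Determinant.det (Matrix.mat d d (\<lambda>(i, j). f i j)) =
      (\<Sum>p | p permutes {0..<d}. of_int (sign p) * (\<Prod>i=0..<d. f i (p i)))"
    by (subst det_def'[of _ d]) (auto intro!: sum.cong prod.cong simp: permutes_in_image)
  also have "\<dots> = (\<Sum>p | p permutes (UNIV :: 'a deg_index set). of_int (sign (?m p)) * (\<Prod>i=0..<d. f i (?m p i)))"
    by (rule sum.reindex_bij_betw[OF bm, symmetric])
  also have "\<dots> = (\<Sum>p | p permutes (UNIV :: 'a deg_index set). of_int (sign p) * (\<Prod>i\<in>UNIV. f (?R i) (?R (p i))))"
  proof (rule sum.cong)
    fix p assume "p \<in> {p. p permutes (UNIV :: 'a deg_index set)}"
    then have p: "p permutes (UNIV :: 'a deg_index set)" by simp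
    have "(\<Prod>i=0..<d. f i (?m p i)) = (\<Prod>i\<in>UNIV. f (?R i) (?m p (?R i)))"
      by (rule prod.reindex_bij_betw[OF b, symmetric])
    also have "\<dots> = (\<Prod>i\<in>UNIV. f (?R i) (?R (p i)))" using inj by (simp add: map_permutation_apply)
    finally show "of_int (sign (?m p)) * (\<Prod>i=0..<d. f i (?m p i)) = of_int (sign p) * (\<Prod>i\<in>UNIV. f (?R i) (?R (p i)))"
      using sign_map_permutation[OF inj p] by simp
  qed simp
  also have "\<dots> = det (\<chi> i j. f (?R i) (?R j))" by (simp add: det_def)
  finally show ?thesis .
qed

section \<open>Conjugates, traces and norms\<close>

lemma det_in_Rats: "(\<And>i j. A $ i $ j \<in> \<rat>) \<Longrightarrow> det (A :: complex^'n^'n) \<in> \<rat>"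
  unfolding det_def by (intro Rats_sum Rats_mult Rats_prod) auto

lemma det_in_Ints: "(\<And>i j. A $ i $ j \<in> \<int>) \<Longrightarrow> det (A :: complex^'n^'n) \<in> \<int>"
  unfolding det_def by (intro Ints_sum Ints_mult Ints_prod) auto

lemma algebraic_int_det: "(\<And>i j. algebraic_int (A $ i $ j)) \<Longrightarrow> algebraic_int (det (A :: complex^'n^'n))"
  unfolding det_def by (intro algebraic_int_sum algebraic_int_add_mult algebraic_int_prod) auto

lemma cart_vec_eqI: "(\<And>i. x $ i = y $ i) \<Longrightarrow> x = (y :: complex^'n)"
  by (simp add: vec_eq_iff)

lemma cart_mat_eqI: "(\<And>i j. x $ i $ j = y $ i $ j) \<Longrightarrow> x = (y :: complex^'n^'m)"
  by (simp add: vec_eq_iff)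

lemma det_nz_iff_ker: "det (A :: complex^'n^'n) \<noteq> 0 \<longleftrightarrow> (\<forall>x. A *v x = 0 \<longrightarrow> x = 0)"
  by (simp only: invertible_det_nz[symmetric] invertible_left_inverse matrix_left_invertible_ker)

text \<open>An enumeration by a type with as many elements as the degree makes the conjugate matrix
  square. Keeping the enumeration a parameter allows two of them to be compared, as the independence
  of the discriminant from the ordering demands.\<close>

locale embedding_enum =
  fixes e :: "'a::field_char_0 deg_index \<Rightarrow> 'a \<Rightarrow> complex"
  assumes nf: "number_field TYPE('a)" and e_bij: "bij_betw e UNIV (embeddings UNIV)"
begin

definition M :: "('a deg_index \<Rightarrow> 'a) \<Rightarrow> complex^'a deg_index^'a deg_index" where
  "M b = (\<chi> i j. e i (b j))"

lemma e_emb: "e i \<in> embeddings UNIV"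
  using e_bij by (auto simp: bij_betw_def)

lemmas e_simps = embedding_simps[OF e_emb]

lemma e_surj: "\<sigma> \<in> embeddings UNIV \<Longrightarrow> \<exists>i. \<sigma> = e i"
  using e_bij by (auto simp: bij_betw_def)

lemma rat_indep_span:
  fixes b :: "'a deg_index \<Rightarrow> 'a"
  shows "rat_indep UNIV b \<Longrightarrow> rat_span UNIV b"
  using rat_indep_card_eq_iff[OF nf finite_class.finite_UNIV, of b] card_deg_index[OF nf] by simp

text \<open>A rational relation between the \<open>b j\<close> is a kernel vector of
  \<open>M b\<close>; conversely, \<open>embedding_columns_independent\<close> excludes even complex
  kernel vectors.\<close>

lemma det_M_nz_iff: "det (M b) \<noteq> 0 \<longleftrightarrow> rat_indep UNIV b"
proof
  assume "det (M b) \<noteq> 0"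
  then have ker: "\<forall>x. M b *v x = 0 \<longrightarrow> x = 0"
    by (simp only: det_nz_iff_ker)
  show "rat_indep UNIV b" unfolding rat_indep_def
  proof (intro allI impI ballI)
    fix c :: "'a deg_index \<Rightarrow> rat" and j assume c: "(\<Sum>i\<in>UNIV. of_rat (c i) * b i) = 0"
    have "M b *v (\<chi> j. of_rat (c j)) = 0"
    proof (rule cart_vec_eqI)
      fix i
      have "(M b *v (\<chi> j. of_rat (c j))) $ i = e i (\<Sum>j\<in>UNIV. of_rat (c j) * b j)"
        by (simp add: M_def matrix_vector_mult_def e_simps mult.commute)
      then show "(M b *v (\<chi> j. of_rat (c j))) $ i = (0 :: complex^'a deg_index) $ i" by (simp add: c e_simps)
    qed
    then have z: "(\<chi> j. of_rat (c j)) = (0 :: complex^'a deg_index)" by (rule ker[THEN spec, THEN mp])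
    then show "c j = 0" by (simp add: vec_eq_iff)
  qed
next
  assume b: "rat_indep UNIV b"
  have "x = 0" if x: "M b *v x = 0" for x
  proof (rule cart_vec_eqI)
    fix k
    have "x $ k = 0"
    proof (rule embedding_columns_independent[OF nf finite_class.finite_UNIV b rat_indep_span[OF b], of "\<lambda>j. x $ j"])
      fix \<sigma> :: "'a \<Rightarrow> complex" assume "\<sigma> \<in> embeddings UNIV"
      then obtain i where i: "\<sigma> = e i" using e_surj by blast
      have "(M b *v x) $ i = 0" using x by simp
      then show "(\<Sum>j\<in>UNIV. x $ j * \<sigma> (b j)) = 0" by (simp add: M_def matrix_vector_mult_def i mult.commute)
    qed simp
    then show "x $ k = 0 $ k" by simp
  qed
  then show "det (M b) \<noteq> 0"
    by (simp only: det_nz_iff_ker) blast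
qed

lemma rat_basis_deg_index:
  obtains b :: "'a deg_index \<Rightarrow> 'a" where "rat_indep UNIV b"
proof -
  obtain b :: "nat \<Rightarrow> 'a" where "rat_indep {..<field_degree TYPE('a)} b"
    by (rule rat_basis_exists[OF nf])
  then have "rat_indep UNIV (\<lambda>i :: 'a deg_index. b (Rep_deg_index i))"
    using rat_indep_reindex[OF bij_Rep_deg_index[OF nf]] by blast
  then show ?thesis by (rule that)
qed

text \<open>Multiplication by \<open>x\<close> has a rational matrix in a rational basis, and conjugating this matrix by
  \<open>M b\<close> gives the diagonal matrix of the conjugates of \<open>x\<close>.\<close>

lemma trace_norm_rational: "(\<Sum>i\<in>UNIV. e i x) \<in> \<rat>" "(\<Prod>i\<in>UNIV. e i x) \<in> \<rat>"
proof -
  obtain b :: "'a deg_index \<Rightarrow> 'a" where b: "rat_indep UNIV b" by (rule rat_basis_deg_index)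
  have "\<exists>c::'a deg_index \<Rightarrow> rat. x * b j = (\<Sum>k\<in>UNIV. of_rat (c k) * b k)" for j
    using rat_indep_span[OF b] unfolding rat_span_def by blast
  then obtain A :: "'a deg_index \<Rightarrow> 'a deg_index \<Rightarrow> rat" where
    A: "\<And>j. x * b j = (\<Sum>k\<in>UNIV. of_rat (A j k) * b k)" by metis
  define D :: "complex^'a deg_index^'a deg_index" where "D = (\<chi> i j. if i = j then e i x else 0)"
  define R :: "complex^'a deg_index^'a deg_index" where "R = (\<chi> k j. of_rat (A j k))"
  have DM: "D ** M b = M b ** R"
  proof (rule cart_mat_eqI)
    fix i j
    have "(D ** M b) $ i $ j = e i (x * b j)"
      by (simp add: D_def M_def matrix_matrix_mult_def if_distrib[of "\<lambda>x. x * _"] e_simps cong: if_cong)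
    also have "\<dots> = (M b ** R) $ i $ j"
      by (subst A) (simp add: M_def R_def matrix_matrix_mult_def e_simps mult.commute)
    finally show "(D ** M b) $ i $ j = (M b ** R) $ i $ j" .
  qed
  have dM: "det (M b) \<noteq> 0" using b det_M_nz_iff by blast
  have "det D * det (M b) = det (M b) * det R" using DM by (metis det_mul)
  then have "det D = det R" using dM by simp
  moreover have "det D = (\<Prod>i\<in>UNIV. e i x)" by (subst det_diagonal) (auto simp: D_def)
  moreover have "det R \<in> \<rat>" by (rule det_in_Rats) (simp add: R_def)
  ultimately show "(\<Prod>i\<in>UNIV. e i x) \<in> \<rat>" by simp
  obtain N where N: "M b ** N = mat 1" "N ** M b = mat 1"
    using dM invertible_det_nz[of "M b"] unfolding invertible_def by blast
  have "trace D = trace (D ** (M b ** N))" by (simp add: N)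
  also have "\<dots> = trace (M b ** R ** N)" by (simp add: matrix_mul_assoc DM)
  also have "\<dots> = trace (N ** (M b ** R))" by (rule trace_mul_sym)
  also have "\<dots> = trace R" by (simp add: matrix_mul_assoc N)
  finally have "trace D = trace R" .
  moreover have "trace D = (\<Sum>i\<in>UNIV. e i x)" by (simp add: trace_def D_def)
  moreover have "trace R \<in> \<rat>" unfolding trace_def R_def by (intro Rats_sum) simp
  ultimately show "(\<Sum>i\<in>UNIV. e i x) \<in> \<rat>" by simp
qed

text \<open>The norm is rational and an algebraic integer, so it is an ordinary integer, and it is
  nonzero.\<close>

lemma norm_prod_ge_1:
  assumes "algebraic_int x" "x \<noteq> 0"
  shows "(\<Prod>i\<in>UNIV. cmod (e i x)) \<ge> 1"
proof -
  have "algebraic_int (\<Prod>i\<in>UNIV. e i x)"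
    by (intro algebraic_int_prod algebraic_int_embedding[OF e_emb] assms)
  then have "(\<Prod>i\<in>UNIV. e i x) \<in> \<int>" by (rule rational_algebraic_int_is_int) (rule trace_norm_rational)
  then obtain k where k: "(\<Prod>i\<in>UNIV. e i x) = of_int k" by (auto simp: Ints_def)
  have "(\<Prod>i\<in>UNIV. e i x) \<noteq> 0" using assms(2) by (simp add: e_simps)
  then have "k \<noteq> 0" using k by auto
  then have "cmod (of_int k) \<ge> 1" by simp
  then show ?thesis unfolding k[symmetric] by (simp add: prod_norm)
qed

text \<open>The right-hand side is the Gram determinant of the trace form. It no longer mentions the
  enumeration, so the square is the same for every ordering of the embeddings.\<close>

lemma det_M_square: "(det (M b))\<^sup>2 = det (\<chi> j k. \<Sum>\<sigma>\<in>embeddings UNIV. \<sigma> (b j * b k))"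
proof -
  have "transpose (M b) ** M b = (\<chi> j k. \<Sum>\<sigma>\<in>embeddings UNIV. \<sigma> (b j * b k))"
  proof (rule cart_mat_eqI)
    fix j k
    have "(transpose (M b) ** M b) $ j $ k = (\<Sum>i\<in>UNIV. e i (b j * b k))"
      by (simp add: M_def transpose_def matrix_matrix_mult_def e_simps)
    then show "(transpose (M b) ** M b) $ j $ k = (\<chi> j k. \<Sum>\<sigma>\<in>embeddings UNIV. \<sigma> (b j * b k)) $ j $ k"
      using sum.reindex_bij_betw[OF e_bij, of "\<lambda>\<sigma>. \<sigma> (b j * b k)"] by simp
  qed
  then show ?thesis by (metis det_mul det_transpose power2_eq_square)
qed

lemma det_M_square_rational: "(det (M b))\<^sup>2 \<in> \<rat>"
proof -
  have "(\<Sum>\<sigma>\<in>embeddings UNIV. \<sigma> x) \<in> \<rat>" for x :: 'a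
    using sum.reindex_bij_betw[OF e_bij, of "\<lambda>\<sigma>. \<sigma> x"] trace_norm_rational(1)[of x] by simp
  then show ?thesis unfolding det_M_square by (intro det_in_Rats) simp
qed

lemma det_M_square_int:
  assumes "\<And>j. algebraic_int (b j)"
  shows "(det (M b))\<^sup>2 \<in> \<int>"
proof (rule rational_algebraic_int_is_int[OF _ det_M_square_rational])
  have "algebraic_int (det (M b))"
    by (rule algebraic_int_det) (simp add: M_def algebraic_int_embedding[OF e_emb assms])
  then show "algebraic_int ((det (M b))\<^sup>2)" unfolding power2_eq_square by (intro algebraic_int_add_mult)
qed

lemma M_change_of_basis:
  assumes "\<And>j. b' j = (\<Sum>k\<in>UNIV. of_rat (C j k) * b k)"
  shows "M b' = M b ** (\<chi> k j. of_rat (C j k))"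
  by (rule cart_mat_eqI) (subst (1) M_def, simp add: assms matrix_matrix_mult_def e_simps M_def mult.commute)

end

section \<open>Integral bases and the discriminant\<close>

lemma rat_int_decomposition: "\<exists>k::int. \<exists>f. q = of_int k + f \<and> 0 \<le> f \<and> f < (1::rat)"
  by (rule exI[of _ "\<lfloor>q\<rfloor>"], rule exI[of _ "frac q"]) (simp add: frac_def frac_lt_1[unfolded frac_def])

lemma of_real_of_rat_complex: "of_real (of_rat q) = (of_rat q :: complex)"
  by (cases q rule: Rat_cases) (simp add: of_rat_rat)

lemma common_denominator:
  fixes c :: "'i \<Rightarrow> rat"
  assumes "finite I"
  shows "\<exists>N z. N \<noteq> (0::int) \<and> (\<forall>i\<in>I. of_int N * c i = of_int (z i))"
  using assms
proof (induction I rule: finite_induct)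
  case empty
  then show ?case by (intro exI[of _ 1]) auto
next
  case (insert i I)
  then obtain N z where N: "N \<noteq> 0" "\<forall>i\<in>I. of_int N * c i = of_int (z i)" by (elim exE conjE)
  obtain a b where ab: "c i = of_int a / of_int b" "b > 0"
    using quotient_of_div[of "c i"] quotient_of_denom_pos[of "c i"] by (metis prod.collapse)
  show ?case
  proof (intro exI conjI ballI)
    show "N * b \<noteq> 0" using N ab by simp
    fix j assume j: "j \<in> insert i I"
    show "of_int (N * b) * c j = of_int ((\<lambda>j. if j = i then N * a else b * z j) j)"
    proof (cases "j = i")
      case True then show ?thesis using ab by simp
    next
      case False
      then have "of_int N * c j = of_int (z j)" using N(2) j by simp
      then show ?thesis using False by (simp add: mult_ac)
    qed
  qed
qed

context embedding_enum
begin

definition int_basis :: "('a deg_index \<Rightarrow> 'a) \<Rightarrow> bool" where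
  "int_basis b \<longleftrightarrow> (\<forall>j. algebraic_int (b j)) \<and> rat_indep UNIV b \<and> (\<forall>x. algebraic_int x \<longrightarrow> x \<in> int_span UNIV b)"

lemma exists_integral_rat_basis: "\<exists>b. (\<forall>j. algebraic_int (b j)) \<and> rat_indep UNIV (b :: 'a deg_index \<Rightarrow> 'a)"
proof -
  obtain b :: "'a deg_index \<Rightarrow> 'a" where b: "rat_indep UNIV b" by (rule rat_basis_deg_index)
  have "\<exists>N. N \<noteq> (0::int) \<and> algebraic_int (of_int N * b j)" for j
  proof -
    obtain N where "N \<noteq> 0" "algebraic_int (of_int N * b j)"
      by (rule exists_algebraic_int_multiple[OF number_field_algebraic[OF nf, of "b j"]])
    then show ?thesis by (intro exI conjI)
  qed
  then have "\<forall>j. \<exists>N. N \<noteq> (0::int) \<and> algebraic_int (of_int N * b j)" by (rule allI)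
  from choice[OF this] obtain N :: "'a deg_index \<Rightarrow> int"
    where "\<forall>j. N j \<noteq> 0 \<and> algebraic_int (of_int (N j) * b j)" by (elim exE)
  then have N: "\<And>j. N j \<noteq> 0" "\<And>j. algebraic_int (of_int (N j) * b j)" by simp_all
  have "rat_indep UNIV (\<lambda>j. of_int (N j) * b j)"
    unfolding rat_indep_def
  proof (intro allI impI)
    fix c :: "'a deg_index \<Rightarrow> rat" assume "(\<Sum>i\<in>UNIV. of_rat (c i) * (of_int (N i) * b i)) = 0"
    then have "(\<Sum>i\<in>UNIV. of_rat (c i * of_int (N i)) * b i) = 0" by (simp add: of_rat_mult mult.assoc)
    then have "\<forall>i\<in>UNIV. c i * of_int (N i) = 0"
      by (rule b[unfolded rat_indep_def, THEN spec, of "\<lambda>i. c i * of_int (N i)", THEN mp])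
    then show "\<forall>i\<in>UNIV. c i = 0" using N(1) by simp
  qed
  then show ?thesis using N(2) by (intro exI conjI allI)
qed

text \<open>An integral rational basis of minimal discriminant is an integral basis: otherwise reduce a
  non-integral coordinate modulo \<open>1\<close>.\<close>

theorem exists_int_basis: "\<exists>b. int_basis b"
proof -
  let ?P = "\<lambda>b. (\<forall>j. algebraic_int (b j)) \<and> rat_indep UNIV (b :: 'a deg_index \<Rightarrow> 'a)"
  \<comment> \<open>For a rational basis of algebraic integers the squared determinant is an
    ordinary integer, so a basis with the smallest absolute value exists.\<close>
  have "\<exists>k::nat. cmod ((det (M b))\<^sup>2) = real k" if "?P b" for b
  proof -
    have "(det (M b))\<^sup>2 \<in> \<int>" by (rule det_M_square_int) (use that in blast)
    then obtain k where "(det (M b))\<^sup>2 = of_int k" by (auto simp: Ints_def)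
    then have "cmod ((det (M b))\<^sup>2) = real (nat \<bar>k\<bar>)" by simp
    then show ?thesis by blast
  qed
  then obtain D where D: "\<And>b. ?P b \<Longrightarrow> cmod ((det (M b))\<^sup>2) = real (D b)" by metis
  obtain b0 where b0: "?P b0" using exists_integral_rat_basis by (elim exE)
  from ex_has_least_nat[of ?P b0 D, OF b0]
  obtain b where b: "?P b" "\<forall>y. ?P y \<longrightarrow> D b \<le> D y" by (elim exE conjE) blast
  have "x \<in> int_span UNIV b" if x: "algebraic_int x" for x
  proof -
    obtain q :: "'a deg_index \<Rightarrow> rat" where q: "x = (\<Sum>j\<in>UNIV. of_rat (q j) * b j)"
      using rat_indep_span[of b] b(1) unfolding rat_span_def by blast
    have "\<exists>k. q j = of_int k" for j
    proof -
      obtain k f where kf: "q j = of_int k + f" "0 \<le> f" "f < 1" using rat_int_decomposition[of "q j"] by (elim exE conjE)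
      have "f = 0"
      proof (rule ccontr)
        assume f0: "f \<noteq> 0"
        define x' where "x' = x + of_int (- k) * b j"
        define b' where "b' = b(j := x')"
        have x': "algebraic_int x'" unfolding x'_def
          by (intro algebraic_int_add_mult x) (use b in auto)
        let ?c = "\<chi> i. (of_rat (if i = j then f else q i) :: complex)"
        have x'e: "e i x' = (M b *v ?c) $ i" for i
        proof -
          have "x' = (\<Sum>i\<in>UNIV. of_rat (if i = j then f else q i) * b i)"
          proof -
            have "(\<Sum>i\<in>UNIV. of_rat (if i = j then f else q i) * b i) =
                (\<Sum>i\<in>UNIV. of_rat (q i) * b i - (if i = j then of_int k * b i else 0))"
              by (intro sum.cong) (auto simp: kf(1) of_rat_add algebra_simps)
            also have "\<dots> = x - of_int k * b j" by (simp add: sum_subtractf q)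
            finally show ?thesis by (simp add: x'_def)
          qed
          then have "e i x' = (\<Sum>l\<in>UNIV. of_rat (if l = j then f else q l) * e i (b l))" by (simp add: e_simps)
          then show ?thesis by (simp add: M_def matrix_vector_mult_def mult.commute)
        qed
        \<comment> \<open>Column \<open>j\<close> is replaced by a combination of all columns with
          coefficient \<open>f\<close> at \<open>j\<close>, so Cramer's rule scales the determinant
          by \<open>f\<close>; with \<open>0 < f < 1\<close> this contradicts minimality.\<close>
        have "M b' = (\<chi> i l. if l = j then (M b *v ?c) $ i else M b $ i $ l)"
          by (rule cart_mat_eqI) (auto simp: M_def b'_def x'e[unfolded M_def])
        then have "det (M b') = ?c $ j * det (M b)" by (simp only: cramer_lemma)
        then have det': "det (M b') = of_rat f * det (M b)" by simp
        have nz: "det (M b) \<noteq> 0" using b(1) det_M_nz_iff by blast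
        then have "det (M b') \<noteq> 0" using det' f0 by simp
        then have P': "?P b'" using x' b(1) det_M_nz_iff by (auto simp: b'_def)
        have "cmod (of_rat f) = real_of_rat f"
        proof -
          have "(of_rat f :: complex) = of_real (of_rat f)" by (simp only: of_real_of_rat_complex)
          then show ?thesis using kf(2) by (simp only: norm_of_real) simp
        qed
        then have "real (D b') = (real_of_rat f)\<^sup>2 * real (D b)"
          using D[OF P'] D[OF b(1)] det' by (simp add: norm_mult norm_power power_mult_distrib)
        moreover have "(real_of_rat f)\<^sup>2 < 1"
        proof -
          have "real_of_rat f < 1" using kf(3) by (metis of_rat_1 of_rat_less)
          moreover have "0 \<le> real_of_rat f" using kf(2) by simp
          ultimately show ?thesis by (simp add: power_less_one_iff abs_square_less_1)
        qed
        moreover have "real (D b) > 0" using D[OF b(1)] nz by (metis norm_eq_zero of_nat_0_less_iff of_nat_eq_0_iff power_not_zero zero_less_iff_neq_zero)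
        ultimately have "real (D b') < real (D b)" by simp
        then show False using b(2) P' by (metis not_less of_nat_less_iff)
      qed
      then show ?thesis using kf(1) by auto
    qed
    then obtain k where k: "\<And>j. q j = of_int (k j)" by metis
    show ?thesis unfolding q k using int_spanI[of k b UNIV] by simp
  qed
  then show ?thesis using b(1) unfolding int_basis_def by blast
qed

text \<open>The base changes in the two directions have integer determinants with product
  \<open>1\<close>, so the determinants of the conjugate matrices differ at most by a sign.\<close>

lemma int_basis_det_eq:
  assumes "int_basis b" "int_basis b'"
  shows "(det (M b))\<^sup>2 = (det (M b'))\<^sup>2"
proof -
  have ch: "\<exists>k::int. det (M v) = det (M u) * of_int k" if "int_basis u" "int_basis v" for u v
  proof -
    have "\<exists>c::'a deg_index \<Rightarrow> int. v j = (\<Sum>k\<in>UNIV. of_int (c k) * u k)" for j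
      using that unfolding int_basis_def int_span_def by blast
    then obtain C where C: "\<And>j. v j = (\<Sum>k\<in>UNIV. of_int (C j k) * u k)" by metis
    have "M v = M u ** (\<chi> k j. of_rat (of_int (C j k)))" by (rule M_change_of_basis) (simp add: C)
    then have "det (M v) = det (M u) * det ((\<chi> k j. of_rat (of_int (C j k))) :: complex^'a deg_index^'a deg_index)"
      by (simp only: det_mul)
    moreover have "det ((\<chi> k j. of_rat (of_int (C j k))) :: complex^'a deg_index^'a deg_index) \<in> \<int>"
      by (rule det_in_Ints) simp
    ultimately show ?thesis by (metis Ints_cases)
  qed
  obtain k l where kl: "det (M b') = det (M b) * of_int k" "det (M b) = det (M b') * of_int l"
    using ch[OF assms] ch[OF assms(2,1)] by blast
  have nz: "det (M b) \<noteq> 0" using assms(1) det_M_nz_iff unfolding int_basis_def by blast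
  have "det (M b) * of_int (k * l) = det (M b) * 1"
    using kl(2)[unfolded kl(1), symmetric] by (simp only: of_int_mult mult.assoc mult_1_right)
  then have "of_int (k * l) = (1 :: complex)" using nz by (simp only: mult_cancel_left) simp
  then have "k * l = 1" by (metis of_int_eq_1_iff)
  then have "k = 1 \<or> k = -1" by (metis pos_zmult_eq_1_iff_lemma zmult_eq_1_iff)
  then show ?thesis using kl(1) by auto
qed

text \<open>\<open>integral_basis\<close> does not fix the length of the list. Uniqueness of integer
  coordinates yields rational independence after clearing denominators, and every element has a
  nonzero integer multiple that is an algebraic integer, which yields spanning; so the length is the
  degree.\<close>

lemma integral_basis_imp_int_basis:
  assumes "integral_basis \<omega>"
  shows "length \<omega> = field_degree TYPE('a)" "int_basis (\<lambda>i. \<omega> ! Rep_deg_index i)"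
proof -
  let ?n = "length \<omega>"
  have int: "algebraic_int (\<omega> ! i)" if "i < ?n" for i
    using assms nth_mem[OF that] by (auto simp: integral_basis_def ring_of_integers_def)
  have ex: "\<exists>!c::int list. length c = ?n \<and> x = (\<Sum>i<?n. of_int (c ! i) * \<omega> ! i)" if "algebraic_int x" for x
    using assms that by (simp add: integral_basis_def ring_of_integers_def)
  have zero: "z i = 0" if z: "(\<Sum>i<?n. of_int (z i) * \<omega> ! i) = 0" and i: "i < ?n" for z :: "nat \<Rightarrow> int" and i
  proof -
    obtain c0 where c0: "\<forall>y::int list. length y = ?n \<and> 0 = (\<Sum>i<?n. of_int (y ! i) * \<omega> ! i) \<longrightarrow> y = c0"
      using ex[OF algebraic_int_0] by (elim ex1E)
    have "map z [0..<?n] = c0" by (rule c0[THEN spec, THEN mp]) (simp add: z)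
    moreover have "replicate ?n 0 = c0" by (rule c0[THEN spec, THEN mp]) simp
    ultimately have "map z [0..<?n] = replicate ?n 0" by (simp only:)
    then have "map z [0..<?n] ! i = replicate ?n 0 ! i" by simp
    then show ?thesis using i by simp
  qed
  have ind: "rat_indep {..<?n} (\<lambda>i. \<omega> ! i)" unfolding rat_indep_def
  proof (intro allI impI ballI)
    fix c :: "nat \<Rightarrow> rat" and j assume c: "(\<Sum>i<?n. of_rat (c i) * \<omega> ! i) = 0" and j: "j \<in> {..<?n}"
    obtain N z where N: "N \<noteq> 0" "\<forall>i\<in>{..<?n}. of_int N * c i = of_int (z i)"
      using common_denominator[of "{..<?n}" c, OF finite_lessThan] by (elim exE conjE)
    have "(\<Sum>i<?n. of_int (z i) * \<omega> ! i) = (\<Sum>i<?n. of_int N * (of_rat (c i) * \<omega> ! i))"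
    proof (rule sum.cong)
      fix i assume "i \<in> {..<?n}"
      then have "of_int (z i) = of_int N * c i" using N(2) by simp
      then have "of_rat (of_int (z i)) = (of_rat (of_int N * c i) :: 'a)" by simp
      then show "of_int (z i) * \<omega> ! i = of_int N * (of_rat (c i) * \<omega> ! i)" by (simp add: of_rat_mult mult.assoc)
    qed simp
    also have "\<dots> = 0" by (simp only: sum_distrib_left[symmetric] c mult_zero_right)
    finally have "z j = 0" using zero j by simp
    then show "c j = 0" using N j by force
  qed
  have span: "rat_span {..<?n} (\<lambda>i. \<omega> ! i)" unfolding rat_span_def
  proof
    fix x :: 'a
    obtain N where N: "N \<noteq> 0" "algebraic_int (of_int N * x)"
      by (rule exists_algebraic_int_multiple[OF number_field_algebraic[OF nf, of x]])
    obtain c :: "int list" where c: "of_int N * x = (\<Sum>i<?n. of_int (c ! i) * \<omega> ! i)"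
      using ex[OF N(2)] by (elim ex1E conjE)
    have "(\<Sum>i<?n. of_rat (of_int (c ! i) / of_int N) * \<omega> ! i) = (\<Sum>i<?n. of_int (c ! i) * \<omega> ! i) / of_int N"
      by (simp add: of_rat_divide sum_divide_distrib)
    also have "\<dots> = x" using N(1) by (simp only: c[symmetric]) simp
    finally show "\<exists>c::nat \<Rightarrow> rat. x = (\<Sum>i<?n. of_rat (c i) * \<omega> ! i)"
      by (intro exI[of _ "\<lambda>i. of_int (c ! i) / of_int N"]) simp
  qed
  show n: "?n = field_degree TYPE('a)" using rat_indep_card_eq_iff[OF nf _ ind] span by simp
  let ?R = "Rep_deg_index :: 'a deg_index \<Rightarrow> nat"
  have bij: "bij_betw ?R UNIV {..<?n}" using bij_Rep_deg_index[OF nf] n by simp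
  have lt: "?R i < ?n" for i using bij by (auto simp: bij_betw_def)
  show "int_basis (\<lambda>i. \<omega> ! Rep_deg_index i)"
    unfolding int_basis_def
  proof (intro conjI allI impI)
    show "algebraic_int (\<omega> ! ?R j)" for j using int[OF lt] .
    show "rat_indep UNIV (\<lambda>i. \<omega> ! ?R i)" using rat_indep_reindex[OF bij, of "\<lambda>i. \<omega> ! i"] ind by simp
    fix x :: 'a assume "algebraic_int x"
    from ex[OF this] obtain c :: "int list" where c: "x = (\<Sum>i<?n. of_int (c ! i) * \<omega> ! i)" by (elim ex1E conjE)
    have "x = (\<Sum>i\<in>UNIV. of_int (c ! ?R i) * \<omega> ! ?R i)"
      unfolding c by (rule sum.reindex_bij_betw[OF bij, symmetric])
    then show "x \<in> int_span UNIV (\<lambda>i. \<omega> ! ?R i)" by (simp only: int_spanI)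
  qed
qed

text \<open>Supplies a list of the kind that the definition of \<open>discriminant\<close>
  quantifies over.\<close>

lemma int_basis_imp_integral_basis:
  assumes "int_basis b"
  defines "\<omega> \<equiv> map (\<lambda>k. b (Abs_deg_index k)) [0..<field_degree TYPE('a)]"
  shows "integral_basis \<omega>" "length \<omega> = field_degree TYPE('a)" "\<And>i. \<omega> ! Rep_deg_index i = b i"
proof -
  let ?R = "Rep_deg_index :: 'a deg_index \<Rightarrow> nat" and ?d = "field_degree TYPE('a)"
  note bij = bij_Rep_deg_index[OF nf]
  have lt: "?R i < ?d" for i using bij by (auto simp: bij_betw_def)
  show len: "length \<omega> = ?d" by (simp add: \<omega>_def)
  show nth: "\<omega> ! ?R i = b i" for i using lt[of i] by (simp add: \<omega>_def Rep_deg_index_inverse)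
  have sum: "(\<Sum>i<?d. of_int (c ! i) * \<omega> ! i) = (\<Sum>i\<in>UNIV. of_int (c ! ?R i) * b i)" for c :: "int list"
    using sum.reindex_bij_betw[OF bij, of "\<lambda>i. of_int (c ! i) * \<omega> ! i"] by (simp add: nth)
  show "integral_basis \<omega>"
    unfolding integral_basis_def len
  proof (intro conjI ballI ex_ex1I)
    show "set \<omega> \<subseteq> ring_of_integers"
      using assms(1) by (auto simp: \<omega>_def ring_of_integers_def int_basis_def)
    fix x :: 'a assume "x \<in> ring_of_integers"
    then have "x \<in> int_span UNIV b" using assms(1) by (auto simp: ring_of_integers_def int_basis_def)
    then obtain c :: "'a deg_index \<Rightarrow> int" where c: "x = (\<Sum>i\<in>UNIV. of_int (c i) * b i)" unfolding int_span_def by blast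
    let ?c = "map (\<lambda>k. c (Abs_deg_index k)) [0..<?d]"
    have cR: "?c ! ?R i = c i" for i using lt[of i] by (simp add: Rep_deg_index_inverse)
    have "x = (\<Sum>i<?d. of_int (?c ! i) * \<omega> ! i)" unfolding sum cR by (rule c)
    then show "\<exists>c::int list. length c = ?d \<and> x = (\<Sum>i<?d. of_int (c ! i) * \<omega> ! i)"
      by (intro exI[of _ ?c]) simp
  next
    fix x :: 'a and c c' :: "int list"
    assume c: "length c = ?d \<and> x = (\<Sum>i<?d. of_int (c ! i) * \<omega> ! i)" and c': "length c' = ?d \<and> x = (\<Sum>i<?d. of_int (c' ! i) * \<omega> ! i)"
    have "(\<Sum>i\<in>UNIV. of_rat (of_int (c ! ?R i - c' ! ?R i)) * b i) = x - x"
      by (subst (1) c[THEN conjunct2], subst c'[THEN conjunct2])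
        (simp add: sum left_diff_distrib sum_subtractf of_rat_diff)
    then have "(\<Sum>i\<in>UNIV. of_rat (of_int (c ! ?R i - c' ! ?R i)) * b i) = 0" by simp
    moreover have "rat_indep UNIV b" using assms(1) by (simp add: int_basis_def)
    ultimately have *: "\<forall>i\<in>UNIV. (of_int (c ! ?R i - c' ! ?R i) :: rat) = 0"
      unfolding rat_indep_def by (elim allE[of _ "\<lambda>i. of_int (c ! ?R i - c' ! ?R i)"] impE)
    show "c = c'"
    proof (rule nth_equalityI)
      show "length c = length c'" using c c' by simp
      fix k assume "k < length c"
      then have "k \<in> ?R ` UNIV" using bij c by (auto simp: bij_betw_def)
      then obtain i where "k = ?R i" by blast
      then show "c ! k = c' ! k" using *[THEN bspec, of i] by simp
    qed
  qed
qed

text \<open>The list \<open>\<sigma>\<close> gives a second instance of the locale, and both squared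
  determinants equal the determinant of the trace form.\<close>

lemma discriminant_relation:
  assumes "integral_basis \<omega>" "distinct \<sigma>" "set \<sigma> = embeddings UNIV"
  shows "(Determinant.det (Matrix.mat (length \<sigma>) (length \<omega>) (\<lambda>(i, j). (\<sigma> ! i) (\<omega> ! j))))\<^sup>2 =
    (det (M (\<lambda>i. \<omega> ! Rep_deg_index i)))\<^sup>2"
proof -
  let ?d = "field_degree TYPE('a)" and ?R = "Rep_deg_index :: 'a deg_index \<Rightarrow> nat"
  have ls: "length \<sigma> = ?d" using distinct_card[OF assms(2)] assms(3) card_embeddings[OF nf] by simp
  note lw = integral_basis_imp_int_basis(1)[OF assms(1)]
  have "bij_betw (\<lambda>k. \<sigma> ! k) {..<?d} (embeddings UNIV)"
    using bij_betw_nth[OF assms(2) _ assms(3)[symmetric]] ls by simp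
  then have bij: "bij_betw (\<lambda>i. \<sigma> ! ?R i) UNIV (embeddings UNIV)"
    using bij_betw_trans[OF bij_Rep_deg_index[OF nf]] by (simp add: o_def)
  interpret E: embedding_enum "\<lambda>i. \<sigma> ! ?R i" by unfold_locales (rule nf, rule bij)
  have "Determinant.det (Matrix.mat (length \<sigma>) (length \<omega>) (\<lambda>(i, j). (\<sigma> ! i) (\<omega> ! j))) =
      det (E.M (\<lambda>i. \<omega> ! ?R i))"
    unfolding ls lw E.M_def by (rule jnf_det_eq_det[OF nf])
  then show ?thesis by (simp only: det_M_square E.det_M_square)
qed

text \<open>An available integral basis together with the independence of all choices makes the
  definite description in \<open>discriminant\<close> denote.\<close>

theorem discriminant_eq:
  assumes "int_basis b"
  shows "of_int (discriminant TYPE('a)) = (det (M b))\<^sup>2"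
proof -
  let ?d = "field_degree TYPE('a)" and ?R = "Rep_deg_index :: 'a deg_index \<Rightarrow> nat"
  let ?Q = "\<lambda>D::int. \<exists>(\<omega> :: 'a list) \<sigma>. integral_basis \<omega> \<and> distinct \<sigma> \<and> set \<sigma> = embeddings UNIV \<and>
     of_int D = (Determinant.det (Matrix.mat (length \<sigma>) (length \<omega>) (\<lambda>(i, j). (\<sigma> ! i) (\<omega> ! j))))\<^sup>2"
  have "(det (M b))\<^sup>2 \<in> \<int>" by (rule det_M_square_int) (use assms in \<open>simp add: int_basis_def\<close>)
  then obtain D where D: "(det (M b))\<^sup>2 = of_int D" by (auto simp: Ints_def)
  have uniq: "D' = D" if "?Q D'" for D'
  proof -
    from that obtain \<omega> :: "'a list" and \<sigma> where *: "integral_basis \<omega>" "distinct \<sigma>" "set \<sigma> = embeddings UNIV"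
      "of_int D' = (Determinant.det (Matrix.mat (length \<sigma>) (length \<omega>) (\<lambda>(i, j). (\<sigma> ! i) (\<omega> ! j))))\<^sup>2"
      by (elim exE conjE)
    have "(of_int D' :: complex) = of_int D"
      unfolding *(4) discriminant_relation[OF *(1,2,3)] D[symmetric]
      by (rule int_basis_det_eq[OF integral_basis_imp_int_basis(2)[OF *(1)] assms])
    then show ?thesis by simp
  qed
  define \<omega> where "\<omega> = map (\<lambda>k. b (Abs_deg_index k)) [0..<?d]"
  note w = int_basis_imp_integral_basis[OF assms, folded \<omega>_def]
  obtain \<sigma> where s: "set \<sigma> = embeddings (UNIV :: 'a set)" "distinct \<sigma>"
    using finite_distinct_list[OF finite_embeddings[OF nf]] by (elim exE conjE)
  have "?Q D"
    by (rule exI[of _ \<omega>], rule exI[of _ \<sigma>])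
      (simp add: w(1) s discriminant_relation[OF w(1) s(2,1)] w(3) D)
  then have "discriminant TYPE('a) = D" unfolding discriminant_def using uniq by (rule the_equality)
  then show ?thesis by (simp add: D)
qed

end

section \<open>The lattice of integers\<close>

lemma det_of_real_cart: "det ((\<chi> i j. of_real (A $ i $ j)) :: complex^'n^'n) = of_real (det (A :: real^'n^'n))"
  by (simp add: det_def)

context embedding_enum
begin

lemma e_inj: "e i = e j \<longleftrightarrow> i = j"
  using e_bij by (auto simp: bij_betw_def inj_on_def)

lemma cnj_embedding:
  assumes "\<sigma> \<in> embeddings (UNIV :: 'a set)" shows "(\<lambda>x. cnj (\<sigma> x)) \<in> embeddings UNIV"
  by (simp add: embeddings_UNIV_iff ring_hom_on_def embedding_simps[OF assms])

definition conj_index :: "'a deg_index \<Rightarrow> 'a deg_index" where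
  "conj_index i = (SOME k. e k = (\<lambda>x. cnj (e i x)))"

lemma e_conj_index: "e (conj_index i) = (\<lambda>x. cnj (e i x))"
proof -
  obtain k where "(\<lambda>x. cnj (e i x)) = e k" using e_surj[OF cnj_embedding[OF e_emb[of i]]] by (elim exE)
  then have "e k = (\<lambda>x. cnj (e i x))" by simp
  then show ?thesis unfolding conj_index_def by (rule someI)
qed

lemma conj_index_conj_index [simp]: "conj_index (conj_index i) = i"
proof -
  have "e (conj_index (conj_index i)) = e i" by (simp add: e_conj_index)
  then show ?thesis by (simp only: e_inj)
qed

lemma conj_index_eq_iff: "conj_index i = i \<longleftrightarrow> range (e i) \<subseteq> \<real>"
proof -
  have "conj_index i = i \<longleftrightarrow> e (conj_index i) = e i" by (simp only: e_inj)
  also have "\<dots> \<longleftrightarrow> (\<forall>x. e i x \<in> \<real>)" by (simp only: e_conj_index fun_eq_iff Reals_cnj_iff)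
  finally show ?thesis by auto
qed

text \<open>The share of the volume, per unit of \<open>r i\<close>, that falls to one index in
  \<open>measure_discs\<close>: an interval has length \<open>2 * r i\<close>, and a disc of area
  \<open>2 * pi * (r i)^2\<close> is shared by two indices.\<close>

definition disc_weight :: "'a deg_index \<Rightarrow> real" where
  "disc_weight i = (if conj_index i = i then 2 else sqrt (2 * pi))"

text \<open>At \<open>conj_index i\<close> the entry becomes \<open>Re - Im\<close>, so a conjugate
  pair yields two real coordinates without a choice of representative. The squares of the
  coordinates at \<open>i\<close> and \<open>conj_index i\<close> add up to twice the squared
  modulus, also at a real embedding; this is where the factor \<open>2\<close> in
  \<open>measure_discs\<close> comes from.\<close>

definition real_matrix :: "('a deg_index \<Rightarrow> 'a) \<Rightarrow> real^'a deg_index^'a deg_index" where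
  "real_matrix b = (\<chi> i j. Re (e i (b j)) + Im (e i (b j)))"

text \<open>The real matrix is \<open>W ** M b\<close>, where \<open>W\<close> satisfies \<open>W ** transpose W = P\<close> for the permutation
  matrix \<open>P\<close> of complex conjugation.\<close>

lemma abs_det_real_matrix: "\<bar>det (real_matrix b)\<bar> = cmod (det (M b))"
proof -
  \<comment> \<open>With this \<open>a\<close>, which is half of \<open>1 - \<i>\<close>, the sum
    \<open>a * z + cnj a * cnj z\<close> equals \<open>Re z + Im z\<close>; the two relations in
    \<open>aa\<close> make \<open>W ** transpose W\<close> a permutation matrix.\<close>
  define a where "a = Complex (1/2) (-1/2)"
  define W :: "complex^'a deg_index^'a deg_index" where
    "W = (\<chi> i j. (if j = i then a else 0) + (if j = conj_index i then cnj a else 0))"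
  define P :: "complex^'a deg_index^'a deg_index" where "P = (\<chi> i k. if k = conj_index i then 1 else 0)"
  have aa: "a * a + cnj a * cnj a = 0" "a * cnj a + cnj a * a = 1" by (auto simp: a_def complex_eq_iff)
  have W_sum: "(\<Sum>j\<in>UNIV. W $ i $ j * f j) = a * f i + cnj a * f (conj_index i)" for i and f :: "'a deg_index \<Rightarrow> complex"
    by (simp add: W_def distrib_right sum.distrib if_distrib[of "\<lambda>x. x * _"] cong: if_cong)
  have "(\<chi> i j. of_real (real_matrix b $ i $ j)) = W ** M b"
  proof (rule cart_mat_eqI)
    fix i j
    have "(W ** M b) $ i $ j = a * e i (b j) + cnj a * cnj (e i (b j))"
      unfolding matrix_matrix_mult_def by (simp add: W_sum M_def e_conj_index)
    also have "\<dots> = of_real (Re (e i (b j)) + Im (e i (b j)))"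
      by (simp add: a_def complex_eq_iff)
    finally show "(\<chi> i j. complex_of_real (real_matrix b $ i $ j)) $ i $ j = (W ** M b) $ i $ j"
      by (simp add: real_matrix_def)
  qed
  then have dT: "of_real (det (real_matrix b)) = det W * det (M b)"
    by (simp only: det_of_real_cart[symmetric] det_mul)
  have WW: "W ** transpose W = P"
  proof (rule cart_mat_eqI)
    fix i k
    have "(W ** transpose W) $ i $ k = a * W $ k $ i + cnj a * W $ k $ conj_index i"
      unfolding matrix_matrix_mult_def transpose_def by (simp add: W_sum)
    also have "\<dots> = P $ i $ k"
    proof (cases "k = i")
      case True
      then show ?thesis using aa by (cases "conj_index i = i") (auto simp: W_def P_def algebra_simps)
    next
      case False
      show ?thesis
      proof (cases "k = conj_index i")
        case True then show ?thesis using aa False by (auto simp: W_def P_def algebra_simps)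
      next
        case ki: False
        have "i \<noteq> conj_index k" "conj_index i \<noteq> conj_index k"
          using ki False by (metis conj_index_conj_index)+
        then show ?thesis using False ki by (simp add: W_def P_def)
      qed
    qed
    finally show "(W ** transpose W) $ i $ k = P $ i $ k" .
  qed
  have "P ** P = mat 1"
  proof (rule cart_mat_eqI)
    fix i k
    have "(P ** P) $ i $ k = (\<Sum>j\<in>UNIV. if j = conj_index i then P $ j $ k else 0)"
      by (simp add: matrix_matrix_mult_def P_def if_distrib[of "\<lambda>x. x * _"] cong: if_cong)
    also have "\<dots> = P $ conj_index i $ k" by simp
    also have "\<dots> = mat 1 $ i $ k" by (auto simp: P_def mat_def)
    finally show "(P ** P) $ i $ k = mat 1 $ i $ k" .
  qed
  \<comment> \<open>Since \<open>P\<close> is an involution, \<open>det W\<close> is a fourth root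
    of unity and has modulus \<open>1\<close>.\<close>
  then have "det P * det P = 1" by (metis det_mul det_I)
  moreover have "det W * det W = det P" by (metis WW det_mul det_transpose)
  ultimately have "(det W * det W) * (det W * det W) = 1" by simp
  then have "cmod ((det W * det W) * (det W * det W)) = 1" by simp
  then have "(cmod (det W)) ^ 4 = 1" by (simp add: norm_mult power4_eq_xxxx mult.assoc)
  then have "cmod (det W) = 1" using power_eq_iff_eq_base[of 4 "cmod (det W)" 1] by simp
  moreover have "\<bar>det (real_matrix b)\<bar> = cmod (of_real (det (real_matrix b)))" by simp
  ultimately show ?thesis unfolding dT by (simp add: norm_mult)
qed

text \<open>In coordinates with respect to an integral basis the algebraic integers are the integer
  vectors, and the bounds cut out the preimage under the real matrix of the set in
  \<open>measure_discs\<close>. The volume of this preimage is the product of the weighted radii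
  divided by \<open>cmod (det (M b))\<close>, the square root of the absolute discriminant.\<close>

theorem minkowski_embedding:
  assumes b: "int_basis b" and r: "\<And>i. r i > 0" "\<And>i. r (conj_index i) = r i"
    and vol: "(\<Prod>i\<in>UNIV. disc_weight i * r i) > 2 ^ CARD('a deg_index) * cmod (det (M b))"
  shows "\<exists>\<alpha>. \<alpha> \<noteq> 0 \<and> algebraic_int \<alpha> \<and> (\<forall>i. cmod (e i \<alpha>) < r i)"
proof -
  let ?c = conj_index
  define T where "T = real_matrix b"
  have bi: "rat_indep UNIV b" using b by (simp add: int_basis_def)
  have dM: "cmod (det (M b)) > 0" using bi det_M_nz_iff by simp
  have dT: "\<bar>det T\<bar> = cmod (det (M b))" unfolding T_def by (rule abs_det_real_matrix)
  define z :: "'a deg_index \<Rightarrow> real^'a deg_index \<Rightarrow> complex" where "z i x = (\<Sum>j\<in>UNIV. of_real (x $ j) * e i (b j))" for i x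
  have zc: "z (?c i) x = cnj (z i x)" for i x by (simp add: z_def e_conj_index)
  have zT: "(T *v x) $ i = Re (z i x) + Im (z i x)" for i x
    by (simp add: T_def real_matrix_def matrix_vector_mult_def z_def distrib_left distrib_right sum.distrib mult.commute)
  have zlin: "z i (u *\<^sub>R x + v *\<^sub>R y) = u *\<^sub>R z i x + v *\<^sub>R z i y" for i u v x y
    by (simp add: z_def scaleR_conv_of_real[where 'a = complex] sum.distrib sum_distrib_left distrib_right mult.assoc)
  define Y where "Y = {y :: real^'a deg_index. \<forall>i. (y $ i)\<^sup>2 + (y $ ?c i)\<^sup>2 < 2 * (r i)\<^sup>2}"
  have TY: "T *v x \<in> Y \<longleftrightarrow> (\<forall>i. cmod (z i x) < r i)" for x
  proof -
    have "((T *v x) $ i)\<^sup>2 + ((T *v x) $ ?c i)\<^sup>2 = 2 * (cmod (z i x))\<^sup>2" for i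
      unfolding zT zc cmod_power2 by (simp add: power2_eq_square algebra_simps)
    moreover have "(cmod (z i x))\<^sup>2 < (r i)\<^sup>2 \<longleftrightarrow> cmod (z i x) < r i" for i
      using r(1)[of i] by (auto intro: power2_less_imp_less power_strict_mono)
    ultimately show ?thesis by (simp add: Y_def)
  qed
  have "det T \<noteq> 0" using dT dM by auto
  then obtain T' where T': "T ** T' = mat 1" "T' ** T = mat 1"
    using invertible_det_nz[of T] unfolding invertible_def by blast
  define S where "S = (*v) T' ` Y"
  have S: "S = {x. \<forall>i. cmod (z i x) < r i}"
  proof (intro equalityI subsetI)
    fix x assume "x \<in> S"
    then obtain y where y: "y \<in> Y" "x = T' *v y" unfolding S_def by blast
    have "T *v x = y" by (simp add: y(2) matrix_vector_mul_assoc T')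
    then show "x \<in> {x. \<forall>i. cmod (z i x) < r i}" using TY[of x] y(1) by simp
  next
    fix x assume "x \<in> {x. \<forall>i. cmod (z i x) < r i}"
    then have "T *v x \<in> Y" using TY[of x] by simp
    moreover have "x = T' *v (T *v x)" by (simp add: matrix_vector_mul_assoc T')
    ultimately show "x \<in> S" unfolding S_def by (rule rev_image_eqI)
  qed
  have lin: "linear ((*v) T')" by (rule matrix_vector_mul_linear)
  note Y = measure_discs[of ?c r, OF conj_index_conj_index r(2) r(1), folded Y_def]
  have Sm: "S \<in> lmeasurable" unfolding S_def by (rule measurable_linear_image[OF lin Y(2)])
  have "det T * det T' = 1" using T'(1) by (metis det_mul det_I)
  then have dT': "\<bar>det T'\<bar> * cmod (det (M b)) = 1" unfolding dT[symmetric] by (simp add: abs_mult[symmetric] mult.commute)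
  have "measure lebesgue S = \<bar>det T'\<bar> * measure lebesgue Y"
    unfolding S_def by (subst measure_linear_image[OF lin Y(2)]) simp
  also have "measure lebesgue Y = (\<Prod>i\<in>UNIV. disc_weight i * r i)" unfolding Y(1) disc_weight_def by simp
  finally have mS: "measure lebesgue S = \<bar>det T'\<bar> * (\<Prod>i\<in>UNIV. disc_weight i * r i)" .
  have "\<bar>det T'\<bar> * (2 ^ CARD('a deg_index) * cmod (det (M b))) < measure lebesgue S"
    unfolding mS by (rule mult_strict_left_mono[OF vol]) (use dT' in auto)
  moreover have "\<bar>det T'\<bar> * (2 ^ CARD('a deg_index) * cmod (det (M b))) = 2 ^ CARD('a deg_index)"
    using dT' by (simp add: mult.left_commute)
  ultimately have vS: "2 ^ CARD('a deg_index) < measure lebesgue S" by simp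
  have conv: "convex S"
  proof (rule convexI)
    fix x y and u v :: real assume *: "x \<in> S" "y \<in> S" "0 \<le> u" "0 \<le> v" "u + v = 1"
    have "cmod (z i (u *\<^sub>R x + v *\<^sub>R y)) < r i" for i
    proof -
      have "u *\<^sub>R z i x + v *\<^sub>R z i y \<in> ball 0 (r i)"
        by (rule convexD[OF convex_ball]) (use * in \<open>auto simp: S\<close>)
      then show ?thesis by (simp add: zlin)
    qed
    then show "u *\<^sub>R x + v *\<^sub>R y \<in> S" by (simp add: S)
  qed
  have sym: "- x \<in> S" if "x \<in> S" for x
  proof -
    have "z i (- x) = - z i x" for i by (simp add: z_def sum_negf)
    then show ?thesis using that by (simp add: S)
  qed
  have bd: "bounded S" unfolding S_def
    by (rule bounded_linear_image[OF Y(3)]) (rule linear_conv_bounded_linear[THEN iffD1, OF lin])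
  have "\<exists>x\<in>S. x \<noteq> 0 \<and> (\<forall>i. x $ i \<in> \<int>)"
    by (rule minkowski[OF conv _ bd Sm vS]) (rule sym)
  then obtain x
    where x: "x \<in> S" "x \<noteq> 0" "\<forall>i. x $ i \<in> \<int>" by (elim bexE conjE)
  define k where "k i = \<lfloor>x $ i\<rfloor>" for i
  have k: "x $ i = of_int (k i)" for i
    using x(3)[THEN spec, of i] by (auto simp: k_def elim: Ints_cases)
  define \<alpha> where "\<alpha> = (\<Sum>j\<in>UNIV. of_int (k j) * b j)"
  have ea: "e i \<alpha> = z i x" for i by (simp add: \<alpha>_def z_def e_simps k)
  have "algebraic_int \<alpha>" unfolding \<alpha>_def
    by (intro algebraic_int_sum algebraic_int_add_mult) (use b in \<open>auto simp: int_basis_def\<close>)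
  moreover have "\<alpha> \<noteq> 0"
  proof
    assume "\<alpha> = 0"
    then have "(\<Sum>j\<in>UNIV. of_rat (of_int (k j)) * b j) = 0" by (simp add: \<alpha>_def)
    then have "\<forall>j\<in>UNIV. (of_int (k j) :: rat) = 0"
      by (rule bi[unfolded rat_indep_def, THEN spec, of "\<lambda>j. of_int (k j)", THEN mp])
    then have "x = 0" by (simp add: vec_eq_iff k)
    then show False using x(2) by simp
  qed
  moreover have "\<forall>i. cmod (e i \<alpha>) < r i" using x(1) by (simp add: S ea)
  ultimately show ?thesis by blast
qed

end

section \<open>Local degrees\<close>

lemma cauchy_ring_simps:
  "zero (cauchy_ring v) = (\<lambda>n. 0)" "one (cauchy_ring v) = (\<lambda>n. 1)"
  "add (cauchy_ring v) x y = (\<lambda>n. x n + y n)" "monoid.mult (cauchy_ring v) x y = (\<lambda>n. x n * y n)"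
  by (simp_all add: cauchy_ring_def)

text \<open>The completion is identified with \<open>'b\<close> through the limits of the images of Cauchy sequences.\<close>

lemma local_degree_eq:
  fixes \<tau> :: "'a::field_char_0 \<Rightarrow> 'b::{real_normed_field, banach}"
  assumes hom: "\<tau> 1 = 1" "\<And>x y. \<tau> (x + y) = \<tau> x + \<tau> y" "\<And>x y. \<tau> (x * y) = \<tau> x * \<tau> y"
    and v: "\<And>x. v x = norm (\<tau> x)"
    and dense: "\<And>z. \<exists>x. (\<lambda>n. \<tau> (x n)) \<longlonglongrightarrow> z"
    and K: "\<And>z. z \<in> K \<longleftrightarrow> (\<exists>x. range x \<subseteq> \<rat> \<and> (\<lambda>n. \<tau> (x n)) \<longlonglongrightarrow> z)"
    and sub: "subfield K (class_ring :: 'b ring)" and dim: "ring.dimension (class_ring :: 'b ring) n K UNIV"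
  shows "local_degree v = n"
proof -
  have h0: "\<tau> 0 = 0" using hom(2)[of 0 0] by simp
  have hneg: "\<tau> (- x) = - \<tau> x" for x
  proof -
    have "\<tau> x + \<tau> (- x) = 0" using hom(2)[of x "- x"] h0 by simp
    then show ?thesis by (rule minus_unique[symmetric])
  qed
  have hdiff: "\<tau> (x - y) = \<tau> x - \<tau> y" for x y using hom(2)[of x "- y"] hneg by simp
  let ?C = "cauchy_ring v"
  \<comment> \<open>By completeness of the target, a sequence is Cauchy for \<open>v\<close> exactly
    if its image converges.\<close>
  have car: "x \<in> carrier ?C \<longleftrightarrow> convergent (\<lambda>n. \<tau> (x n))" for x
    unfolding Cauchy_convergent_iff[symmetric] Cauchy_iff by (simp add: cauchy_ring_def v hdiff)
  have nul: "null_sequences v = {x. (\<lambda>n. \<tau> (x n)) \<longlonglongrightarrow> 0}"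
    by (simp add: null_sequences_def v tendsto_norm_zero_iff)
  define \<phi> where "\<phi> x = lim (\<lambda>n. \<tau> (x n))" for x :: "nat \<Rightarrow> 'a"
  have \<phi>: "(\<lambda>n. \<tau> (x n)) \<longlonglongrightarrow> \<phi> x" if "x \<in> carrier ?C" for x
    using that by (simp add: car \<phi>_def convergent_LIMSEQ_iff)
  have \<phi>I: "x \<in> carrier ?C \<and> \<phi> x = z" if "(\<lambda>n. \<tau> (x n)) \<longlonglongrightarrow> z" for x z
    using that by (auto simp: car \<phi>_def convergent_def limI)
  have add: "(\<lambda>n. x n + y n) \<in> carrier ?C \<and> \<phi> (\<lambda>n. x n + y n) = \<phi> x + \<phi> y"
    if "x \<in> carrier ?C" "y \<in> carrier ?C" for x y
    by (rule \<phi>I) (simp add: hom tendsto_add \<phi> that)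
  have mul: "(\<lambda>n. x n * y n) \<in> carrier ?C \<and> \<phi> (\<lambda>n. x n * y n) = \<phi> x * \<phi> y"
    if "x \<in> carrier ?C" "y \<in> carrier ?C" for x y
    by (rule \<phi>I) (simp add: hom tendsto_mult \<phi> that)
  have neg: "(\<lambda>n. - x n) \<in> carrier ?C" if "x \<in> carrier ?C" for x
    using \<phi>I[of "\<lambda>n. - x n" "- \<phi> x"] tendsto_minus[OF \<phi>[OF that]] by (simp add: hneg)
  have one: "(\<lambda>n. 1) \<in> carrier ?C \<and> \<phi> (\<lambda>n. 1) = 1" by (rule \<phi>I) (simp add: hom)
  have zero: "(\<lambda>n. 0) \<in> carrier ?C \<and> \<phi> (\<lambda>n. 0) = 0" by (rule \<phi>I) (simp add: h0)
  have rC: "ring ?C"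
  proof (rule ringI)
    show "abelian_group ?C"
    proof (rule abelian_groupI)
      fix x assume x: "x \<in> carrier ?C"
      show "\<exists>y\<in>carrier ?C. y \<oplus>\<^bsub>?C\<^esub> x = \<zero>\<^bsub>?C\<^esub>"
        by (rule bexI[OF _ neg[OF x]]) (simp add: cauchy_ring_simps)
    qed (use add zero in \<open>simp_all add: cauchy_ring_simps add_ac\<close>)
    show "monoid ?C" by (rule monoidI) (use mul one in \<open>simp_all add: cauchy_ring_simps mult_ac\<close>)
  qed (simp_all add: cauchy_ring_simps algebra_simps)
  have rB: "ring (class_ring :: 'b ring)" by (rule class_ring.ring_axioms)
  have "\<phi> \<in> Ring.ring_hom ?C class_ring"
  proof (rule ring_hom_memI)
    fix x y assume x: "x \<in> carrier ?C" and y: "y \<in> carrier ?C"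
    show "\<phi> (x \<otimes>\<^bsub>?C\<^esub> y) = \<phi> x \<otimes>\<^bsub>class_ring\<^esub> \<phi> y"
      unfolding cauchy_ring_simps using mul[OF x y] by simp
    show "\<phi> (x \<oplus>\<^bsub>?C\<^esub> y) = \<phi> x \<oplus>\<^bsub>class_ring\<^esub> \<phi> y"
      unfolding cauchy_ring_simps using add[OF x y] by simp
  next
    show "\<phi> \<one>\<^bsub>?C\<^esub> = \<one>\<^bsub>class_ring\<^esub>" unfolding cauchy_ring_simps using one by simp
  qed simp
  then have F: "ring_hom_ring ?C (class_ring :: 'b ring) \<phi>"
    by (rule ring_hom_ringI2[OF rC rB])
  have ker: "a_kernel ?C class_ring \<phi> = null_sequences v"
  proof (intro equalityI subsetI)
    fix x assume "x \<in> a_kernel ?C class_ring \<phi>"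
    then have "x \<in> carrier ?C" "\<phi> x = 0" by (simp_all add: a_kernel_def')
    then show "x \<in> null_sequences v" using \<phi>[of x] by (simp add: nul)
  next
    fix x assume "x \<in> null_sequences v"
    then show "x \<in> a_kernel ?C class_ring \<phi>" using \<phi>I[of x 0] by (simp add: nul a_kernel_def')
  qed
  have surj: "\<phi> ` carrier ?C = carrier (class_ring :: 'b ring)"
  proof (intro equalityI subsetI)
    fix z :: 'b
    obtain x where "(\<lambda>n. \<tau> (x n)) \<longlonglongrightarrow> z" using dense[of z] by (elim exE)
    then have "x \<in> carrier ?C \<and> \<phi> x = z" by (rule \<phi>I)
    then show "z \<in> \<phi> ` carrier ?C" by (elim conjE) (rule image_eqI, simp_all)
  qed simp
  let ?Q = "Defs.completion v" and ?h = "\<lambda>A. the_elem (\<phi> ` A)"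
  have Q: "?Q = ?C Quot (a_kernel ?C class_ring \<phi>)" by (simp add: Defs.completion_def ker)
  have iso: "?h \<in> ring_iso ?Q (class_ring :: 'b ring)" unfolding Q by (rule ring_hom_ring.FactRing_iso_set[OF F surj])
  have rQ: "ring ?Q" unfolding Q by (rule ideal.quotient_is_ring[OF ring_hom_ring.kernel_is_ideal[OF F]])
  have bij: "bij_betw ?h (carrier ?Q) UNIV" using iso by (simp add: ring_iso_def)
  \<comment> \<open>Subfields and dimensions are carried forward along an injective homomorphism, so
    the inverse of the isomorphism is used, from the known field into the completion.\<close>
  define \<psi> where "\<psi> = inv_into (carrier ?Q) ?h"
  have \<psi>iso: "\<psi> \<in> ring_iso (class_ring :: 'b ring) ?Q" unfolding \<psi>_def by (rule ring_iso_set_sym[OF rQ iso])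
  have \<psi>bij: "bij_betw \<psi> UNIV (carrier ?Q)" unfolding \<psi>_def by (rule bij_betw_inv_into[OF bij])
  have G: "ring_hom_ring (class_ring :: 'b ring) ?Q \<psi>"
    by (rule ring_hom_ringI2[OF rB rQ]) (use \<psi>iso in \<open>simp add: ring_iso_def\<close>)
  have coset: "a_r_coset ?C (null_sequences v) x \<in> carrier ?Q \<and> ?h (a_r_coset ?C (null_sequences v) x) = \<phi> x"
    if "x \<in> carrier ?C" for x
    using ring_hom_ring.the_elem_simp[OF F that] that unfolding Q ker
    by (auto simp: FactRing_def A_RCOSETS_def')
  have img: "\<psi> ` K = rational_completion v"
  proof (intro equalityI subsetI)
    fix A assume "A \<in> \<psi> ` K"
    then obtain z where z: "z \<in> K" "A = \<psi> z" by blast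
    obtain x where x: "range x \<subseteq> \<rat>" "(\<lambda>n. \<tau> (x n)) \<longlonglongrightarrow> z" using z(1) K[of z] by blast
    have xc: "x \<in> carrier ?C" "\<phi> x = z" using \<phi>I[OF x(2)] by simp_all
    have "\<psi> (?h (a_r_coset ?C (null_sequences v) x)) = a_r_coset ?C (null_sequences v) x"
      unfolding \<psi>_def by (rule bij_betw_inv_into_left[OF bij]) (use coset[OF xc(1)] in simp)
    then have "A = a_r_coset ?C (null_sequences v) x" using coset[OF xc(1)] xc(2) z(2) by simp
    then show "A \<in> rational_completion v" unfolding rational_completion_def using xc(1) x(1) by blast
  next
    fix A assume "A \<in> rational_completion v"
    then obtain x where x: "A = a_r_coset ?C (null_sequences v) x" "x \<in> carrier ?C" "range x \<subseteq> \<rat>"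
      unfolding rational_completion_def by blast
    have "\<psi> (?h A) = A" unfolding \<psi>_def by (rule bij_betw_inv_into_left[OF bij]) (use coset[OF x(2)] x(1) in simp)
    moreover have "?h A = \<phi> x" using coset[OF x(2)] x(1) by simp
    moreover have "\<phi> x \<in> K" using K[of "\<phi> x"] \<phi>[OF x(2)] x(3) by blast
    ultimately show "A \<in> \<psi> ` K" by (metis image_eqI)
  qed
  have img_UNIV: "\<psi> ` UNIV = carrier ?Q" using \<psi>bij by (simp add: bij_betw_def)
  have nz: "\<one>\<^bsub>?Q\<^esub> \<noteq> \<zero>\<^bsub>?Q\<^esub>"
  proof
    assume "\<one>\<^bsub>?Q\<^esub> = \<zero>\<^bsub>?Q\<^esub>"
    moreover have hm: "\<psi> \<in> Ring.ring_hom class_ring ?Q" using \<psi>iso by (simp add: ring_iso_def)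
    moreover have "\<psi> 1 = \<one>\<^bsub>?Q\<^esub>" using ring_hom_one[OF hm] by simp
    moreover have "\<psi> 0 = \<zero>\<^bsub>?Q\<^esub>" using ring_hom_zero[OF hm rB rQ] by simp
    ultimately have "\<psi> 1 = \<psi> 0" by (simp only:)
    then have "(1 :: 'b) = 0" using \<psi>bij by (metis UNIV_I bij_betw_imp_inj_on inj_onD)
    then show False by simp
  qed
  have sf: "subfield (rational_completion v) ?Q" using ring_hom_ring.img_is_subfield(2)[OF G sub nz] img by simp
  have "ring.dimension ?Q n (\<psi> ` K) (\<psi> ` UNIV)"
    by (rule ring_hom_ring.inj_hom_dimension[OF G sub nz _ dim]) (use \<psi>bij in \<open>simp add: bij_betw_def\<close>)
  then have "ring.dimension ?Q n (rational_completion v) (carrier ?Q)" by (simp only: img img_UNIV)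
  then show ?thesis
    unfolding local_degree_def using ring.dimI[OF rQ sf] by (simp add: over_def)
qed

section \<open>The real and complex numbers as local fields\<close>

lemma rat_sequence: "\<exists>q :: nat \<Rightarrow> rat. (\<lambda>n. of_rat (q n) :: real) \<longlonglongrightarrow> z"
proof -
  have "\<forall>n. \<exists>q. z < of_rat q \<and> of_rat q < z + 1 / real (Suc n)"
    using of_rat_dense by simp
  from choice[OF this] obtain q :: "nat \<Rightarrow> rat"
    where q: "\<forall>n. z < of_rat (q n) \<and> of_rat (q n) < z + 1 / real (Suc n)" by (elim exE)
  have lim: "(\<lambda>n. z + 1 / real (Suc n)) \<longlonglongrightarrow> z + 0"
    by (intro tendsto_add tendsto_const LIMSEQ_Suc[OF lim_1_over_n])
  have "(\<lambda>n. of_rat (q n) :: real) \<longlonglongrightarrow> z"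
    by (rule tendsto_sandwich[OF _ _ tendsto_const lim[simplified]])
      (use q in \<open>auto intro!: always_eventually less_imp_le\<close>)
  then show ?thesis by (intro exI)
qed

lemma subfield_UNIV_real: "subfield UNIV (class_ring :: real ring)"
  by (simp add: subfield_class_ring_iff)

lemma dimension_real: "ring.dimension (class_ring :: real ring) 1 UNIV UNIV"
  by (rule ring.dimension_one[OF ring_class_ring subfield_UNIV_real])

lemma subfield_Reals: "subfield \<real> (class_ring :: complex ring)"
  by (simp add: subfield_class_ring_iff)

lemma dimension_complex: "ring.dimension (class_ring :: complex ring) 2 \<real> UNIV"
proof -
  have "ring.dimension (class_ring :: complex ring) (Suc 1) \<real> (ring.line_extension class_ring \<real> \<i> \<real>)"
    by (rule ring.Suc_dim[OF ring_class_ring _ _ ring.dimension_one[OF ring_class_ring subfield_Reals]])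
      (simp_all add: complex_is_Real_iff)
  moreover have "ring.line_extension class_ring \<real> \<i> \<real> = (UNIV :: complex set)"
  proof (intro equalityI subsetI)
    fix z :: complex
    have "z = of_real (Im z) * \<i> + of_real (Re z)" by (simp add: complex_eq_iff)
    then show "z \<in> ring.line_extension class_ring \<real> \<i> \<real>"
      unfolding ring.line_extension_mem_iff[OF ring_class_ring] by (intro bexI[of _ "of_real (Im z)"] bexI[of _ "of_real (Re z)"]) simp_all
  qed simp
  ultimately show ?thesis by (simp add: numeral_2_eq_2)
qed

section \<open>Places and heights\<close>

lemma absolute_value_simps:
  assumes "absolute_value (v :: 'a::field_char_0 \<Rightarrow> real)"
  shows "v 0 = 0" "v 1 = 1" "v x \<ge> 0" "v x = 0 \<longleftrightarrow> x = 0" "v (x * y) = v x * v y" "v (x + y) \<le> v x + v y"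
    "v (- x) = v x" "v (x ^ n) = v x ^ n" "v (inverse x) = inverse (v x)" "v (x / y) = v x / v y"
    "v (sum f A) \<le> (\<Sum>i\<in>A. v (f i))" "v (x - y) \<le> v x + v y"
proof -
  have *: "v x \<ge> 0" "v x = 0 \<longleftrightarrow> x = 0" "v (x * y) = v x * v y" "v (x + y) \<le> v x + v y" for x y
    using assms by (auto simp: absolute_value_def)
  show z: "v 0 = 0" using * by simp
  have "v 1 * v 1 = v 1 * 1" using *(3)[of 1 1] by simp
  then show one: "v 1 = 1" using *(2)[of 1] by (simp only: mult_cancel_left) simp
  show "v x \<ge> 0" "v x = 0 \<longleftrightarrow> x = 0" "v (x * y) = v x * v y" "v (x + y) \<le> v x + v y" by (rule *)+
  have "v (-1) * v (-1) = 1" using *(3)[of "-1" "-1"] one by simp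
  then have "v (-1) = 1" using *(1)[of "-1"] by (metis abs_of_nonneg abs_mult_self_eq real_sqrt_abs2 real_sqrt_one)
  then show m: "v (- x) = v x" for x using *(3)[of "-1" x] by simp
  show "v (x ^ n) = v x ^ n" by (induction n) (simp_all add: one *(3))
  have inv: "v (inverse x) = inverse (v x)" for x
  proof (cases "x = 0")
    case False
    then have "v x * v (inverse x) = 1" using *(3)[of x "inverse x"] one by simp
    then show ?thesis by (metis inverse_unique)
  qed (simp add: z)
  show "v (inverse x) = inverse (v x)" by (rule inv)
  show "v (x / y) = v x / v y" by (simp add: divide_inverse *(3) inv)
  show "v (sum f A) \<le> (\<Sum>i\<in>A. v (f i))"
  proof (induction A rule: infinite_finite_induct)
    case (insert i A)
    then show ?case using *(4)[of "f i" "sum f A"] by simp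
  qed (simp_all add: z)
  show "v (x - y) \<le> v x + v y" using *(4)[of x "- y"] m[of y] by simp
qed

text \<open>\<open>absolute_value\<close> provides only the triangle inequality, so the bound comes
  from growth: every power of \<open>x\<close> is an integer combination of finitely many fixed
  powers, integers have absolute value at most \<open>1\<close>, and thus the powers of
  \<open>v x\<close> stay bounded.\<close>

lemma nonarchimedean_algebraic_int_le_1:
  assumes "v \<in> nonarchimedean_places" "algebraic_int (x :: 'a::field_char_0)"
  shows "v x \<le> 1"
proof (rule ccontr)
  assume "\<not> v x \<le> 1"
  then have gt: "v x > 1" by simp
  obtain p where av: "absolute_value v" and p: "prime p" "\<And>q. v (of_rat q) = padic_abs p q"
    using assms(1) unfolding nonarchimedean_places_def by blast
  note V = absolute_value_simps[OF av]
  have int: "v (of_int k) \<le> 1" for k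
  proof -
    have "v (of_int k) = padic_abs p (of_int k)" using p(2)[of "of_int k"] by simp
    also have "\<dots> \<le> 1"
    proof (cases "k = 0")
      case False
      have "real p > 1" using prime_gt_1_nat[OF p(1)] by simp
      then have "1 \<le> real p ^ multiplicity (int p) k" by (simp add: one_le_power)
      then have "real p powi (- int (multiplicity (int p) k)) \<le> 1"
        by (simp add: power_int_minus power_int_of_nat inverse_le_1_iff)
      then show ?thesis using False by (simp add: padic_abs_def)
    qed (simp add: padic_abs_def)
    finally show ?thesis .
  qed
  obtain n where "0 < n" and n: "\<And>k. x ^ k \<in> int_span {..<n} (\<lambda>i. x ^ i)"
    by (rule algebraic_int_power_span[OF assms(2)], rule that)
  have bound: "v x ^ k \<le> (\<Sum>i<n. v x ^ i)" for k
  proof -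
    obtain c where c: "x ^ k = (\<Sum>i<n. of_int (c i) * x ^ i)" using n[of k] by (auto simp: int_span_def)
    have "v x ^ k = v (x ^ k)" by (simp add: V)
    also have "\<dots> \<le> (\<Sum>i<n. v (of_int (c i) * x ^ i))" unfolding c by (rule V(11))
    also have "\<dots> \<le> (\<Sum>i<n. v x ^ i)"
      by (rule sum_mono) (use int in \<open>simp add: V mult_left_le_one_le\<close>)
    finally show ?thesis .
  qed
  obtain k where "(\<Sum>i<n. v x ^ i) < v x ^ k" using real_arch_pow[OF gt, of "\<Sum>i<n. v x ^ i"] by (elim exE)
  then show False using bound[of k] by simp
qed

text \<open>Polymorphic because it is formed in the number field and, after an embedding is applied,
  among the complex numbers. The denominator vanishes only if a power of \<open>x\<close> is
  \<open>-1\<close>, which \<open>v x > 1\<close> rules out.\<close>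

definition power_ratio :: "'a::field \<Rightarrow> nat \<Rightarrow> 'a" where
  "power_ratio x n = x ^ n / (1 + x ^ n)"

lemma power_ratio_tendsto_0:
  assumes "cmod t < 1" shows "power_ratio t \<longlonglongrightarrow> 0"
proof -
  have lim: "(\<lambda>n. t ^ n) \<longlonglongrightarrow> 0" by (rule LIMSEQ_power_zero[OF assms])
  have "(\<lambda>n. t ^ n / (1 + t ^ n)) \<longlonglongrightarrow> 0 / (1 + 0)"
    by (intro tendsto_divide tendsto_add tendsto_const lim) simp
  then show ?thesis by (simp add: power_ratio_def[abs_def])
qed

lemma power_ratio_tendsto_1:
  assumes "cmod t > 1" shows "power_ratio t \<longlonglongrightarrow> 1"
proof -
  have t0: "t \<noteq> 0" using assms by auto
  have "cmod (1 / t) < 1" using assms t0 by (simp add: norm_divide divide_less_eq)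
  then have lim: "(\<lambda>n. (1 / t) ^ n) \<longlonglongrightarrow> 0" by (rule LIMSEQ_power_zero)
  have "(\<lambda>n. 1 / ((1 / t) ^ n + 1)) \<longlonglongrightarrow> 1 / (0 + 1)"
    by (intro tendsto_divide tendsto_add tendsto_const lim) simp
  moreover have "1 / ((1 / t) ^ n + 1) = t ^ n / (1 + t ^ n)" for n
  proof -
    have "(1 / t) ^ n + 1 = (1 + t ^ n) / t ^ n" using t0 by (simp add: power_divide add_divide_distrib)
    then show ?thesis by simp
  qed
  ultimately show ?thesis by (simp add: power_ratio_def[abs_def])
qed

section \<open>Archimedean absolute values of a number field\<close>

context embedding_enum
begin

definition place :: "'a deg_index \<Rightarrow> 'a \<Rightarrow> real" where
  "place i = (\<lambda>x. cmod (e i x))"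

lemma place_archimedean: "place i \<in> archimedean_places"
proof -
  have "cmod (of_rat q) = \<bar>of_rat q\<bar>" for q
    by (simp only: of_real_of_rat_complex[symmetric] norm_of_real)
  then show ?thesis
    by (simp add: archimedean_places_def place_def absolute_value_def e_simps norm_mult norm_triangle_ineq)
qed

text \<open>Equal moduli at \<open>x\<close> and at \<open>x + 1\<close> force equal real parts, so
  at each point the second embedding agrees with the first or with its conjugate. If each
  alternative failed somewhere, at \<open>x\<close> and at \<open>y\<close>, both would fail at
  \<open>x + y\<close>.\<close>

lemma place_eq_iff: "place i = place j \<longleftrightarrow> j = i \<or> j = conj_index i"
proof
  assume eq: "place i = place j"
  have pt: "cmod (e i x) = cmod (e j x)" for x using fun_cong[OF eq, of x] by (simp add: place_def)
  have dich: "e j x = e i x \<or> e j x = cnj (e i x)" for x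
  proof -
    have "(cmod (e i x + 1))\<^sup>2 = (cmod (e j x + 1))\<^sup>2" using pt[of "x + 1"] by (simp add: e_simps)
    moreover have sq: "(cmod (e i x))\<^sup>2 = (cmod (e j x))\<^sup>2" using pt[of x] by simp
    ultimately have re: "Re (e i x) = Re (e j x)" by (simp only: cmod_power2) (simp add: power2_eq_square algebra_simps)
    then have "(Im (e i x))\<^sup>2 = (Im (e j x))\<^sup>2" using sq by (simp add: cmod_power2)
    then have "Im (e j x) = Im (e i x) \<or> Im (e j x) = - Im (e i x)" by (metis power2_eq_iff)
    then show ?thesis using re by (auto simp: complex_eq_iff)
  qed
  show "j = i \<or> j = conj_index i"
  proof (rule ccontr)
    assume "\<not> ?thesis"
    then have "e j \<noteq> e i" "e j \<noteq> e (conj_index i)" by (simp_all only: e_inj) simp_all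
    then obtain x y where xy: "e j x \<noteq> e i x" "e j y \<noteq> cnj (e i y)" by (auto simp: fun_eq_iff e_conj_index)
    then have "e j x = cnj (e i x)" "e j y = e i y" using dich[of x] dich[of y] by simp_all
    then show False using dich[of "x + y"] xy by (auto simp: e_simps)
  qed
next
  assume "j = i \<or> j = conj_index i"
  then show "place i = place j" by (auto simp: place_def e_conj_index)
qed

text \<open>The inverse of \<open>M b\<close> expresses the rational coordinates of \<open>x\<close>
  linearly in its conjugates, and \<open>v\<close> is the usual absolute value on these
  coordinates.\<close>

lemma archimedean_le_sum:
  assumes "v \<in> archimedean_places"
  obtains C where "C \<ge> 0" "\<And>x. v x \<le> C * (\<Sum>i\<in>UNIV. cmod (e i x))"
proof -
  have av: "absolute_value v" and vq: "\<And>q. v (of_rat q) = \<bar>of_rat q\<bar>" using assms by (auto simp: archimedean_places_def)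
  note V = absolute_value_simps[OF av]
  obtain b :: "'a deg_index \<Rightarrow> 'a" where b: "rat_indep UNIV b" by (rule rat_basis_deg_index)
  obtain N where N: "N ** M b = mat 1"
    using b det_M_nz_iff[of b] invertible_det_nz[of "M b"] unfolding invertible_def by blast
  define C where "C = (\<Sum>j\<in>UNIV. (\<Sum>i\<in>UNIV. cmod (N $ j $ i)) * v (b j))"
  have C0: "C \<ge> 0" unfolding C_def by (intro sum_nonneg mult_nonneg_nonneg) (simp_all add: V)
  have "v x \<le> C * (\<Sum>i\<in>UNIV. cmod (e i x))" for x
  proof -
    let ?s = "\<Sum>i\<in>UNIV. cmod (e i x)"
    obtain q :: "'a deg_index \<Rightarrow> rat" where q: "x = (\<Sum>j\<in>UNIV. of_rat (q j) * b j)"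
      using rat_indep_span[OF b] unfolding rat_span_def by blast
    have "M b *v (\<chi> j. of_rat (q j)) = (\<chi> i. e i x)"
      by (rule cart_vec_eqI) (simp add: M_def matrix_vector_mult_def q e_simps mult.commute)
    then have "N *v (\<chi> i. e i x) = (\<chi> j. of_rat (q j))"
      by (metis N matrix_vector_mul_assoc matrix_vector_mul_lid)
    then have qj: "of_rat (q j) = (\<Sum>i\<in>UNIV. N $ j $ i * e i x)" for j
      by (simp add: vec_eq_iff matrix_vector_mult_def)
    have "\<bar>of_rat (q j)\<bar> \<le> (\<Sum>i\<in>UNIV. cmod (N $ j $ i)) * ?s" for j
    proof -
      have "\<bar>of_rat (q j)\<bar> = cmod (of_rat (q j))" by (simp only: of_real_of_rat_complex[symmetric] norm_of_real)
      also have "\<dots> \<le> (\<Sum>i\<in>UNIV. cmod (N $ j $ i * e i x))" unfolding qj by (rule norm_sum)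
      also have "\<dots> \<le> (\<Sum>i\<in>UNIV. cmod (N $ j $ i) * ?s)"
      proof (rule sum_mono)
        fix i
        have "cmod (e i x) \<le> ?s" by (rule member_le_sum) simp_all
        then show "cmod (N $ j $ i * e i x) \<le> cmod (N $ j $ i) * ?s" by (simp add: norm_mult mult_left_mono)
      qed
      finally show ?thesis by (simp add: sum_distrib_right)
    qed
    then have "(\<Sum>j\<in>UNIV. v (of_rat (q j) * b j)) \<le> (\<Sum>j\<in>UNIV. (\<Sum>i\<in>UNIV. cmod (N $ j $ i)) * ?s * v (b j))"
      by (intro sum_mono) (simp add: V vq mult_right_mono)
    moreover have "v x \<le> (\<Sum>j\<in>UNIV. v (of_rat (q j) * b j))" by (subst q) (rule V(11))
    moreover have "C * ?s = (\<Sum>j\<in>UNIV. (\<Sum>i\<in>UNIV. cmod (N $ j $ i)) * v (b j) * ?s)"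
      unfolding C_def by (rule sum_distrib_right)
    then have "C * ?s = (\<Sum>j\<in>UNIV. (\<Sum>i\<in>UNIV. cmod (N $ j $ i)) * ?s * v (b j))"
      by (simp only: mult.assoc mult.commute[of ?s])
    ultimately show ?thesis by linarith
  qed
  then show ?thesis by (rule that[OF C0])
qed

text \<open>Passing to high powers removes the constant \<open>C\<close>: if \<open>v x\<close>
  exceeded every \<open>cmod (e i x)\<close>, the bound for \<open>x ^ n\<close> divided by
  \<open>v x ^ n\<close> would fail for large \<open>n\<close>.\<close>

lemma archimedean_le_some_embedding:
  assumes "v \<in> archimedean_places"
  shows "\<exists>i. v x \<le> cmod (e i x)"
proof (rule ccontr)
  assume "\<not> ?thesis"
  then have lt: "cmod (e i x) < v x" for i by (simp add: not_le)
  have av: "absolute_value v" using assms by (auto simp: archimedean_places_def)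
  note V = absolute_value_simps[OF av]
  obtain C where C: "C \<ge> 0" "\<And>x. v x \<le> C * (\<Sum>i\<in>UNIV. cmod (e i x))" by (rule archimedean_le_sum[OF assms], rule that)
  have vx: "v x > 0" using lt[of undefined] norm_ge_zero[of "e undefined x"] by linarith
  have "1 \<le> C * (\<Sum>i\<in>UNIV. (cmod (e i x) / v x) ^ n)" for n
  proof -
    have "v x ^ n \<le> C * (\<Sum>i\<in>UNIV. cmod (e i x) ^ n)" using C(2)[of "x ^ n"] by (simp add: V e_simps norm_power)
    then have "v x ^ n / v x ^ n \<le> C * (\<Sum>i\<in>UNIV. cmod (e i x) ^ n) / v x ^ n" using vx by (simp add: divide_right_mono)
    then show ?thesis using vx by (simp add: sum_divide_distrib[symmetric] power_divide)
  qed
  moreover have "(\<lambda>n. C * (\<Sum>i\<in>UNIV. (cmod (e i x) / v x) ^ n)) \<longlonglongrightarrow> C * (\<Sum>i\<in>(UNIV :: 'a deg_index set). 0)"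
    by (intro tendsto_intros LIMSEQ_realpow_zero) (use lt vx in \<open>simp_all add: less_imp_le\<close>)
  ultimately have "1 \<le> C * (\<Sum>i\<in>(UNIV :: 'a deg_index set). 0)" by (intro LIMSEQ_le_const) auto
  then show False by simp
qed

text \<open>If \<open>v x > 1\<close> then \<open>x ^ n / (1 + x ^ n)\<close> stays large at \<open>v\<close> and tends to \<open>1\<close> or \<open>0\<close> at
  the embeddings.  A minimal set of embeddings dominating \<open>v\<close> can therefore not contain two elements.\<close>

theorem archimedean_place_cases:
  assumes v: "v \<in> archimedean_places"
  shows "\<exists>i. v = place i"
proof -
  have av: "absolute_value v" and vq: "\<And>q. v (of_rat q) = \<bar>of_rat q\<bar>" using assms by (auto simp: archimedean_places_def)
  note V = absolute_value_simps[OF av]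
  let ?P = "\<lambda>S. \<forall>x. \<exists>i\<in>S. v x \<le> cmod (e i x)"
  have "?P UNIV" using archimedean_le_some_embedding[OF v] by simp
  from ex_has_least_nat[of ?P UNIV card, OF this]
  obtain S where S: "?P S" "\<forall>T. ?P T \<longrightarrow> card S \<le> card T" by (elim exE conjE)
  have sep: "\<exists>y. v y > 1 \<and> cmod (e i y) > 1 \<and> (\<forall>l\<in>S - {i}. cmod (e l y) < 1)" if i: "i \<in> S" for i
  proof -
    have "card (S - {i}) < card S" using i by (intro psubset_card_mono) auto
    have "\<not> ?P (S - {i})"
    proof
      assume "?P (S - {i})"
      then have "card S \<le> card (S - {i})" by (rule S(2)[THEN spec, THEN mp])
      then show False using \<open>card (S - {i}) < card S\<close> by simp
    qed
    then obtain x where x: "\<forall>l\<in>S - {i}. cmod (e l x) < v x" by (auto simp: not_le)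
    obtain l0 where "l0 \<in> S" "v x \<le> cmod (e l0 x)" using S(1) by blast
    then have big: "v x \<le> cmod (e i x)" using x by force
    show ?thesis
    proof (cases "x = 0")
      case True
      then have "S - {i} = {}" using x by (auto simp: e_simps V)
      then have "\<forall>l\<in>S - {i}. cmod (e l 2) < 1" by blast
      moreover have "v 2 = 2" using vq[of 2] by simp
      moreover have "cmod (e i 2) = 2" using e_simps(14)[of i 2] by simp
      ultimately show ?thesis by (intro exI[of _ 2]) simp
    next
      case False
      then have vx: "v x > 0" using V(3)[of x] V(4)[of x] by linarith
      define m where "m = Max (insert 0 ((\<lambda>l. cmod (e l x)) ` (S - {i})))"
      have m: "m < v x" unfolding m_def using x vx by (subst Max_less_iff) auto
      have mge: "0 \<le> m" "\<And>l. l \<in> S - {i} \<Longrightarrow> cmod (e l x) \<le> m" unfolding m_def by (auto intro!: Max_ge)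
      \<comment> \<open>Here \<open>m\<close> bounds \<open>x\<close> at the other embeddings in
        \<open>S\<close>. On rational numbers \<open>v\<close> and all embeddings give the usual
        absolute value, so division by a rational between \<open>m\<close> and \<open>v x\<close>
        brings the former below \<open>1\<close> and the latter above \<open>1\<close>.\<close>
      obtain q where q: "m < of_rat q" "of_rat q < v x" using of_rat_dense[OF m] by blast
      have q0: "real_of_rat q > 0" using q(1) mge(1) by linarith
      have nq: "cmod (of_rat q) = real_of_rat q" using q0 by (simp only: of_real_of_rat_complex[symmetric] norm_of_real)
      have ey: "cmod (e l (x / of_rat q)) = cmod (e l x) / of_rat q" for l by (simp add: e_simps norm_divide nq)
      have "v (x / of_rat q) > 1" using q q0 by (simp add: V vq)
      moreover have "cmod (e i (x / of_rat q)) > 1" unfolding ey using q q0 big by simp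
      moreover have "\<forall>l\<in>S - {i}. cmod (e l (x / of_rat q)) < 1" unfolding ey using q q0 mge(2) by force
      ultimately show ?thesis by (intro exI conjI)
    qed
  qed
  have "\<exists>i\<in>S. v 1 \<le> cmod (e i 1)" using S(1) by (rule spec)
  then obtain i where i: "i \<in> S" by (elim bexE)
  have Si: "S = {i}"
  proof (rule ccontr)
    assume "S \<noteq> {i}"
    then obtain j where j: "j \<in> S" "j \<noteq> i" using i by blast
    obtain x where x: "v x > 1" "cmod (e i x) > 1" "\<forall>l\<in>S - {i}. cmod (e l x) < 1" using sep[OF i] by (elim exE conjE)
    obtain y where y: "v y > 1" "cmod (e j y) > 1" "\<forall>l\<in>S - {j}. cmod (e l y) < 1" using sep[OF j(1)] by (elim exE conjE)
    have half: "v (power_ratio x n) \<ge> 1 / 2" if "v x > 1" "n > 0" for x and n :: nat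
    proof -
      have p: "v x ^ n > 1" using that by (simp add: one_less_power)
      have "1 + x ^ n \<noteq> 0"
      proof
        assume "1 + x ^ n = 0"
        then have "x ^ n = - 1" by (simp add: add_eq_0_iff)
        then have "v x ^ n = 1" using V(8)[of x n] V(7)[of 1] V(2) by simp
        then show False using p by simp
      qed
      then have pos: "v (1 + x ^ n) > 0" using V(3)[of "1 + x ^ n"] V(4)[of "1 + x ^ n"] by linarith
      have "v (1 + x ^ n) \<le> 1 + v x ^ n" using V(6)[of 1 "x ^ n"] by (simp add: V)
      then have "v (1 + x ^ n) \<le> 2 * v x ^ n" using p by linarith
      then show ?thesis using pos by (simp add: power_ratio_def V field_simps)
    qed
    \<comment> \<open>At each embedding in \<open>S\<close> one of the two ratios tends to
      \<open>0\<close> and the other converges, so the product tends to \<open>0\<close>, although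
      each ratio is at least \<open>1 / 2\<close> at \<open>v\<close>.\<close>
    have lims: "(\<lambda>n. e l (power_ratio x n * power_ratio y n)) \<longlonglongrightarrow> 0" if l: "l \<in> S" for l
    proof -
      have eq: "e l (power_ratio x n * power_ratio y n) = power_ratio (e l x) n * power_ratio (e l y) n" for n
        by (simp add: power_ratio_def e_simps)
      consider "l = i" | "l = j" | "l \<noteq> i" "l \<noteq> j" by blast
      then show ?thesis
      proof cases
        case 1
        then have "cmod (e l x) > 1" "cmod (e l y) < 1" using x y j i by auto
        then show ?thesis unfolding eq
          using tendsto_mult[OF power_ratio_tendsto_1[of "e l x"] power_ratio_tendsto_0[of "e l y"]] by simp
      next
        case 2
        then have "cmod (e l x) < 1" "cmod (e l y) > 1" using x y j i by auto
        then show ?thesis unfolding eq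
          using tendsto_mult[OF power_ratio_tendsto_0[of "e l x"] power_ratio_tendsto_1[of "e l y"]] by simp
      next
        case 3
        then have "cmod (e l x) < 1" "cmod (e l y) < 1" using x y l by auto
        then show ?thesis unfolding eq
          using tendsto_mult[OF power_ratio_tendsto_0[of "e l x"] power_ratio_tendsto_0[of "e l y"]] by simp
      qed
    qed
    have "(\<lambda>n. \<Sum>l\<in>S. cmod (e l (power_ratio x n * power_ratio y n))) \<longlonglongrightarrow> (\<Sum>l\<in>S. 0)"
      by (intro tendsto_sum tendsto_norm_zero lims)
    then have "(\<lambda>n. \<Sum>l\<in>S. cmod (e l (power_ratio x n * power_ratio y n))) \<longlonglongrightarrow> 0" by simp
    then have "\<forall>\<^sub>F n in sequentially. (\<Sum>l\<in>S. cmod (e l (power_ratio x n * power_ratio y n))) < 1 / 4"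
      by (rule order_tendstoD) simp
    from eventually_happens'[OF sequentially_bot eventually_conj[OF this eventually_gt_at_top[of 0]]]
    obtain n :: nat where n: "(\<Sum>l\<in>S. cmod (e l (power_ratio x n * power_ratio y n))) < 1 / 4" "n > 0"
      by (elim exE conjE)
    have "(1 / 2) * (1 / 2) \<le> v (power_ratio x n) * v (power_ratio y n)"
      by (intro mult_mono half x y n) (simp_all add: V)
    then have "1 / 4 \<le> v (power_ratio x n * power_ratio y n)" by (simp add: V)
    moreover have "\<exists>l\<in>S. v (power_ratio x n * power_ratio y n) \<le> cmod (e l (power_ratio x n * power_ratio y n))" using S(1) by (rule spec)
    then obtain l where l: "l \<in> S" "v (power_ratio x n * power_ratio y n) \<le> cmod (e l (power_ratio x n * power_ratio y n))" by (elim bexE)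
    moreover have "cmod (e l (power_ratio x n * power_ratio y n)) \<le> (\<Sum>l\<in>S. cmod (e l (power_ratio x n * power_ratio y n)))"
      by (rule member_le_sum[OF l(1)]) simp_all
    ultimately show False using n(1) by linarith
  qed
  have le: "v x \<le> cmod (e i x)" for x using S(1) by (simp add: Si)
  have "v x = cmod (e i x)" for x
  proof (cases "x = 0")
    case False
    \<comment> \<open>The inequality at \<open>inverse x\<close> is the reverse inequality at
      \<open>x\<close>.\<close>
    have "inverse (v x) \<le> inverse (cmod (e i x))" using le[of "inverse x"] by (simp add: V e_simps norm_inverse)
    moreover have "v x > 0" "cmod (e i x) > 0" using False V(3)[of x] V(4)[of x] by (auto simp: e_simps less_le)
    ultimately have "cmod (e i x) \<le> v x" by (simp add: inverse_le_iff_le)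
    then show ?thesis using le[of x] by simp
  qed (simp add: V e_simps)
  then show ?thesis unfolding place_def by blast
qed

lemma archimedean_places_eq: "archimedean_places = range place"
  using archimedean_place_cases place_archimedean by blast

text \<open>Limits of rational sequences fill exactly the real line. For a real embedding this is
  already the whole completion. Otherwise the rational combinations of \<open>1\<close> and an
  \<open>x0\<close> with nonreal image are dense in the complex numbers, which have dimension two
  over the reals.\<close>

lemma local_degree_place: "local_degree (place i) = (if conj_index i = i then 1 else 2)"
proof (cases "conj_index i = i")
  case True
  then have real: "e i x \<in> \<real>" for x using conj_index_eq_iff[of i] by auto
  then have im: "Im (e i x) = 0" for x by (simp add: complex_is_Real_iff)
  have re_rat: "Re (e i (of_rat q)) = of_rat q" for q
    by (simp only: e_simps of_real_of_rat_complex[symmetric] Re_complex_of_real)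
  have K: "\<exists>x. range x \<subseteq> \<rat> \<and> (\<lambda>n. Re (e i (x n))) \<longlonglongrightarrow> z" for z
  proof -
    obtain q :: "nat \<Rightarrow> rat" where "(\<lambda>n. of_rat (q n) :: real) \<longlonglongrightarrow> z" using rat_sequence[of z] by (elim exE)
    then show ?thesis by (intro exI[of _ "\<lambda>n. of_rat (q n)"]) (auto simp: re_rat)
  qed
  have "local_degree (place i) = 1"
  proof (rule local_degree_eq[where \<tau> = "\<lambda>x. Re (e i x)" and K = UNIV])
    show "place i x = norm (Re (e i x))" for x using real[of x] by (simp add: place_def in_Reals_norm)
    show "\<exists>x. (\<lambda>n. Re (e i (x n))) \<longlonglongrightarrow> z" for z using K[of z] by blast
    show "z \<in> UNIV \<longleftrightarrow> (\<exists>x. range x \<subseteq> \<rat> \<and> (\<lambda>n. Re (e i (x n))) \<longlonglongrightarrow> z)" for z using K[of z] by simp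
  qed (simp_all add: e_simps im subfield_UNIV_real dimension_real[unfolded One_nat_def])
  then show ?thesis using True by simp
next
  case False
  then obtain x0 where "e i x0 \<notin> \<real>" using conj_index_eq_iff[of i] by auto
  then have im0: "Im (e i x0) \<noteq> 0" by (simp add: complex_is_Real_iff)
  have rat_lim: "\<exists>q :: nat \<Rightarrow> rat. (\<lambda>n. of_rat (q n) :: complex) \<longlonglongrightarrow> of_real a" for a
  proof -
    obtain q :: "nat \<Rightarrow> rat" where "(\<lambda>n. of_rat (q n) :: real) \<longlonglongrightarrow> a" using rat_sequence[of a] by (elim exE)
    then have "(\<lambda>n. of_real (of_rat (q n)) :: complex) \<longlonglongrightarrow> of_real a" by (rule tendsto_of_real)
    then show ?thesis by (intro exI[of _ q]) (simp only: of_real_of_rat_complex)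
  qed
  have "local_degree (place i) = 2"
  proof (rule local_degree_eq[where \<tau> = "e i" and K = "\<real>"])
    show "place i x = norm (e i x)" for x by (simp add: place_def)
    show "\<exists>x. (\<lambda>n. e i (x n)) \<longlonglongrightarrow> z" for z
    proof -
      define c where "c = Im z / Im (e i x0)"
      define a where "a = Re z - c * Re (e i x0)"
      have z: "z = of_real a + of_real c * e i x0" using im0 by (simp add: complex_eq_iff a_def c_def)
      obtain q :: "nat \<Rightarrow> rat" where q: "(\<lambda>n. of_rat (q n) :: complex) \<longlonglongrightarrow> of_real a"
        using rat_lim[of a] by (elim exE)
      obtain p :: "nat \<Rightarrow> rat" where p: "(\<lambda>n. of_rat (p n) :: complex) \<longlonglongrightarrow> of_real c"
        using rat_lim[of c] by (elim exE)
      have "(\<lambda>n. of_rat (q n) + of_rat (p n) * e i x0) \<longlonglongrightarrow> z"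
        unfolding z by (intro tendsto_add tendsto_mult tendsto_const q p)
      then show ?thesis by (intro exI[of _ "\<lambda>n. of_rat (q n) + of_rat (p n) * x0"]) (simp add: e_simps)
    qed
    show "z \<in> \<real> \<longleftrightarrow> (\<exists>x. range x \<subseteq> \<rat> \<and> (\<lambda>n. e i (x n)) \<longlonglongrightarrow> z)" for z
    proof
      assume "z \<in> \<real>"
      then obtain a where a: "z = of_real a" by (auto simp: Reals_def)
      obtain q :: "nat \<Rightarrow> rat" where "(\<lambda>n. of_rat (q n) :: complex) \<longlonglongrightarrow> z"
        unfolding a using rat_lim[of a] by (elim exE)
      then show "\<exists>x. range x \<subseteq> \<rat> \<and> (\<lambda>n. e i (x n)) \<longlonglongrightarrow> z"
        by (intro exI[of _ "\<lambda>n. of_rat (q n)"]) (auto simp: e_simps)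
    next
      assume "\<exists>x. range x \<subseteq> \<rat> \<and> (\<lambda>n. e i (x n)) \<longlonglongrightarrow> z"
      then obtain x where x: "range x \<subseteq> \<rat>" "(\<lambda>n. e i (x n)) \<longlonglongrightarrow> z"
        by (elim exE conjE)
      have "e i (x n) \<in> \<real>" for n
      proof -
        have "x n \<in> \<rat>" using x(1) by blast
        then obtain q where "x n = of_rat q" by (auto simp: Rats_def)
        then have "e i (x n) = of_real (of_rat q)" by (simp only: e_simps of_real_of_rat_complex)
        then show ?thesis by simp
      qed
      then show "z \<in> \<real>" by (rule closed_sequentially[OF closed_complex_Reals _ x(2)])
    qed
  qed (simp_all add: e_simps subfield_Reals dimension_complex)
  then show ?thesis using False by simp
qed

section \<open>Heights and complex places in terms of embeddings\<close>

lemma place_fiber: "{j. place j = place i} = {i, conj_index i}"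
  by (auto simp: eq_commute[of "place _" "place i"] place_eq_iff)

lemma card_place_fiber: "card {j. place j = place i} = local_degree (place i)"
  unfolding place_fiber local_degree_place by (simp add: card_insert_if)

text \<open>The nonarchimedean factors of an algebraic integer are \<open>1\<close>. The number of
  embeddings that induce an archimedean place is its local degree, so the local exponents disappear
  when the product is taken over embeddings.\<close>

theorem weil_height_algebraic_int:
  assumes "algebraic_int x"
  shows "weil_height x = (\<Prod>i\<in>UNIV. max 1 (cmod (e i x))) powr (1 / real (field_degree TYPE('a)))"
proof -
  let ?d = "real (field_degree TYPE('a))"
  have d: "?d > 0" using field_degree_pos[OF nf] by simp
  have fin: "finite (archimedean_places :: ('a \<Rightarrow> real) set)" by (simp add: archimedean_places_eq)
  have nonarch: "max 1 (normalized_abs v x) = 1" if "v \<in> nonarchimedean_places" for v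
  proof -
    have av: "absolute_value v" using that by (auto simp: nonarchimedean_places_def)
    have "v x powr (real (local_degree v) / ?d) \<le> 1"
      using nonarchimedean_algebraic_int_le_1[OF that assms] absolute_value_simps(3)[OF av, of x] by (intro powr_le1) simp_all
    then show ?thesis by (simp add: normalized_abs_def max_def)
  qed
  have arch: "max 1 (normalized_abs v x) = ((max 1 (v x)) ^ local_degree v) powr (1 / ?d)" if "v \<in> archimedean_places" for v
  proof -
    have v0: "v x \<ge> 0" using that absolute_value_simps(3) by (auto simp: archimedean_places_def)
    show ?thesis
    proof (cases "v x \<le> 1")
      case True
      then have "v x powr (real (local_degree v) / ?d) \<le> 1" using v0 by (intro powr_le1) simp_all
      then show ?thesis using True by (simp add: normalized_abs_def max_def)
    next
      case False
      then have "v x powr (real (local_degree v) / ?d) \<ge> 1" by (intro ge_one_powr_ge_zero) simp_all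
      moreover have "(v x ^ local_degree v) powr (1 / ?d) = v x powr (real (local_degree v) / ?d)"
        using False by (simp add: powr_realpow[symmetric] powr_powr)
      ultimately show ?thesis using False by (simp add: normalized_abs_def max_def)
    qed
  qed
  have "weil_height x = (\<Prod>v\<in>archimedean_places. max 1 (normalized_abs v x))"
    unfolding weil_height_def
  proof (rule prod.mono_neutral_cong_left[OF fin])
    show "{v \<in> places. max 1 (normalized_abs v x) \<noteq> 1} \<subseteq> archimedean_places"
      using nonarch by (auto simp: places_def)
    show "\<forall>v\<in>archimedean_places - {v \<in> places. max 1 (normalized_abs v x) \<noteq> 1}. max 1 (normalized_abs v x) = 1"
      by (auto simp: places_def)
  qed simp
  also have "\<dots> = (\<Prod>v\<in>archimedean_places. ((max 1 (v x)) ^ local_degree v) powr (1 / ?d))"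
    by (rule prod.cong[OF refl]) (rule arch)
  also have "\<dots> = (\<Prod>v\<in>archimedean_places. (max 1 (v x)) ^ local_degree v) powr (1 / ?d)"
    by (subst prod_powr_distrib) simp_all
  also have "(\<Prod>v\<in>archimedean_places. (max 1 (v x)) ^ local_degree v) = (\<Prod>i\<in>UNIV. max 1 (cmod (e i x)))"
  proof -
    have "(\<Prod>i\<in>UNIV. max 1 (cmod (e i x))) = (\<Prod>v\<in>range place. \<Prod>i\<in>{i\<in>UNIV. place i = v}. max 1 (cmod (e i x)))"
      by (rule prod.image_gen) simp
    also have "\<dots> = (\<Prod>v\<in>range place. (max 1 (v x)) ^ local_degree v)"
    proof (rule prod.cong[OF refl])
      fix v assume "v \<in> range place"
      then obtain i where i: "v = place i" by blast
      have "(\<Prod>i\<in>{i\<in>UNIV. place i = v}. max 1 (cmod (e i x))) = (\<Prod>i\<in>{i\<in>UNIV. place i = v}. max 1 (v x))"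
        by (rule prod.cong[OF refl]) (auto simp: place_def)
      also have "\<dots> = (max 1 (v x)) ^ local_degree v" using card_place_fiber[of i] by (simp add: i)
      finally show "(\<Prod>i\<in>{i\<in>UNIV. place i = v}. max 1 (cmod (e i x))) = (max 1 (v x)) ^ local_degree v" .
    qed
    finally show ?thesis by (simp add: archimedean_places_eq)
  qed
  finally show ?thesis .
qed

lemma complex_places_eq: "complex_places = place ` {i. conj_index i \<noteq> i}"
proof (intro equalityI subsetI)
  fix v assume "v \<in> (complex_places :: ('a \<Rightarrow> real) set)"
  then obtain \<sigma> where s: "\<sigma> \<in> embeddings UNIV" "\<not> range \<sigma> \<subseteq> \<real>" "v = (\<lambda>x. cmod (\<sigma> x))"
    unfolding complex_places_def by (elim CollectE conjE bexE) ((rule that; assumption)?)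
  obtain i where i: "\<sigma> = e i" using e_surj[OF s(1)] by (elim exE)
  then show "v \<in> place ` {i. conj_index i \<noteq> i}"
    using s(2,3) conj_index_eq_iff[of i] by (intro image_eqI[of _ _ i]) (simp_all add: place_def)
next
  fix v assume "v \<in> place ` {i. conj_index i \<noteq> i}"
  then obtain i where i: "conj_index i \<noteq> i" "v = place i" by blast
  then show "v \<in> complex_places"
    unfolding complex_places_def using place_archimedean[of i] conj_index_eq_iff[of i] e_emb[of i]
    by (intro CollectI conjI bexI[of _ "e i"]) (simp_all add: place_def)
qed

text \<open>A nonreal embedding and its conjugate induce the same place, and no other embedding
  does.\<close>

lemma card_complex_places: "2 * card (complex_places :: ('a \<Rightarrow> real) set) = card {i. conj_index i \<noteq> i}"
proof -
  let ?A = "{i. conj_index i \<noteq> i}"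
  have "card ?A = (\<Sum>i\<in>?A. 1)" by simp
  also have "\<dots> = (\<Sum>v\<in>place ` ?A. \<Sum>i\<in>{i\<in>?A. place i = v}. 1)" by (rule sum.image_gen) simp
  also have "\<dots> = (\<Sum>v\<in>place ` ?A. 2)"
  proof (rule sum.cong[OF refl])
    fix v assume "v \<in> place ` ?A"
    then obtain i where i: "conj_index i \<noteq> i" "v = place i" by blast
    have "{j\<in>?A. place j = v} = {i, conj_index i}"
      using place_fiber[of i] i by (auto simp: conj_index_conj_index)
    then show "(\<Sum>i\<in>{i\<in>?A. place i = v}. 1) = (2::nat)" using i(1) by simp
  qed
  finally show ?thesis unfolding complex_places_eq by simp
qed

end

section \<open>Integers dominated by one embedding\<close>

lemma algebraic_over_subfield:
  assumes "number_field TYPE('a::field_char_0)" "class_subfield (F :: 'a set)"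
  shows "(ring.algebraic class_ring over F) x"
proof -
  have fd: "ring.finite_dimension (class_ring :: 'a ring) \<rat> UNIV" using assms(1) by (simp add: number_field_def)
  have "(ring.algebraic class_ring over \<rat>) x"
    by (rule ring.finite_dimension_imp_algebraic[OF ring_class_ring subfield_Rats subfieldE(1)[OF subfield_UNIV] fd UNIV_I])
  then show ?thesis
    using ring.algebraic_mono[OF ring_class_ring subfield_Rats_subset[OF assms(2)]] by simp
qed

lemma weil_height_nonneg: "weil_height x \<ge> 0"
  unfolding weil_height_def by (intro prod_nonneg) simp

text \<open>Heights are bounded below by \<open>0\<close> and a supposed generator lies in the set,
  so the infimum is a genuine lower bound in this situation.\<close>

lemma not_generator_if_small_height:
  assumes "algebraic_int (\<beta> :: 'a::field_char_0)"
    "weil_height \<beta> < Inf {weil_height \<alpha> | \<alpha>::'a. \<alpha> \<in> ring_of_integers \<and> adjoin_to_Rats \<alpha> = UNIV}"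
  shows "adjoin_to_Rats \<beta> \<noteq> UNIV"
proof
  assume "adjoin_to_Rats \<beta> = UNIV"
  then have "weil_height \<beta> \<in> {weil_height \<alpha> | \<alpha>::'a. \<alpha> \<in> ring_of_integers \<and> adjoin_to_Rats \<alpha> = UNIV}"
    using assms(1) by (auto simp: ring_of_integers_def)
  then have "Inf {weil_height \<alpha> | \<alpha>::'a. \<alpha> \<in> ring_of_integers \<and> adjoin_to_Rats \<alpha> = UNIV} \<le> weil_height \<beta>"
    by (rule cInf_lower) (auto intro!: bdd_belowI[of _ 0] simp: weil_height_nonneg)
  then show False using assms(2) by simp
qed

context embedding_enum
begin

lemma cmod_e_conj_index: "cmod (e (conj_index i) x) = cmod (e i x)"
  by (simp add: e_conj_index)

text \<open>The norm is at least \<open>1\<close> although every factor away from \<open>i\<close>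
  and its conjugate is below \<open>1\<close>, so the remaining one or two equal factors must make
  up for it. They are then the only ones that enter the height, and the exponent is \<open>1\<close>
  or \<open>2\<close> according to whether the embedding is real.\<close>

lemma dominant_ge_1:
  assumes \<beta>: "algebraic_int \<beta>" "\<beta> \<noteq> 0" and off: "\<forall>j\<in>- {i, conj_index i}. cmod (e j \<beta>) < 1"
  shows "cmod (e i \<beta>) \<ge> 1"
    and "(\<Prod>j\<in>UNIV. max 1 (cmod (e j \<beta>))) = cmod (e i \<beta>) ^ card {i, conj_index i}"
proof -
  let ?F = "{i, conj_index i}"
  have on: "cmod (e j \<beta>) = cmod (e i \<beta>)" if "j \<in> ?F" for j using that by (auto simp: cmod_e_conj_index)
  have split: "(\<Prod>j\<in>UNIV. f j) = (\<Prod>j\<in>?F. f j) * (\<Prod>j\<in>- ?F. f j)" for f :: "'a deg_index \<Rightarrow> real"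
    using prod.union_disjoint[of ?F "- ?F" f] by (simp only: Compl_partition finite Compl_disjoint)
  have "1 \<le> (\<Prod>j\<in>?F. cmod (e j \<beta>)) * (\<Prod>j\<in>- ?F. cmod (e j \<beta>))"
    using norm_prod_ge_1[OF \<beta>] split by simp
  also have "\<dots> \<le> (\<Prod>j\<in>?F. cmod (e j \<beta>)) * 1"
    by (intro mult_left_mono prod_le_1 prod_nonneg) (use off in \<open>auto intro: less_imp_le\<close>)
  also have "(\<Prod>j\<in>?F. cmod (e j \<beta>)) = (\<Prod>j\<in>?F. cmod (e i \<beta>))" by (rule prod.cong[OF refl on])
  finally have "1 \<le> cmod (e i \<beta>) ^ card ?F" by simp
  then show ge: "cmod (e i \<beta>) \<ge> 1"
  proof (rule contrapos_pp)
    assume "\<not> cmod (e i \<beta>) \<ge> 1"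
    moreover from this have "cmod (e i \<beta>) ^ card ?F \<le> cmod (e i \<beta>) ^ 1"
      by (intro power_decreasing) (simp_all add: Suc_le_eq card_gt_0_iff)
    ultimately show "\<not> 1 \<le> cmod (e i \<beta>) ^ card ?F" by simp
  qed
  have "(\<Prod>j\<in>- ?F. max 1 (cmod (e j \<beta>))) = (\<Prod>j\<in>- ?F. 1)"
  proof (rule prod.cong[OF refl])
    fix j assume "j \<in> - ?F"
    then have "cmod (e j \<beta>) < 1" by (rule bspec[OF off])
    then show "max 1 (cmod (e j \<beta>)) = 1" by simp
  qed
  moreover have "(\<Prod>j\<in>?F. max 1 (cmod (e j \<beta>))) = (\<Prod>j\<in>?F. cmod (e i \<beta>))"
  proof (rule prod.cong[OF refl])
    fix j assume "j \<in> ?F"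
    then have "cmod (e j \<beta>) = cmod (e i \<beta>)" by (rule on)
    then show "max 1 (cmod (e j \<beta>)) = cmod (e i \<beta>)" using ge by simp
  qed
  ultimately show "(\<Prod>j\<in>UNIV. max 1 (cmod (e j \<beta>))) = cmod (e i \<beta>) ^ card ?F" using split by simp
qed

lemma non_generator_real:
  assumes \<beta>: "algebraic_int \<beta>" "\<beta> \<noteq> 0" and off: "\<forall>j\<in>- {i, conj_index i}. cmod (e j \<beta>) < 1"
    and ng: "adjoin_to_Rats \<beta> \<noteq> UNIV"
  shows "conj_index i \<noteq> i" "e i \<beta> \<in> \<real>"
proof -
  have "\<exists>j. e j \<beta> = e i \<beta> \<and> j \<noteq> i"
  proof (rule ccontr)
    assume *: "\<not> ?thesis"
    have "adjoin_to_Rats \<beta> = UNIV"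
    proof (rule generator_criterion[OF nf e_emb[of i]])
      fix \<tau> assume "\<tau> \<in> embeddings UNIV" and t: "\<tau> \<beta> = e i \<beta>"
      then obtain j where j: "\<tau> = e j" using e_surj[of \<tau>] by auto
      then have "j = i" using * t by blast
      then show "\<tau> = e i" using j by simp
    qed
    then show False using ng by simp
  qed
  then obtain j where t: "e j \<beta> = e i \<beta>" and "j \<noteq> i" by (elim exE conjE)
  note \<open>j \<noteq> i\<close>
  moreover have "j = conj_index i"
  proof (rule ccontr)
    assume "j \<noteq> conj_index i"
    then have "cmod (e j \<beta>) < 1" using off \<open>j \<noteq> i\<close> by simp
    moreover have "cmod (e i \<beta>) \<ge> 1" by (rule dominant_ge_1(1)[OF \<beta> off])
    ultimately show False using t by simp
  qed
  ultimately show "conj_index i \<noteq> i" by simp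
  have "cnj (e i \<beta>) = e i \<beta>" using t \<open>j = conj_index i\<close> by (simp add: e_conj_index)
  then show "e i \<beta> \<in> \<real>" by (simp add: Reals_cnj_iff)
qed

text \<open>The two indices of a complex place contribute \<open>2 * pi\<close>, that is
  \<open>2 ^ 2 * (pi / 2)\<close>. The surplus \<open>pi / 2\<close> per complex place is the origin
  of the factor \<open>2 / pi\<close> in \<open>field_constant\<close>.\<close>

lemma prod_disc_weight:
  "(\<Prod>i\<in>UNIV. disc_weight i) = 2 ^ CARD('a deg_index) * (pi / 2) ^ card (complex_places :: ('a \<Rightarrow> real) set)"
proof -
  let ?A = "{i. conj_index i \<noteq> i}" and ?s = "card (complex_places :: ('a \<Rightarrow> real) set)"
  have "(\<Prod>i\<in>UNIV. disc_weight i) = (\<Prod>i\<in>?A. disc_weight i) * (\<Prod>i\<in>- ?A. disc_weight i)"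
    using prod.union_disjoint[of ?A "- ?A" disc_weight] by (simp only: Compl_partition finite Compl_disjoint)
  also have "(\<Prod>i\<in>?A. disc_weight i) = (\<Prod>i\<in>?A. sqrt (2 * pi))" by (rule prod.cong) (auto simp: disc_weight_def)
  also have "\<dots> = sqrt (2 * pi) ^ (2 * ?s)" using card_complex_places by simp
  also have "\<dots> = (2 * pi) ^ ?s" by (simp add: power_mult)
  also have "(\<Prod>i\<in>- ?A. disc_weight i) = (\<Prod>i\<in>- ?A. 2)" by (rule prod.cong) (auto simp: disc_weight_def)
  also have "\<dots> = 2 ^ card (- ?A)" by simp
  finally have *: "(\<Prod>i\<in>UNIV. disc_weight i) = (2 * pi) ^ ?s * 2 ^ card (- ?A)" .
  have "CARD('a deg_index) = card ?A + card (- ?A)"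
    using card_Un_disjoint[of ?A "- ?A"] by (simp only: Compl_partition finite Compl_disjoint)
  also have "card ?A = 2 * ?s" using card_complex_places by simp
  finally have "(2::real) ^ CARD('a deg_index) * (pi / 2) ^ ?s = (2 ^ 2 * (pi / 2)) ^ ?s * 2 ^ card (- ?A)"
    by (simp only: power_add power_mult[of 2 2] power_mult_distrib) (simp only: mult_ac)
  then show ?thesis unfolding * by simp
qed

text \<open>Minkowski's theorem for radii below the inverse size of \<open>\<mu>\<close> away from the \<open>i\<close>-th embedding and
  its conjugate.\<close>

lemma exists_small_element:
  fixes \<H> :: real
  assumes hyp: "\<H> * field_constant TYPE('a) < I"
    and \<mu>: "algebraic_int \<mu>" "\<mu> \<noteq> 0" "weil_height \<mu> \<le> \<H>"
  obtains \<alpha> where "algebraic_int \<alpha>" "\<alpha> \<noteq> 0"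
    "\<forall>j\<in>- {i, conj_index i}. cmod (e j \<alpha>) < 1"
    "\<forall>j\<in>- {i, conj_index i}. cmod (e j (\<mu> * \<alpha>)) < 1"
    "weil_height \<alpha> < I" "weil_height (\<mu> * \<alpha>) < I"
proof -
  let ?F = "{i, conj_index i}" and ?d = "real (field_degree TYPE('a))"
  let ?s = "card (complex_places :: ('a \<Rightarrow> real) set)"
  let ?m = "\<lambda>j. max 1 (cmod (e j \<mu>))" and ?k = "card {i, conj_index i}"
  obtain b where b: "int_basis b" using exists_int_basis by (elim exE)
  have d: "?d > 0" using field_degree_pos[OF nf] by simp
  define \<Delta> where "\<Delta> = \<bar>real_of_int (discriminant TYPE('a))\<bar>"
  have dM: "cmod (det (M b)) = sqrt \<Delta>"
  proof -
    have "(cmod (det (M b)))\<^sup>2 = cmod (of_int (discriminant TYPE('a)))"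
      unfolding discriminant_eq[OF b] by (simp add: norm_power)
    then have "(cmod (det (M b)))\<^sup>2 = \<Delta>" by (simp add: \<Delta>_def)
    then show ?thesis using real_sqrt_unique[of "cmod (det (M b))" \<Delta>] by simp
  qed
  have "det (M b) \<noteq> 0" using b det_M_nz_iff by (simp add: int_basis_def)
  then have "sqrt \<Delta> > 0" unfolding dM[symmetric] by simp
  then have \<Delta>: "\<Delta> > 0" by simp
  \<comment> \<open>The value that the product of all radii has to exceed in
    \<open>minkowski_embedding\<close>, and at the same time the power of
    \<open>field_constant\<close> with the degree as exponent.\<close>
  define B where "B = (2 / pi) ^ ?s * sqrt \<Delta>"
  have B0: "B > 0" unfolding B_def using \<Delta> by simp
  have fc: "field_constant TYPE('a) = B powr (1 / ?d)"
  proof -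
    have "((2 / pi) ^ ?s) powr (1 / ?d) = (2 / pi) powr (real ?s / ?d)"
      by (simp add: powr_realpow[symmetric] powr_powr)
    moreover have "sqrt \<Delta> powr (1 / ?d) = \<Delta> powr (1 / (2 * ?d))"
      using \<Delta> by (simp add: powr_half_sqrt[symmetric] powr_powr)
    ultimately show ?thesis unfolding field_constant_def B_def \<Delta>_def[symmetric]
      by (simp add: powr_mult \<Delta>_def)
  qed
  define Hm where "Hm = (\<Prod>j\<in>UNIV. ?m j)"
  have Hm1: "Hm \<ge> 1" unfolding Hm_def by (rule prod_ge_1) simp
  have "(Hm * B) powr (1 / ?d) = weil_height \<mu> * field_constant TYPE('a)"
    unfolding weil_height_algebraic_int[OF \<mu>(1)] fc Hm_def[symmetric] by (rule powr_mult)
  also have "\<dots> \<le> \<H> * field_constant TYPE('a)" by (rule mult_right_mono[OF \<mu>(3)]) (simp add: fc)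
  finally have lt: "(Hm * B) powr (1 / ?d) < I" using hyp by simp
  then have I0: "I > 0" using powr_ge_zero[of "Hm * B" "1 / ?d"] by linarith
  have "((Hm * B) powr (1 / ?d)) powr ?d < I powr ?d" by (rule powr_less_mono2[OF d _ lt]) simp
  then have HB: "Hm * B < I powr ?d" using d Hm1 B0 by (simp add: powr_powr)
  \<comment> \<open>The midpoint of the interval that the strict hypothesis leaves open: above
    \<open>B\<close> for Minkowski's theorem, and below \<open>I powr ?d / Hm\<close> for the
    heights.\<close>
  define P where "P = (B + I powr ?d / Hm) / 2"
  have BP: "B < P" unfolding P_def using HB Hm1 by (simp add: field_simps)
  have HP: "Hm * P < I powr ?d"
  proof -
    have "Hm * P = (Hm * B + I powr ?d) / 2" unfolding P_def using Hm1 by (simp add: field_simps)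
    then show ?thesis using HB by simp
  qed
  have P0: "P > 0" using BP B0 by simp
  have small: "weil_height \<beta> < I" if "algebraic_int \<beta>" "(\<Prod>j\<in>UNIV. max 1 (cmod (e j \<beta>))) \<le> Hm * P" for \<beta>
  proof -
    have "weil_height \<beta> \<le> (Hm * P) powr (1 / ?d)"
      unfolding weil_height_algebraic_int[OF that(1)]
      by (rule powr_mono2[OF _ _ that(2)]) (simp_all add: prod_nonneg)
    also have "\<dots> < (I powr ?d) powr (1 / ?d)" by (rule powr_less_mono2) (use HP Hm1 P0 d in simp_all)
    also have "\<dots> = I" using d I0 by (simp add: powr_powr)
    finally show ?thesis .
  qed
  have split: "(\<Prod>j\<in>UNIV. f j) = (\<Prod>j\<in>?F. f j) * (\<Prod>j\<in>- ?F. f j)" for f :: "'a deg_index \<Rightarrow> real"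
    using prod.union_disjoint[of ?F "- ?F" f] by (simp only: Compl_partition finite Compl_disjoint)
  define Q where "Q = (\<Prod>j\<in>- ?F. ?m j)"
  have Q1: "Q \<ge> 1" unfolding Q_def by (rule prod_ge_1) simp
  have k: "?k > 0" by (simp add: card_gt_0_iff)
  have HmQ: "Hm = ?m i ^ ?k * Q"
  proof -
    have "(\<Prod>j\<in>?F. ?m j) = (\<Prod>j\<in>?F. ?m i)" by (rule prod.cong) (auto simp: cmod_e_conj_index)
    then show ?thesis unfolding Hm_def Q_def split by simp
  qed
  \<comment> \<open>The radii \<open>1 / ?m j\<close> away from \<open>i\<close> and its conjugate
    multiply to \<open>1 / Q\<close>; the common radius \<open>R\<close> at these two makes the
    product of all radii equal to \<open>P\<close>.\<close>
  define R where "R = root ?k (P * Q)"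
  have R0: "R > 0" unfolding R_def using k P0 Q1 by (simp add: real_root_gt_zero)
  have Rk: "R ^ ?k = P * Q" unfolding R_def using k P0 Q1 by (intro real_root_pow_pos2) simp_all
  define r where "r j = (if j \<in> ?F then R else 1 / ?m j)" for j
  have rpos: "r j > 0" for j using R0 by (simp add: r_def less_max_iff_disj)
  have rc: "r (conj_index j) = r j" for j
  proof -
    have "conj_index j \<in> ?F \<longleftrightarrow> j \<in> ?F" by (metis conj_index_conj_index insert_iff singletonD)
    then show ?thesis unfolding r_def by (simp only: cmod_e_conj_index)
  qed
  have "(\<Prod>j\<in>?F. r j) = (\<Prod>j\<in>?F. R)" by (rule prod.cong[OF refl]) (simp add: r_def)
  moreover have "(\<Prod>j\<in>- ?F. r j) = (\<Prod>j\<in>- ?F. 1 / ?m j)" by (rule prod.cong[OF refl]) (simp add: r_def)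
  moreover have "(\<Prod>j\<in>- ?F. 1 / ?m j) = 1 / Q" unfolding Q_def by (simp add: prod_dividef)
  ultimately have prod_r: "(\<Prod>j\<in>UNIV. r j) = P"
    unfolding split using Rk Q1 by simp
  have vol: "(\<Prod>j\<in>UNIV. disc_weight j * r j) > 2 ^ CARD('a deg_index) * cmod (det (M b))"
  proof -
    have "(pi / 2) ^ ?s * B < (pi / 2) ^ ?s * P" using BP by simp
    moreover have "(pi / 2) ^ ?s * B = sqrt \<Delta>" unfolding B_def by (simp add: mult.assoc[symmetric] power_mult_distrib[symmetric])
    ultimately have "sqrt \<Delta> < (pi / 2) ^ ?s * P" by simp
    then have "2 ^ CARD('a deg_index) * sqrt \<Delta> < 2 ^ CARD('a deg_index) * ((pi / 2) ^ ?s * P)" by simp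
    then show ?thesis unfolding prod.distrib prod_disc_weight prod_r dM by (simp only: mult.assoc)
  qed
  obtain \<alpha> where \<alpha>: "\<alpha> \<noteq> 0" "algebraic_int \<alpha>" "\<forall>j. cmod (e j \<alpha>) < r j"
    using minkowski_embedding[OF b rpos rc vol] by (elim exE conjE)
  have off1: "\<forall>j\<in>- ?F. cmod (e j \<alpha>) < 1"
  proof
    fix j assume j: "j \<in> - ?F"
    have "cmod (e j \<alpha>) < 1 / ?m j" using \<alpha>(3)[THEN spec, of j] j by (simp add: r_def)
    also have "\<dots> \<le> 1" by simp
    finally show "cmod (e j \<alpha>) < 1" .
  qed
  have off2: "\<forall>j\<in>- ?F. cmod (e j (\<mu> * \<alpha>)) < 1"
  proof
    fix j assume j: "j \<in> - ?F"
    have m0: "cmod (e j \<mu>) > 0" using \<mu>(2) by (simp add: e_simps)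
    have "cmod (e j \<alpha>) < 1 / ?m j" using \<alpha>(3)[THEN spec, of j] j by (simp add: r_def)
    then have "cmod (e j \<mu>) * cmod (e j \<alpha>) < cmod (e j \<mu>) * (1 / ?m j)" using m0 by (rule mult_strict_left_mono)
    also have "\<dots> \<le> 1" by simp
    finally show "cmod (e j (\<mu> * \<alpha>)) < 1" by (simp add: e_simps norm_mult)
  qed
  have Ri: "cmod (e i \<alpha>) < R" using \<alpha>(3)[THEN spec, of i] by (simp add: r_def)
  \<comment> \<open>\<open>R * ?m i\<close> bounds the product of \<mu> and \<alpha> at
    \<open>i\<close>, and also \<alpha> itself because \<open>?m i\<close> is at least
    \<open>1\<close>; so both heights are controlled by the same number.\<close>
  have Rm: "(R * ?m i) ^ ?k = Hm * P" unfolding HmQ power_mult_distrib Rk by (simp only: mult_ac)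
  have a\<mu>: "algebraic_int (\<mu> * \<alpha>)" "\<mu> * \<alpha> \<noteq> 0" using \<mu> \<alpha> by (simp_all add: algebraic_int_add_mult)
  have "cmod (e i \<alpha>) \<le> R * 1" using Ri by simp
  also have "\<dots> \<le> R * ?m i" using R0 by (intro mult_left_mono) simp_all
  finally have "cmod (e i \<alpha>) ^ ?k \<le> Hm * P" unfolding Rm[symmetric] by (rule power_mono) simp
  then have h1: "weil_height \<alpha> < I" by (intro small[OF \<alpha>(2)]) (simp only: dominant_ge_1(2)[OF \<alpha>(2,1) off1])
  have "cmod (e i (\<mu> * \<alpha>)) \<le> R * ?m i"
    unfolding e_simps norm_mult mult.commute[of "cmod (e i \<mu>)"] using Ri R0 by (intro mult_mono) simp_all
  then have "cmod (e i (\<mu> * \<alpha>)) ^ ?k \<le> Hm * P" unfolding Rm[symmetric] by (rule power_mono) simp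
  then have h2: "weil_height (\<mu> * \<alpha>) < I" by (intro small[OF a\<mu>(1)]) (simp only: dominant_ge_1(2)[OF a\<mu> off2])
  show ?thesis by (rule that[OF \<alpha>(2,1) off1 off2 h1 h2])
qed

text \<open>Complex conjugation at the \<open>i\<close>-th embedding is induced by an automorphism as soon as only the
  \<open>i\<close>-th embedding and its conjugate extend the restriction of the \<open>i\<close>-th embedding to a subfield with
  real image.\<close>

lemma conj_in_range:
  assumes \<alpha>: "e i \<alpha> \<in> \<real>" and only: "\<forall>j. e j \<alpha> = e i \<alpha> \<longrightarrow> j = i \<or> j = conj_index i"
  shows "\<exists>z. e i z = cnj (e i x)"
proof -
  let ?L = "adjoin_to_Rats \<alpha>"
  note L = adjoin_to_Rats_subfield(1)[of \<alpha>]
  have "class_subfield {y. e i y \<in> \<real>}" by (simp add: subfield_class_ring_iff e_simps)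
  then have "?L \<subseteq> {y. e i y \<in> \<real>}" by (rule adjoin_to_Rats_least) (simp add: \<alpha>)
  then have real: "cnj (e i y) = e i y" if "y \<in> ?L" for y using that by (auto simp: Reals_cnj_iff)
  have "\<forall>\<tau>\<in>embeddings UNIV. (\<forall>y\<in>?L. \<tau> y = e i y) \<longrightarrow> \<tau> x = e i x \<or> \<tau> x = cnj (e i x)"
  proof (intro ballI impI)
    fix \<tau> assume t: "\<tau> \<in> embeddings UNIV" "\<forall>y\<in>?L. \<tau> y = e i y"
    obtain j where j: "\<tau> = e j" using e_surj[OF t(1)] by (elim exE)
    have "e j \<alpha> = e i \<alpha>" using bspec[OF t(2) adjoin_to_Rats_subfield(2)] j by simp
    then have "j = i \<or> j = conj_index i" by (rule only[THEN spec, THEN mp])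
    then show "\<tau> x = e i x \<or> \<tau> x = cnj (e i x)" using j by (auto simp: e_conj_index)
  qed
  from two_conjugates_trace[OF nf L e_emb this] obtain p q :: nat and y
    where pq: "p + q > 0" "y \<in> ?L" "of_nat p * e i x + of_nat q * cnj (e i x) = e i y"
      "(\<exists>\<tau>\<in>embeddings UNIV. (\<forall>y\<in>?L. \<tau> y = e i y) \<and> \<tau> x = cnj (e i x)) \<longrightarrow> q > 0" by (elim exE conjE)
  \<comment> \<open>The image of \<open>?L\<close> is real, so the conjugate embedding also extends
    the restriction of the \<open>i\<close>-th one. This forces \<open>q > 0\<close>, and the trace
    relation can be solved for the conjugate of \<open>e i x\<close>.\<close>
  have "\<exists>\<tau>\<in>embeddings UNIV. (\<forall>y\<in>?L. \<tau> y = e i y) \<and> \<tau> x = cnj (e i x)"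
    by (rule bexI[OF _ e_emb[of "conj_index i"]]) (simp add: e_conj_index real)
  then have q: "q > 0" using pq(4) by simp
  have "e i ((y - of_nat p * x) / of_nat q) = (e i y - of_nat p * e i x) / of_nat q" by (simp add: e_simps)
  also have "\<dots> = cnj (e i x)" unfolding pq(3)[symmetric] using q by simp
  finally show ?thesis by (rule exI)
qed

text \<open>Since \<open>e i\<close> is injective, the homomorphism laws for a choice of preimages
  can be checked on images; conjugating twice shows that the chosen map is its own inverse.\<close>

lemma conj_automorphism:
  assumes "\<And>x. \<exists>z. e i z = cnj (e i x)"
  obtains t where "t \<in> ring_iso (class_ring :: 'a ring) class_ring" "\<And>x. e i (t x) = cnj (e i x)"
proof -
  have "\<forall>x. \<exists>z. e i z = cnj (e i x)" using assms by (rule allI)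
  from choice[OF this] obtain t where "\<forall>x. e i (t x) = cnj (e i x)" by (elim exE)
  then have t: "e i (t x) = cnj (e i x)" for x by (rule spec)
  have eqI: "a = c" if "e i a = e i c" for a c using that by (simp only: e_simps)
  have tt: "t (t x) = x" for x by (rule eqI) (simp add: t)
  have "t \<in> Ring.ring_hom (class_ring :: 'a ring) class_ring"
    by (rule ring_hom_memI) (auto intro!: eqI simp: t e_simps)
  moreover have "bij t" by (rule o_bij[of t]) (simp_all add: fun_eq_iff tt)
  ultimately have "t \<in> ring_iso (class_ring :: 'a ring) class_ring" by (simp add: ring_iso_def)
  then show ?thesis using t by (rule that)
qed

text \<open>Evaluates \<open>GREATEST\<close> with respect to inclusion. Every embedding of the set
  on the right extends to the whole field, so its values are real; conversely, the restriction of
  each \<open>e i\<close> to a totally real subfield shows that its elements have only real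
  conjugates.\<close>

lemma max_totally_real_subfield_eq:
  "max_totally_real_subfield = {x :: 'a. \<forall>i. e i x \<in> \<real>}" (is "_ = ?F")
  and class_subfield_real: "class_subfield {x :: 'a. \<forall>i. e i x \<in> \<real>}"
proof -
  show sub: "class_subfield ?F" by (simp add: subfield_class_ring_iff e_simps)
  have "totally_real ?F" unfolding totally_real_def
  proof
    fix \<sigma> assume "\<sigma> \<in> embeddings ?F"
    then have h: "ring_hom_on ?F \<sigma>" by (simp add: embeddings_iff)
    obtain \<tau> where t: "\<tau> \<in> embeddings UNIV" "\<And>y. y \<in> ?F \<Longrightarrow> \<tau> y = \<sigma> y" by (rule extend_hom[OF nf sub h], rule that)
    obtain i where i: "\<tau> = e i" using e_surj[OF t(1)] by (elim exE)
    show "\<sigma> ` ?F \<subseteq> \<real>"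
    proof (rule image_subsetI)
      fix y assume y: "y \<in> ?F"
      then have "\<sigma> y = e i y" using t(2)[OF y] i by simp
      then show "\<sigma> y \<in> \<real>" using y by simp
    qed
  qed
  moreover have "L \<subseteq> ?F" if L: "class_subfield L \<and> totally_real L" for L
  proof (intro subsetI CollectI allI)
    fix x i assume x: "x \<in> L"
    have "ring_hom_on L (restrict (e i) L)"
      using subfield_closed[OF L[THEN conjunct1]] by (auto simp: ring_hom_on_def e_simps)
    then have res: "restrict (e i) L \<in> embeddings L" by (simp add: embeddings_iff)
    have "restrict (e i) L ` L \<subseteq> \<real>"
      by (rule bspec[OF _ res]) (use L[THEN conjunct2] in \<open>simp only: totally_real_def\<close>)
    then show "e i x \<in> \<real>" using x by auto
  qed
  ultimately show "max_totally_real_subfield = ?F"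
    unfolding max_totally_real_subfield_def using sub by (intro Greatest_equality) auto
qed

end

theorem theorem1p3:
  fixes \<H> :: real and F :: "'a::field_char_0 set"
  assumes "number_field TYPE('a)"
    and "\<H> \<ge> 1"
    and "\<H> * field_constant TYPE('a)
           < Inf {weil_height \<alpha> | \<alpha>::'a. \<alpha> \<in> ring_of_integers \<and> adjoin_to_Rats \<alpha> = UNIV}"
    and "F = max_totally_real_subfield"
  shows "totally_complex (UNIV :: 'a set) \<and> galois_over F \<and>
    (\<forall>\<mu>\<in>ring_of_integers. weil_height \<mu> \<le> \<H> \<longrightarrow> \<mu> \<in> F)"
proof -
  let ?I = "Inf {weil_height \<alpha> | \<alpha>::'a. \<alpha> \<in> ring_of_integers \<and> adjoin_to_Rats \<alpha> = UNIV}"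
  have "card (UNIV :: 'a deg_index set) = card (embeddings (UNIV :: 'a set))"
    using card_deg_index[OF assms(1)] card_embeddings[OF assms(1)] by simp
  then obtain e :: "'a deg_index \<Rightarrow> 'a \<Rightarrow> complex" where "bij_betw e UNIV (embeddings UNIV)"
    using bij_betw_iff_card[OF finite finite_embeddings[OF assms(1)]] by blast
  then interpret embedding_enum e using assms(1) by unfold_locales
  have key: "conj_index i \<noteq> i \<and> e i \<mu> \<in> \<real> \<and>
      (\<exists>\<alpha>. e i \<alpha> \<in> \<real> \<and> (\<forall>j. e j \<alpha> = e i \<alpha> \<longrightarrow> j = i \<or> j = conj_index i))"
    if \<mu>: "algebraic_int \<mu>" "\<mu> \<noteq> 0" "weil_height \<mu> \<le> \<H>" for \<mu> i
  proof -
    obtain \<alpha> where \<alpha>: "algebraic_int \<alpha>" "\<alpha> \<noteq> 0"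
      and off: "\<forall>j\<in>- {i, conj_index i}. cmod (e j \<alpha>) < 1"
        "\<forall>j\<in>- {i, conj_index i}. cmod (e j (\<mu> * \<alpha>)) < 1"
      and small: "weil_height \<alpha> < ?I" "weil_height (\<mu> * \<alpha>) < ?I"
      by (rule exists_small_element[OF assms(3) \<mu>, of i], rule that)
    have a\<mu>: "algebraic_int (\<mu> * \<alpha>)" "\<mu> * \<alpha> \<noteq> 0" using \<mu> \<alpha> by (simp_all add: algebraic_int_add_mult)
    note r1 = non_generator_real[OF \<alpha> off(1) not_generator_if_small_height[OF \<alpha>(1) small(1)]]
    note r2 = non_generator_real[OF a\<mu> off(2) not_generator_if_small_height[OF a\<mu>(1) small(2)]]
    have "e i \<mu> = e i (\<mu> * \<alpha>) / e i \<alpha>" using \<alpha>(2) by (simp add: e_simps)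
    then have real: "e i \<mu> \<in> \<real>" using r1(2) r2(2) by simp
    have only: "j = i \<or> j = conj_index i" if "e j \<alpha> = e i \<alpha>" for j
    proof (rule ccontr)
      assume "\<not> ?thesis"
      then have "cmod (e j \<alpha>) < 1" using off(1) by simp
      moreover have "cmod (e i \<alpha>) \<ge> 1" by (rule dominant_ge_1(1)[OF \<alpha> off(1)])
      ultimately show False using that by simp
    qed
    show ?thesis by (intro conjI r1(1) real exI[of _ \<alpha>] r1(2) allI impI only)
  qed
  \<comment> \<open>The element \<open>1\<close> satisfies the height bound because
    \<open>\<H> \<ge> 1\<close>; this instance yields the statements that concern the field
    alone.\<close>
  have "weil_height (1 :: 'a) = 1" by (simp add: weil_height_algebraic_int e_simps)
  then have key1: "conj_index i \<noteq> i" "\<exists>\<alpha>. e i \<alpha> \<in> \<real> \<and> (\<forall>j. e j \<alpha> = e i \<alpha> \<longrightarrow> j = i \<or> j = conj_index i)" for i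
    using key[of 1 i] assms(2) by simp_all
  have complex: "totally_complex (UNIV :: 'a set)"
    unfolding totally_complex_def
  proof
    fix \<sigma> :: "'a \<Rightarrow> complex" assume "\<sigma> \<in> embeddings UNIV"
    then obtain i where "\<sigma> = e i" using e_surj[of \<sigma>] by auto
    then show "\<not> range \<sigma> \<subseteq> \<real>" using key1(1)[of i] conj_index_eq_iff[of i] by simp
  qed
  have F: "F = {x. \<forall>i. e i x \<in> \<real>}" by (simp add: assms(4) max_totally_real_subfield_eq)
  have sub: "class_subfield F" unfolding F by (rule class_subfield_real)
  have fixed: "x \<in> F" if x: "\<forall>\<tau>\<in>field_automorphisms F. \<tau> x = x" for x
    unfolding F
  proof (intro CollectI allI)
    fix i
    obtain \<alpha> where \<alpha>: "e i \<alpha> \<in> \<real>" "\<forall>j. e j \<alpha> = e i \<alpha> \<longrightarrow> j = i \<or> j = conj_index i"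
      using key1(2)[of i] by (elim exE conjE)
    have conj: "\<exists>z. e i z = cnj (e i x)" for x
      by (rule conj_in_range[OF \<alpha>(1) \<alpha>(2)])
    obtain t where t: "t \<in> ring_iso (class_ring :: 'a ring) class_ring" "\<And>x. e i (t x) = cnj (e i x)"
      by (rule conj_automorphism[OF conj], rule that)
    \<comment> \<open>Conjugation fixes the real number \<open>e i y\<close>, and injectivity of
      \<open>e i\<close> lifts this to the field.\<close>
    have "t y = y" if "y \<in> F" for y
    proof -
      have "e i y \<in> \<real>" using that F by simp
      then have "e i (t y) = e i y" unfolding t(2) by (simp only: Reals_cnj_iff)
      then show ?thesis by (simp only: e_simps)
    qed
    then have "t \<in> field_automorphisms F" using t(1) by (simp add: field_automorphisms_def)
    then have "t x = x" by (rule bspec[OF x])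
    then have "cnj (e i x) = e i x" using t(2)[of x] by simp
    then show "e i x \<in> \<real>" by (simp add: Reals_cnj_iff)
  qed
  have "{x. \<forall>\<tau>\<in>field_automorphisms F. \<tau> x = x} = F"
  proof (intro equalityI subsetI)
    fix x assume "x \<in> {x. \<forall>\<tau>\<in>field_automorphisms F. \<tau> x = x}"
    then show "x \<in> F" by (intro fixed) simp
  next
    fix x assume "x \<in> F"
    then show "x \<in> {x. \<forall>\<tau>\<in>field_automorphisms F. \<tau> x = x}" by (simp add: field_automorphisms_def)
  qed
  then have galois: "galois_over F"
    unfolding galois_over_def by (intro conjI allI sub algebraic_over_subfield[OF assms(1) sub])
  have small: "\<mu> \<in> F" if "\<mu> \<in> ring_of_integers" "weil_height \<mu> \<le> \<H>" for \<mu>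
  proof (cases "\<mu> = 0")
    case True then show ?thesis using subfield_closed(2)[OF sub] by simp
  next
    case False
    then have "e i \<mu> \<in> \<real>" for i using key[of \<mu> i] that by (simp add: ring_of_integers_def)
    then show ?thesis by (simp add: F)
  qed
  show ?thesis by (intro conjI ballI impI complex galois small)
qed

end
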